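(* Let $T>0$, $\nu>0$, and let $(\mathcal{F}'_t)_{t\in[0,T]}$ be a filtration. Let $\eta:[0,T]\times\mathbb{R}^n\times\Omega\to\mathbb{R}^n$, $F:[0,T]\times\mathbb{R}^n\times\mathbb{R}^n\times\Omega\to\mathbb{R}^n$ and $h:\mathbb{R}^n\times\Omega\to\mathbb{R}^n$ be random functions such that for each fixed $(x,y)\in\mathbb{R}^{2n}$ the processes $\eta(t,x)$ and $F(t,x,y)$ are $\mathcal{F}'_t$-adapted, $h(x)$ is $\mathcal{F}'_0$-measurable, and for almost every $\omega$, $\eta\in{\rm C}^{0,2}_b([0,T]\times\mathbb{R}^n)$, $F\in{\rm C}^{0,2}_b([0,T]\times\mathbb{R}^{2n})$, $h\in{\rm C}^2_b(\mathbb{R}^n)$, with norms bounded by deterministic constants. Let $K$ and $C$ be the constants defined in the context. Then there exists a constant $\gamma_{K,C}>0$, depending only on $K$ and $C$, such that on $[T-\gamma_{K,C},T]$ there exists an $\mathcal{F}'_{T-t}$-adapted solution $\bar y(t,x)$, of class ${\rm C}^{1,2}_b$, of the backward equation \[ \bar y(t,x)=h(x)+\int_t^T\big[\nu\Delta\bar y(s,x)-(\bar\eta(s,x)+\bar y(s,x),\nabla)\bar y(s,x)+\bar F(s,x,\bar y(s,x))\big]\,ds, \] where $\bar\eta(t,x)=\eta(T-t,x)$ and $\bar F(t,x,y)=F(T-t,x,y)$.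
   Context: ${\rm C}^{0,l}_b$ denotes functions bounded and continuous in all variables together with their spatial derivatives (in $x$, resp. $(x,y)$) up to order $l$; ${\rm C}^{1,2}_b$ denotes bounded functions with bounded continuous $\partial_t$ and spatial derivatives up to order 2. $(u,\nabla)v=\sum_j u_j\partial_{x_j}v$. Let $\Omega_0$ be a full-measure set on which the regularity and deterministic bounds hold. The constants are $K=\sup_{\Omega_0\times\mathbb{R}^n}|\nabla h|+\sup_{\Omega_0\times[0,T]\times\mathbb{R}^n}|\partial_x\eta|+\sup_{\Omega_0\times[0,T]\times\mathbb{R}^{2n}}(|\partial_xF|+|\partial_yF|)$ and $C=\sup_{\Omega_0\times\mathbb{R}^n}|\nabla^2h|+\sup_{\Omega_0\times[0,T]\times\mathbb{R}^n}|\partial^2_{xx}\eta|+\sup_{\Omega_0\times[0,T]\times\mathbb{R}^{2n}}(|\partial^2_{xx}F|+|\partial^2_{yy}F|+|\partial^2_{xy}F|)$. *)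

theory Defs
  imports "HOL-Probability.Probability"
begin

(* Partial derivative of g at z in direction d, relative to the domain S
   (one-sided at boundary points of S along the line z + s d). *)
definition pd_exists :: "'v::real_normed_vector set \<Rightarrow> ('v \<Rightarrow> 'b::real_normed_vector) \<Rightarrow> 'v \<Rightarrow> 'v \<Rightarrow> bool" where
  "pd_exists S g d z \<longleftrightarrow> (\<lambda>s::real. g (z + s *\<^sub>R d)) differentiable (at 0 within {s. z + s *\<^sub>R d \<in> S})"

definition pd :: "'v::real_normed_vector set \<Rightarrow> ('v \<Rightarrow> 'b::real_normed_vector) \<Rightarrow> 'v \<Rightarrow> 'v \<Rightarrow> 'b" where
  "pd S g d z = vector_derivative (\<lambda>s::real. g (z + s *\<^sub>R d)) (at 0 within {s. z + s *\<^sub>R d \<in> S})"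

fun Cb :: "'v::real_normed_vector set \<Rightarrow> 'v set \<Rightarrow> nat \<Rightarrow> ('v \<Rightarrow> 'b::real_normed_vector) \<Rightarrow> bool" where
  "Cb S D 0 g = (continuous_on S g \<and> bounded (g ` S))"
| "Cb S D (Suc l) g = (Cb S D l g \<and> (\<forall>d\<in>D. \<forall>z\<in>S. pd_exists S g d z) \<and> (\<forall>d\<in>D. Cb S D l (pd S g d)))"

fun Cb_bound :: "'v::real_normed_vector set \<Rightarrow> 'v set \<Rightarrow> nat \<Rightarrow> ('v \<Rightarrow> 'b::real_normed_vector) \<Rightarrow> real \<Rightarrow> bool" where
  "Cb_bound S D 0 g B = (\<forall>z\<in>S. norm (g z) \<le> B)"
| "Cb_bound S D (Suc l) g B = (Cb_bound S D l g B \<and> (\<forall>d\<in>D. Cb_bound S D l (pd S g d) B))"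

definition gnorm :: "'v::real_normed_vector set \<Rightarrow> ('v \<Rightarrow> 'b::real_normed_vector) \<Rightarrow> ('n::finite \<Rightarrow> 'v) \<Rightarrow> 'v \<Rightarrow> real" where
  "gnorm S g e z = sqrt (\<Sum>i\<in>UNIV. (norm (pd S g (e i) z))\<^sup>2)"

definition hnorm :: "'v::real_normed_vector set \<Rightarrow> ('v \<Rightarrow> 'b::real_normed_vector) \<Rightarrow> ('n::finite \<Rightarrow> 'v) \<Rightarrow> ('n \<Rightarrow> 'v) \<Rightarrow> 'v \<Rightarrow> real" where
  "hnorm S g e1 e2 z = sqrt (\<Sum>i\<in>UNIV. \<Sum>j\<in>UNIV. (norm (pd S (pd S g (e2 j)) (e1 i) z))\<^sup>2)"

definition eh :: "'n::finite \<Rightarrow> real^'n" where "eh i = axis i 1"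
definition eeta :: "'n::finite \<Rightarrow> real \<times> (real^'n)" where "eeta i = (0, axis i 1)"
definition eFx :: "'n::finite \<Rightarrow> real \<times> ((real^'n) \<times> (real^'n))" where "eFx i = (0, (axis i 1, 0))"
definition eFy :: "'n::finite \<Rightarrow> real \<times> ((real^'n) \<times> (real^'n))" where "eFy i = (0, (0, axis i 1))"

definition eta_u :: "(real \<Rightarrow> real^'n \<Rightarrow> 'w \<Rightarrow> real^'n) \<Rightarrow> 'w \<Rightarrow> real \<times> (real^'n) \<Rightarrow> real^'n" where
  "eta_u \<eta> \<omega> z = \<eta> (fst z) (snd z) \<omega>"
definition F_u :: "(real \<Rightarrow> real^'n \<Rightarrow> real^'n \<Rightarrow> 'w \<Rightarrow> real^'n) \<Rightarrow> 'w \<Rightarrow> real \<times> ((real^'n) \<times> (real^'n)) \<Rightarrow> real^'n" where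
  "F_u F \<omega> z = F (fst z) (fst (snd z)) (snd (snd z)) \<omega>"

definition filtration_on :: "'w measure \<Rightarrow> real \<Rightarrow> (real \<Rightarrow> 'w measure) \<Rightarrow> bool" where
  "filtration_on M T Fl \<longleftrightarrow> (\<forall>t\<in>{0..T}. subalgebra M (Fl t)) \<and>
     (\<forall>s t. 0 \<le> s \<longrightarrow> s \<le> t \<longrightarrow> t \<le> T \<longrightarrow> sets (Fl s) \<subseteq> sets (Fl t))"

definition setting ::
  "'w measure \<Rightarrow> (real \<Rightarrow> 'w measure) \<Rightarrow> real \<Rightarrow> real \<Rightarrow>
   (real \<Rightarrow> real^'n::finite \<Rightarrow> 'w \<Rightarrow> real^'n) \<Rightarrow>
   (real \<Rightarrow> real^'n \<Rightarrow> real^'n \<Rightarrow> 'w \<Rightarrow> real^'n) \<Rightarrow>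
   (real^'n \<Rightarrow> 'w \<Rightarrow> real^'n) \<Rightarrow> 'w set \<Rightarrow> bool" where
  "setting M Fl T \<nu> \<eta> F h \<Omega>0 \<longleftrightarrow>
     prob_space M \<and> T > 0 \<and> \<nu> > 0 \<and> filtration_on M T Fl \<and>
     (\<forall>t\<in>{0..T}. \<forall>x. (\<lambda>\<omega>. \<eta> t x \<omega>) \<in> borel_measurable (Fl t)) \<and>
     (\<forall>t\<in>{0..T}. \<forall>x y. (\<lambda>\<omega>. F t x y \<omega>) \<in> borel_measurable (Fl t)) \<and>
     (\<forall>x. (\<lambda>\<omega>. h x \<omega>) \<in> borel_measurable (Fl 0)) \<and>
     \<Omega>0 \<in> sets M \<and> \<Omega>0 \<subseteq> space M \<and> emeasure M \<Omega>0 = emeasure M (space M) \<and>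
     (\<forall>\<omega>\<in>\<Omega>0.
        Cb ({0..T} \<times> UNIV) (range eeta) 2 (eta_u \<eta> \<omega>) \<and>
        Cb ({0..T} \<times> UNIV) (range eFx \<union> range eFy) 2 (F_u F \<omega>) \<and>
        Cb UNIV (range eh) 2 (\<lambda>x. h x \<omega>)) \<and>
     (\<exists>B. \<forall>\<omega>\<in>\<Omega>0.
        Cb_bound ({0..T} \<times> UNIV) (range eeta) 2 (eta_u \<eta> \<omega>) B \<and>
        Cb_bound ({0..T} \<times> UNIV) (range eFx \<union> range eFy) 2 (F_u F \<omega>) B \<and>
        Cb_bound UNIV (range eh) 2 (\<lambda>x. h x \<omega>) B)"

definition Kconst ::
  "real \<Rightarrow> (real \<Rightarrow> real^'n::finite \<Rightarrow> 'w \<Rightarrow> real^'n) \<Rightarrow>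
   (real \<Rightarrow> real^'n \<Rightarrow> real^'n \<Rightarrow> 'w \<Rightarrow> real^'n) \<Rightarrow>
   (real^'n \<Rightarrow> 'w \<Rightarrow> real^'n) \<Rightarrow> 'w set \<Rightarrow> real" where
  "Kconst T \<eta> F h \<Omega>0 =
     (SUP p\<in>\<Omega>0 \<times> UNIV. gnorm UNIV (\<lambda>x. h x (fst p)) eh (snd p))
   + (SUP p\<in>\<Omega>0 \<times> ({0..T} \<times> UNIV). gnorm ({0..T} \<times> UNIV) (eta_u \<eta> (fst p)) eeta (snd p))
   + (SUP p\<in>\<Omega>0 \<times> ({0..T} \<times> UNIV).
        gnorm ({0..T} \<times> UNIV) (F_u F (fst p)) eFx (snd p)
      + gnorm ({0..T} \<times> UNIV) (F_u F (fst p)) eFy (snd p))"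

definition Cconst ::
  "real \<Rightarrow> (real \<Rightarrow> real^'n::finite \<Rightarrow> 'w \<Rightarrow> real^'n) \<Rightarrow>
   (real \<Rightarrow> real^'n \<Rightarrow> real^'n \<Rightarrow> 'w \<Rightarrow> real^'n) \<Rightarrow>
   (real^'n \<Rightarrow> 'w \<Rightarrow> real^'n) \<Rightarrow> 'w set \<Rightarrow> real" where
  "Cconst T \<eta> F h \<Omega>0 =
     (SUP p\<in>\<Omega>0 \<times> UNIV. hnorm UNIV (\<lambda>x. h x (fst p)) eh eh (snd p))
   + (SUP p\<in>\<Omega>0 \<times> ({0..T} \<times> UNIV). hnorm ({0..T} \<times> UNIV) (eta_u \<eta> (fst p)) eeta eeta (snd p))
   + (SUP p\<in>\<Omega>0 \<times> ({0..T} \<times> UNIV).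
        hnorm ({0..T} \<times> UNIV) (F_u F (fst p)) eFx eFx (snd p)
      + hnorm ({0..T} \<times> UNIV) (F_u F (fst p)) eFy eFy (snd p)
      + hnorm ({0..T} \<times> UNIV) (F_u F (fst p)) eFx eFy (snd p))"

definition is_solution ::
  "'w measure \<Rightarrow> (real \<Rightarrow> 'w measure) \<Rightarrow> real \<Rightarrow> real \<Rightarrow>
   (real \<Rightarrow> real^'n::finite \<Rightarrow> 'w \<Rightarrow> real^'n) \<Rightarrow>
   (real \<Rightarrow> real^'n \<Rightarrow> real^'n \<Rightarrow> 'w \<Rightarrow> real^'n) \<Rightarrow>
   (real^'n \<Rightarrow> 'w \<Rightarrow> real^'n) \<Rightarrow> real \<Rightarrow>
   (real \<Rightarrow> real^'n \<Rightarrow> 'w \<Rightarrow> real^'n) \<Rightarrow> bool" where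
  "is_solution M Fl T \<nu> \<eta> F h T0 yb \<longleftrightarrow>
     (\<forall>t\<in>{T0..T}. \<forall>x. (\<lambda>\<omega>. yb t x \<omega>) \<in> borel_measurable (Fl (T - t))) \<and>
     (AE \<omega> in M.
        (let S = {T0..T} \<times> (UNIV :: (real^'n) set);
             Y = eta_u yb \<omega> in
          Cb S (range eeta) 2 Y \<and>
          (\<forall>z\<in>S. pd_exists S Y (1, 0) z) \<and>
          Cb S (range eeta) 0 (pd S Y (1, 0)) \<and>
          (\<forall>t\<in>{T0..T}. \<forall>x.
             ((\<lambda>s. \<nu> *\<^sub>R (\<Sum>i\<in>UNIV. pd S (pd S Y (eeta i)) (eeta i) (s, x))
                  - (\<Sum>j\<in>UNIV. ((\<eta> (T - s) x \<omega> + yb s x \<omega>) $ j) *\<^sub>R pd S Y (eeta j) (s, x))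
                  + F (T - s) x (yb s x \<omega>) \<omega>)
              has_integral (yb t x \<omega> - h x \<omega>)) {t..T})))"

end

theory Submission
  imports Defs
begin

text \<open>
  Reverse time and write \<open>u(t) = y(T - t)\<close>, so that \<open>u\<close> solves a forward Burgers type equation with initial
  value \<open>h\<close>. Truncate the gradient in the transport term at a level \<open>R\<close>. The truncated equation has a mild
  solution: its Duhamel formulation, written for \<open>u\<close> together with its first and second space derivatives, is
  a contraction for a sup norm with weight \<open>exp (\<mu> t)\<close>, since after the substitution \<open>t - s = \<rho>\<^sup>2\<close> the heat
  kernel and its gradient have no singularity.

  The lifespan is independent of \<open>\<nu>\<close> and of the sup norms of the data because the Lipschitz constant of \<open>u\<close> is
  controlled by a maximum principle with doubled variables: at a maximum of
  \<open>u\<^sub>k(x) - u\<^sub>k(y) - L(t) |x - y|\<close> the two gradients agree, and moving \<open>x\<close> and \<open>y\<close> together shows that the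
  Laplacians contribute with a favourable sign. As long as \<open>L(t) \<le> R\<close>, which holds up to a time depending
  only on \<open>K\<close> and the dimension, the truncation is inactive.

  Adaptedness holds because the solution is a pointwise limit of Picard iterates. The iteration is only
  meaningful on the full measure set \<open>\<Omega>0\<close>, so measurability is first shown for the trace of the filtration on
  \<open>\<Omega>0\<close> (which need not contain \<open>\<Omega>0\<close>), and the values are then extended measurably to the whole space.
\<close>

section \<open>Dominated convergence, measurability and Picard iteration\<close>

text \<open>The data have only two spatial derivatives, so the nonlinearity can be differentiated
  once and no more: its gradient already contains the Hessian of the unknown. The Hessian is
  therefore an unknown of its own, and the last derivative is put on the heat kernel. This costs a
  factor of order \<open>1 / (sqrt t * \<theta>)\<close>, which the Jacobian
  \<open>2 * t * \<theta>\<close> of the time substitution absorbs.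

  The truncation has a second purpose. With it the nonlinearity grows at most linearly in the
  solution, and its gradient grows at most linearly in the first and second derivatives once the
  solution is bounded. An invariant set then exists on a time interval of any prescribed length; all
  smallness comes from a large weight, none from a short time.

  Space is not compact, so the doubled functional is penalised by a small multiple \<epsilon> of a
  function with linear growth. The viscosity and the sup norms of the data enter the resulting
  estimate only through an error proportional to \<epsilon>, and \<epsilon> tends to 0 with the
  points held fixed.\<close>

lemma continuous_on_integral_dominated:
  fixes G :: "'a::metric_space \<Rightarrow> 'p \<Rightarrow> real"
  assumes "\<And>a. a \<in> A \<Longrightarrow> G a \<in> borel_measurable P"
    and "\<And>w. w \<in> space P \<Longrightarrow> continuous_on A (\<lambda>a. G a w)"
    and "integrable P W"
    and "\<And>a w. a \<in> A \<Longrightarrow> w \<in> space P \<Longrightarrow> \<bar>G a w\<bar> \<le> W w"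
  shows "continuous_on A (\<lambda>a. \<integral>w. G a w \<partial>P)"
proof (rule continuous_on_sequentiallyI)
  fix u a assume u: "\<forall>n. u n \<in> A" "a \<in> A" "u \<longlonglongrightarrow> a"
  show "(\<lambda>n. \<integral>w. G (u n) w \<partial>P) \<longlonglongrightarrow> (\<integral>w. G a w \<partial>P)"
  proof (rule integral_dominated_convergence[where w=W])
    show "AE w in P. (\<lambda>i. G (u i) w) \<longlonglongrightarrow> G a w"
    proof (rule AE_I2)
      fix w assume "w \<in> space P"
      from assms(2)[OF this] show "(\<lambda>i. G (u i) w) \<longlonglongrightarrow> G a w"
        using u by (auto simp: continuous_on_sequentially comp_def)
    qed
  qed (use assms u in auto)
qed

text \<open>Difference quotients inherit the bound \<open>W\<close> from the derivative by the mean
  value inequality, so dominated convergence applies. The derivative is controlled only for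
  \<open>\<bar>s\<bar> < d\<close> because the Gaussian densities met later are dominated only for
  small shifts.\<close>

lemma has_real_derivative_integral_dominated:
  fixes G G' :: "real \<Rightarrow> 'p \<Rightarrow> real"
  assumes d: "0 < d"
    and G: "\<And>s. integrable P (G s)"
    and G': "G' 0 \<in> borel_measurable P"
    and der: "\<And>s w. \<bar>s\<bar> < d \<Longrightarrow> w \<in> space P \<Longrightarrow> ((\<lambda>s. G s w) has_real_derivative G' s w) (at s)"
    and W: "integrable P W"
    and bd: "\<And>s w. \<bar>s\<bar> < d \<Longrightarrow> w \<in> space P \<Longrightarrow> \<bar>G' s w\<bar> \<le> W w"
  shows "((\<lambda>s. \<integral>w. G s w \<partial>P) has_real_derivative (\<integral>w. G' 0 w \<partial>P)) (at 0)"
proof -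
  have mvt: "\<bar>(G s w - G 0 w) / s\<bar> \<le> W w" if "\<bar>s\<bar> < d" "s \<noteq> 0" "w \<in> space P" for s w
  proof -
    have "norm (G s w - G 0 w) \<le> W w * norm (s - 0)"
    proof (rule field_differentiable_bound[where S="{-\<bar>s\<bar>..\<bar>s\<bar>}" and f'="\<lambda>s. G' s w"])
      fix z assume "z \<in> {-\<bar>s\<bar>..\<bar>s\<bar>}"
      then have "\<bar>z\<bar> < d" using that by auto
      then show "((\<lambda>s. G s w) has_field_derivative G' z w) (at z within {-\<bar>s\<bar>..\<bar>s\<bar>})"
        "norm (G' z w) \<le> W w"
        using der bd that by (auto intro: has_field_derivative_at_within)
    qed auto
    then show ?thesis using that by (simp add: field_simps abs_div)
  qed
  show ?thesis
    unfolding has_field_derivative_iff tendsto_at_iff_sequentially comp_def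
  proof (intro allI impI)
    fix X :: "nat \<Rightarrow> real" assume X: "\<forall>i. X i \<in> UNIV - {0}" "X \<longlonglongrightarrow> 0"
    then have "\<forall>\<^sub>F n in sequentially. \<bar>X n\<bar> < d"
      using d by (auto simp: tendsto_iff dist_real_def)
    \<comment> \<open>Domination holds only for arguments below \<open>d\<close>, so the limit is
      taken along a tail of the sequence and shifted back afterwards.\<close>
    then obtain N where N: "\<And>n. n \<ge> N \<Longrightarrow> \<bar>X n\<bar> < d"
      by (auto simp: eventually_sequentially)
    have "(\<lambda>n. \<integral>w. (G (X (n+N)) w - G 0 w) / X (n+N) \<partial>P) \<longlonglongrightarrow> (\<integral>w. G' 0 w \<partial>P)"
    proof (rule integral_dominated_convergence[where w=W])
      show "AE w in P. (\<lambda>n. (G (X (n+N)) w - G 0 w) / X (n+N)) \<longlonglongrightarrow> G' 0 w"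
      proof (rule AE_I2)
        fix w assume "w \<in> space P"
        then have "((\<lambda>s. G s w) has_real_derivative G' 0 w) (at 0)" using der d by auto
        then have "(\<lambda>n. (G (X n) w - G 0 w) / X n) \<longlonglongrightarrow> G' 0 w"
          using X unfolding has_field_derivative_iff tendsto_at_iff_sequentially comp_def by auto
        then show "(\<lambda>n. (G (X (n+N)) w - G 0 w) / X (n+N)) \<longlonglongrightarrow> G' 0 w"
          by (rule LIMSEQ_ignore_initial_segment)
      qed
      show "AE w in P. norm ((G (X (n+N)) w - G 0 w) / X (n+N)) \<le> W w" for n
        using mvt[of "X (n+N)"] N[of "n+N"] X by (auto intro!: AE_I2)
    qed (use G G' W in \<open>auto intro!: borel_measurable_integrable\<close>)
    moreover have "(\<integral>w. (G (X (n+N)) w - G 0 w) / X (n+N) \<partial>P)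
       = ((\<integral>w. G (X (n+N)) w \<partial>P) - (\<integral>w. G 0 w \<partial>P)) / X (n+N)" for n
      using G by simp
    ultimately have "(\<lambda>n. ((\<integral>w. G (X (n+N)) w \<partial>P) - (\<integral>w. G 0 w \<partial>P)) / X (n+N)) \<longlonglongrightarrow> (\<integral>w. G' 0 w \<partial>P)"
      by (simp only:)
    then have "(\<lambda>n. ((\<integral>w. G (X n) w \<partial>P) - (\<integral>w. G 0 w \<partial>P)) / X n) \<longlonglongrightarrow> (\<integral>w. G' 0 w \<partial>P)"
      by (rule LIMSEQ_offset)
    then show "(\<lambda>n. ((\<integral>w. G (X n) w \<partial>P) - (\<integral>w. G 0 w \<partial>P)) / (X n - 0)) \<longlonglongrightarrow> (\<integral>w. G' 0 w \<partial>P)"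
      by simp
  qed
qed

text \<open>Approximate \<open>g\<close> by functions with countably many values taken from a dense
  sequence: each approximant is measurable, and continuity of \<open>f\<close> in its first argument
  passes the composition to the limit. This is how the random solution is inserted into the random
  coefficients, and how joint measurability is obtained for parameter integrals.\<close>

lemma measurable_caratheodory_compose:
  fixes f :: "'a::{metric_space,second_countable_topology} \<Rightarrow> 'w \<Rightarrow> 'b::metric_space"
  assumes f: "\<And>x. f x \<in> borel_measurable N"
    and cont: "\<And>w. w \<in> space N \<Longrightarrow> continuous_on UNIV (\<lambda>x. f x w)"
    and g[measurable]: "g \<in> borel_measurable N"
  shows "(\<lambda>w. f (g w) w) \<in> borel_measurable N"
proof -
  obtain D :: "'a set" where D: "countable D" "\<And>X. open X \<Longrightarrow> X \<noteq> {} \<Longrightarrow> \<exists>d\<in>D. d \<in> X"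
    using countable_dense_exists by metis
  have Dne: "D \<noteq> {}" using D(2)[of UNIV] by auto
  define q where "q = from_nat_into D"
  \<comment> \<open>Index of the first dense point at distance less than \<open>1 / Suc m\<close>
    from \<open>g w\<close>; being a least index, it depends measurably on \<open>w\<close>.\<close>
  define k where "k m w = (LEAST n. dist (q n) (g w) < 1 / Suc m)" for m w
  have near: "dist (q (k m w)) (g w) < 1 / Suc m" for m w
  proof -
    have "ball (g w) (1 / Suc m) \<noteq> {}" by simp
    then obtain d where "d \<in> D" "d \<in> ball (g w) (1 / Suc m)" using D(2)[of "ball (g w) (1 / Suc m)"] by auto
    then have "\<exists>n. dist (q n) (g w) < 1 / Suc m"
      using from_nat_into_surj[OF D(1)] unfolding q_def by (metis dist_commute mem_ball)
    then show ?thesis unfolding k_def by (rule LeastI_ex)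
  qed
  have "(\<lambda>m. q (k m w)) \<longlonglongrightarrow> g w" for w
  proof (rule metric_tendsto_imp_tendsto)
    show "(\<lambda>m. 1 / real (Suc m)) \<longlonglongrightarrow> 0" by (rule LIMSEQ_Suc, rule lim_1_over_n)
    show "\<forall>\<^sub>F m in sequentially. dist (q (k m w)) (g w) \<le> dist (1 / real (Suc m)) 0"
      using near[of _ w] by (intro always_eventually allI) (simp add: less_imp_le)
  qed
  then have lim: "(\<lambda>m. f (q (k m w)) w) \<longlonglongrightarrow> f (g w) w" if "w \<in> space N" for w
    using cont[OF that] by (auto simp: continuous_on_sequentially comp_def)
  have [measurable]: "k m \<in> N \<rightarrow>\<^sub>M count_space UNIV" for m
    unfolding k_def by measurable
  show ?thesis
  proof (rule borel_measurable_LIMSEQ_metric[OF _ lim])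
    show "(\<lambda>w. f (q (k m w)) w) \<in> borel_measurable N" for m
      by (rule measurable_compose_countable[where f="\<lambda>n w. f (q n) w"]) (use f in auto)
  qed
qed

text \<open>Each superlevel set at a rational level is the trace of some set of \<open>N\<close>,
  and a function is recovered from these sets as a supremum of rationals. Since
  \<open>\<Omega>0\<close> itself need not belong to \<open>N\<close>, extending by 0 outside
  \<open>\<Omega>0\<close> would not be measurable.\<close>

lemma borel_measurable_restrict_extend:
  fixes f :: "'w \<Rightarrow> real"
  assumes f: "f \<in> borel_measurable (restrict_space N \<Omega>0)" and sub: "\<Omega>0 \<subseteq> space N"
  shows "\<exists>g\<in>borel_measurable N. \<forall>w\<in>\<Omega>0. g w = f w"
proof -
  have "\<exists>A\<in>sets N. {w\<in>\<Omega>0. f w > real_of_rat q} = \<Omega>0 \<inter> A" for q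
  proof -
    have "{w \<in> space (restrict_space N \<Omega>0). f w > real_of_rat q} \<in> sets (restrict_space N \<Omega>0)"
      using f by measurable
    then show ?thesis using sub by (auto simp: sets_restrict_space space_restrict_space Int_absorb2)
  qed
  then obtain A where A: "\<And>q. A q \<in> sets N" "\<And>q. {w\<in>\<Omega>0. f w > real_of_rat q} = \<Omega>0 \<inter> A q"
    by metis
  \<comment> \<open>Outside \<open>\<Omega>0\<close> this supremum may be infinite, so it is formed
    in the extended reals and cut back to a real value at the end.\<close>
  define g where "g w = (SUP q. if w \<in> A q then ereal (real_of_rat q) else - \<infinity>)" for w
  have "g \<in> borel_measurable N" unfolding g_def using A(1) by (intro borel_measurable_SUP) auto
  then have m: "(\<lambda>w. real_of_ereal (g w)) \<in> borel_measurable N" by measurable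
  have "g w = ereal (f w)" if w: "w \<in> \<Omega>0" for w
  proof -
    have iff: "w \<in> A q \<longleftrightarrow> real_of_rat q < f w" for q using A(2)[of q] w by auto
    show ?thesis unfolding g_def iff
    proof (rule antisym)
      show "(SUP q. if real_of_rat q < f w then ereal (real_of_rat q) else - \<infinity>) \<le> ereal (f w)"
        by (intro SUP_least) auto
      show "ereal (f w) \<le> (SUP q. if real_of_rat q < f w then ereal (real_of_rat q) else - \<infinity>)"
      proof (rule dense_le)
        fix y assume y: "y < ereal (f w)"
        then obtain r where r: "y < ereal r" "r < f w"
          using ereal_dense2[OF y] by auto
        obtain q where q: "r < real_of_rat q" "real_of_rat q < f w" using of_rat_dense[OF r(2)] by auto
        have "y \<le> ereal (real_of_rat q)" using less_trans[OF r(1), of "ereal (real_of_rat q)"] q(1) by simp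
        also have "\<dots> \<le> (SUP q. if real_of_rat q < f w then ereal (real_of_rat q) else - \<infinity>)"
          by (rule SUP_upper2[of q]) (use q in auto)
        finally show "y \<le> (SUP q. if real_of_rat q < f w then ereal (real_of_rat q) else - \<infinity>)" .
      qed
    qed
  qed
  then show ?thesis using m by (intro bexI[of _ "\<lambda>w. real_of_ereal (g w)"]) auto
qed

text \<open>Banach's fixed point theorem for the sup norm weighted by \<open>w\<close>. The
  functions are controlled on \<open>S\<close> only, hence the equation holds on \<open>S\<close>
  only. Convergence of the iterates from the given start is part of the conclusion, because
  measurability of the fixed point will be read off from them.\<close>

lemma picard_iteration_converges:
  fixes \<Phi> :: "('a \<Rightarrow> real) \<Rightarrow> ('a \<Rightarrow> real)" and w :: "'a \<Rightarrow> real"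
  assumes U0: "U0 \<in> \<A>" and inv: "\<And>U. U \<in> \<A> \<Longrightarrow> \<Phi> U \<in> \<A>"
    and w: "\<And>a. a \<in> S \<Longrightarrow> 0 \<le> w a \<and> w a \<le> W"
    and start: "\<And>a. a \<in> S \<Longrightarrow> \<bar>\<Phi> U0 a - U0 a\<bar> \<le> D0 * w a" "0 \<le> D0"
    and contr: "\<And>U V D. U \<in> \<A> \<Longrightarrow> V \<in> \<A> \<Longrightarrow> 0 \<le> D \<Longrightarrow> (\<And>a. a \<in> S \<Longrightarrow> \<bar>U a - V a\<bar> \<le> D * w a) \<Longrightarrow>
        (\<And>a. a \<in> S \<Longrightarrow> \<bar>\<Phi> U a - \<Phi> V a\<bar> \<le> (D / 2) * w a)"
    and closed: "\<And>X U. (\<And>m::nat. X m \<in> \<A>) \<Longrightarrow> uniform_limit S X U sequentially \<Longrightarrow> U \<in> \<A>"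
  obtains U where "U \<in> \<A>" "\<And>a. a \<in> S \<Longrightarrow> \<Phi> U a = U a"
    "\<And>a. a \<in> S \<Longrightarrow> (\<lambda>m. (\<Phi> ^^ m) U0 a) \<longlonglongrightarrow> U a"
proof -
  define X where "X m = (\<Phi> ^^ m) U0" for m
  have XS: "X (Suc m) = \<Phi> (X m)" for m by (simp add: X_def)
  have XA: "X m \<in> \<A>" for m by (induction m) (auto simp: X_def U0 inv)
  have step: "\<bar>X (Suc m) a - X m a\<bar> \<le> (D0 / 2^m) * w a" if "a \<in> S" for m a
    using that
  proof (induction m arbitrary: a)
    case 0 then show ?case using start by (simp add: X_def)
  next
    case (Suc m)
    have "\<bar>\<Phi> (X (Suc m)) a - \<Phi> (X m) a\<bar> \<le> ((D0/2^m) / 2) * w a"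
      by (rule contr[OF XA XA _ _ Suc.prems]) (use start Suc.IH in auto)
    then show ?case by (simp add: XS field_simps)
  qed
  have W0: "0 \<le> W" if "a \<in> S" for a using w[OF that] by linarith
  \<comment> \<open>The last factor is the partial geometric sum; without it the bound would not
    carry the induction on \<open>k\<close>.\<close>
  have diff: "\<bar>X (m+k) a - X m a\<bar> \<le> (2 * D0 / 2^m) * w a * (1 - 1/2^k)" if a: "a \<in> S" for m k a
  proof (induction k)
    case (Suc k)
    have "\<bar>X (m + Suc k) a - X m a\<bar> \<le> \<bar>X (Suc (m+k)) a - X (m+k) a\<bar> + \<bar>X (m+k) a - X m a\<bar>" by simp
    also have "\<dots> \<le> (D0 / 2^(m+k)) * w a + (2 * D0 / 2^m) * w a * (1 - 1/2^k)"
      using step[OF a, of "m+k"] Suc by linarith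
    also have "\<dots> = (2 * D0 / 2^m) * w a * (1 - 1/2^Suc k)" by (simp add: field_simps power_add)
    finally show ?case .
  qed simp
  have diff': "\<bar>X (m+k) a - X m a\<bar> \<le> (2 * D0 / 2^m) * w a" if a: "a \<in> S" for m k a
  proof -
    have "(2 * D0 / 2^m) * w a * (1 - 1/2^k) \<le> (2 * D0 / 2^m) * w a * 1"
      using w[OF a] start by (intro mult_left_mono) auto
    then show ?thesis using diff[OF a, of m k] by linarith
  qed
  have null: "(\<lambda>m. c / 2^m) \<longlonglongrightarrow> 0" for c :: real
    using tendsto_mult[OF tendsto_const[of c] LIMSEQ_realpow_zero[of "1/2::real"]]
    by (simp add: power_divide)
  have cauchy: "Cauchy (\<lambda>m. X m a)" if a: "a \<in> S" for a
  proof (rule metric_CauchyI)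
    fix e :: real assume "e > 0"
    with null[of "2 * D0 * w a"] have "\<forall>\<^sub>F m in sequentially. \<bar>2 * D0 * w a / 2^m\<bar> < e / 2"
      by (auto simp: tendsto_iff dist_real_def dest: spec[where x="e/2"])
    then obtain M where M: "\<bar>2 * D0 * w a / 2^M\<bar> < e / 2" by (auto simp: eventually_sequentially)
    have "dist (X m a) (X M a) < e/2" if "m \<ge> M" for m
    proof -
      have "\<bar>X m a - X M a\<bar> \<le> (2 * D0 / 2^M) * w a" using diff'[OF a, of M "m - M"] that by simp
      then have "\<bar>X m a - X M a\<bar> \<le> \<bar>2 * D0 * w a / 2^M\<bar>"
        using abs_ge_self[of "2 * D0 * w a / 2^M"] by (simp del: abs_divide)
      then show ?thesis using M unfolding dist_real_def by linarith
    qed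
    then have "dist (X m a) (X n a) < e" if "m \<ge> M" "n \<ge> M" for m n
      using that dist_triangle_half_l by blast
    then show "\<exists>M. \<forall>m\<ge>M. \<forall>n\<ge>M. dist (X m a) (X n a) < e" by blast
  qed
  define U where "U a = lim (\<lambda>m. X m a)" for a
  have lim: "(\<lambda>m. X m a) \<longlonglongrightarrow> U a" if "a \<in> S" for a
    using cauchy[OF that] by (simp add: U_def Cauchy_convergent convergent_LIMSEQ_iff[symmetric])
  have rate: "\<bar>U a - X m a\<bar> \<le> (2 * D0 / 2^m) * w a" if a: "a \<in> S" for m a
  proof (rule tendsto_upperbound)
    show "(\<lambda>k. \<bar>X (m+k) a - X m a\<bar>) \<longlonglongrightarrow> \<bar>U a - X m a\<bar>"
      using LIMSEQ_ignore_initial_segment[OF lim[OF a], of m]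
      by (intro tendsto_intros) (simp add: add.commute)
  qed (use diff'[OF a] in auto)
  have unif: "uniform_limit S X U sequentially"
  proof (rule uniform_limitI)
    fix e :: real assume "e > 0"
    with null[of "2 * D0 * W"] have "\<forall>\<^sub>F m in sequentially. \<bar>2 * D0 * W / 2^m\<bar> < e"
      by (auto simp: tendsto_iff dist_real_def)
    then show "\<forall>\<^sub>F m in sequentially. \<forall>a\<in>S. dist (X m a) (U a) < e"
    proof eventually_elim
      case (elim m)
      show ?case
      proof
        fix a assume a: "a \<in> S"
        have "(2 * D0 / 2^m) * w a \<le> (2 * D0 / 2^m) * W"
          using w[OF a] start by (intro mult_left_mono) auto
        then have "\<bar>U a - X m a\<bar> \<le> \<bar>2 * D0 * W / 2^m\<bar>" 
          using rate[OF a, of m] abs_ge_self[of "2 * D0 * W / 2^m"] by (simp del: abs_divide)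
        then show "dist (X m a) (U a) < e" using elim unfolding dist_real_def by linarith
      qed
    qed
  qed
  have UA: "U \<in> \<A>" by (rule closed[OF XA unif])
  have fixp: "\<Phi> U a = U a" if a: "a \<in> S" for a
  proof (rule LIMSEQ_unique)
    show "(\<lambda>m. X (Suc m) a) \<longlonglongrightarrow> U a" by (rule LIMSEQ_Suc[OF lim[OF a]])
    show "(\<lambda>m. X (Suc m) a) \<longlonglongrightarrow> \<Phi> U a"
    proof (rule Lim_null_comparison[THEN Lim_null[THEN iffD2]])
      show "\<forall>\<^sub>F m in sequentially. norm (X (Suc m) a - \<Phi> U a) \<le> (D0 * w a) / 2^m"
      proof (intro always_eventually allI)
        fix m
        have "\<bar>\<Phi> U a - \<Phi> (X m) a\<bar> \<le> ((2 * D0 / 2^m) / 2) * w a"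
          by (rule contr[OF UA XA _ _ a]) (use rate start in auto)
        then show "norm (X (Suc m) a - \<Phi> U a) \<le> (D0 * w a) / 2^m"
          by (simp add: XS abs_minus_commute)
      qed
      show "(\<lambda>m. D0 * w a / 2^m) \<longlonglongrightarrow> 0" by (rule null)
    qed
  qed
  show thesis by (rule that[OF UA fixp]) (use lim in \<open>auto simp: X_def\<close>)
qed

section \<open>Gaussian averages\<close>

text \<open>A relation to an explicitly given derivative instead of an operator: differentiating
  integrals and limits then amounts to exhibiting the candidate, and two candidates agree by
  \<open>pder_unique\<close>.\<close>

definition pder :: "'n::finite \<Rightarrow> (real^'n \<Rightarrow> real) \<Rightarrow> (real^'n \<Rightarrow> real) \<Rightarrow> bool" where
  "pder j g g' \<longleftrightarrow> (\<forall>x. ((\<lambda>s. g (x + s *\<^sub>R axis j 1)) has_real_derivative g' x) (at 0))"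

lemma pder_line:
  assumes "pder j g g'"
  shows "((\<lambda>s. g (x + s *\<^sub>R axis j 1)) has_real_derivative g' (x + s *\<^sub>R axis j 1)) (at s)"
proof -
  have "((\<lambda>r. g ((x + s *\<^sub>R axis j 1) + r *\<^sub>R axis j 1)) has_real_derivative g' (x + s *\<^sub>R axis j 1)) (at 0)"
    using assms by (simp add: pder_def)
  then have "((\<lambda>r. g (x + (r + s) *\<^sub>R axis j 1)) has_real_derivative g' (x + s *\<^sub>R axis j 1)) (at 0)"
    by (simp add: scaleR_add_left add.assoc add.commute add.left_commute)
  then show ?thesis
    using DERIV_shift[of "\<lambda>r. g (x + r *\<^sub>R axis j 1)" _ 0 s] by simp
qed

lemma pder_integral:
  fixes G G' :: "real^'n::finite \<Rightarrow> 'p \<Rightarrow> real"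
  assumes "\<And>x. integrable P (G x)" "\<And>x. G' x \<in> borel_measurable P"
    and "\<And>w. w \<in> space P \<Longrightarrow> pder j (\<lambda>x. G x w) (\<lambda>x. G' x w)"
    and "integrable P W" "\<And>x w. w \<in> space P \<Longrightarrow> \<bar>G' x w\<bar> \<le> W w"
  shows "pder j (\<lambda>x. \<integral>w. G x w \<partial>P) (\<lambda>x. \<integral>w. G' x w \<partial>P)"
  unfolding pder_def
proof
  fix x
  show "((\<lambda>s. \<integral>w. G (x + s *\<^sub>R axis j 1) w \<partial>P) has_real_derivative (\<integral>w. G' x w \<partial>P)) (at 0)"
    using has_real_derivative_integral_dominated[where d=1 and P=P and W=W
       and G="\<lambda>s w. G (x + s *\<^sub>R axis j 1) w" and G'="\<lambda>s w. G' (x + s *\<^sub>R axis j 1) w"]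
      assms pder_line[OF assms(3)] by simp
qed

section \<open>The standard Gaussian measure on Euclidean space\<close>

definition gdens :: "real^'n::finite \<Rightarrow> real" where
  "gdens z = (\<Prod>b\<in>Basis. std_normal_density (z \<bullet> b))"

definition gauss :: "(real^'n::finite) measure" where
  "gauss = density lborel (\<lambda>z. ennreal (gdens z))"

lemma gdens_nonneg[simp]: "0 \<le> gdens z"
  unfolding gdens_def by (intro prod_nonneg) auto

lemma gdens_measurable[measurable]: "gdens \<in> borel_measurable borel"
  unfolding gdens_def by measurable

lemma sets_gauss[simp, measurable_cong]: "sets gauss = sets borel"
  by (simp add: gauss_def)

lemma space_gauss[simp]: "space gauss = UNIV"
  by (simp add: gauss_def)

lemma nn_integral_gdens: "(\<integral>\<^sup>+z. ennreal (gdens (z::real^'n::finite)) \<partial>lborel) = 1"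
proof -
  have 1: "(\<integral>\<^sup>+x. ennreal (std_normal_density x) \<partial>lborel) = 1"
  proof -
    interpret prob_space "density lborel std_normal_density" by (rule prob_space_normal_density) simp
    show ?thesis using emeasure_space_1 by (simp add: emeasure_density)
  qed
  have "(\<integral>\<^sup>+z. ennreal (gdens (z::real^'n)) \<partial>lborel) = (\<integral>\<^sup>+z. (\<Prod>b\<in>Basis. ennreal (std_normal_density ((z::real^'n) \<bullet> b))) \<partial>lborel)"
    by (simp add: gdens_def prod_ennreal)
  also have "\<dots> = 1" by (subst nn_integral_lborel_prod) (simp_all add: 1)
  finally show ?thesis .
qed

lemma prob_space_gauss: "prob_space gauss"
  by (rule prob_spaceI) (simp add: gauss_def emeasure_density nn_integral_gdens)

lemma gdens_shift:
  "gdens (z - a *\<^sub>R axis j 1) = gdens z * exp (a * z $ j - a\<^sup>2 / 2)"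
proof -
  let ?e = "axis j (1::real) :: real^'a"
  have e: "?e \<in> Basis" by simp
  have "gdens (z - a *\<^sub>R ?e) = std_normal_density ((z - a *\<^sub>R ?e) \<bullet> ?e) * (\<Prod>b\<in>Basis - {?e}. std_normal_density ((z - a *\<^sub>R ?e) \<bullet> b))"
    unfolding gdens_def by (rule prod.remove) auto
  also have "(\<Prod>b\<in>Basis - {?e}. std_normal_density ((z - a *\<^sub>R ?e) \<bullet> b)) = (\<Prod>b\<in>Basis - {?e}. std_normal_density (z \<bullet> b))"
    by (intro prod.cong refl) (auto simp: inner_diff_left inner_Basis[OF e])
  also have "std_normal_density ((z - a *\<^sub>R ?e) \<bullet> ?e) = std_normal_density (z \<bullet> ?e) * exp (a * z $ j - a\<^sup>2 / 2)"
    by (simp add: inner_diff_left inner_Basis[OF e e] inner_axis std_normal_density_def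
        exp_add[symmetric] power2_eq_square field_simps)
  finally show ?thesis unfolding gdens_def using prod.remove[OF finite_Basis e, of "\<lambda>b. std_normal_density (z \<bullet> b)"]
    by simp
qed

text \<open>Multiplied by the Gaussian density, the integrand is the density translated along axis
  \<open>j\<close>, and Lebesgue measure is translation invariant.\<close>

lemma gauss_exp_nn: "(\<integral>\<^sup>+z. ennreal (exp (a * z $ j - a\<^sup>2 / 2)) \<partial>(gauss::(real^'n::finite) measure)) = 1"
proof -
  let ?c = "- a *\<^sub>R axis j (1::real) :: real^'n"
  have "(\<integral>\<^sup>+z. ennreal (exp (a * z $ j - a\<^sup>2 / 2)) \<partial>(gauss::(real^'n) measure)) = (\<integral>\<^sup>+z. ennreal (gdens (?c + z)) \<partial>lborel)"
    unfolding gauss_def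
    by (subst nn_integral_density) (auto simp: ennreal_mult[symmetric] gdens_shift[symmetric] uminus_add_conv_diff intro!: nn_integral_cong)
  also have "\<dots> = (\<integral>\<^sup>+z. ennreal (gdens z) \<partial>distr lborel borel ((+) ?c))"
    by (subst nn_integral_distr) auto
  also have "\<dots> = 1" unfolding lborel_distr_plus by (rule nn_integral_gdens)
  finally show ?thesis .
qed

lemma gauss_exp_integrable: "integrable gauss (\<lambda>z. exp (a * z $ j))"
proof -
  have "integrable gauss (\<lambda>z. exp (a * z $ j - a\<^sup>2 / 2))"
    by (rule integrableI_nonneg) (auto simp: gauss_exp_nn)
  then have "integrable gauss (\<lambda>z. exp (a\<^sup>2 / 2) * exp (a * z $ j - a\<^sup>2 / 2))" by simp
  then show ?thesis by (simp add: exp_add[symmetric])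
qed

text \<open>Exponential moments of \<open>\<bar>z $ j\<bar>\<close> dominate both the Cameron-Martin
  density and its derivative in the shift.\<close>

lemma gauss_exp_abs_integrable: "integrable gauss (\<lambda>z. exp (a * \<bar>z $ j\<bar>))"
proof (rule Bochner_Integration.integrable_bound)
  show "integrable gauss (\<lambda>z. exp (a * z $ j) + exp (- a * z $ j))"
    using gauss_exp_integrable[of a j] gauss_exp_integrable[of "-a" j] by simp
  show "AE z in gauss. norm (exp (a * \<bar>z $ j\<bar>)) \<le> norm (exp (a * z $ j) + exp (- a * z $ j))"
  proof (intro AE_I2)
    fix z :: "real^'a"
    have "exp (a * \<bar>z $ j\<bar>) \<le> exp (a * z $ j) + exp (- a * z $ j)"
      by (cases "z $ j \<ge> 0") auto
    moreover have "0 \<le> exp (a * z $ j) + exp (- a * z $ j)" by (intro add_nonneg_nonneg) auto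
    ultimately show "norm (exp (a * \<bar>z $ j\<bar>)) \<le> norm (exp (a * z $ j) + exp (- a * z $ j))" by simp
  qed
qed auto

lemma gauss_abs_integrable: "integrable gauss (\<lambda>z. \<bar>z $ j\<bar>)"
proof (rule Bochner_Integration.integrable_bound[OF gauss_exp_abs_integrable[of 1 j]])
  show "AE z in gauss. norm \<bar>z $ j\<bar> \<le> norm (exp (1 * \<bar>z $ j\<bar>))"
  proof (intro AE_I2)
    fix z :: "real^'a"
    show "norm \<bar>z $ j\<bar> \<le> norm (exp (1 * \<bar>z $ j\<bar>))"
      using exp_ge_add_one_self[of "\<bar>z $ j\<bar>"] by (simp del: exp_ge_add_one_self)
  qed
qed auto

text \<open>The shift is moved from \<open>g\<close> to the measure, so a function that is merely
  measurable becomes differentiable after averaging.\<close>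

lemma cameron_martin:
  fixes g :: "real^'n::finite \<Rightarrow> real"
  assumes [measurable]: "g \<in> borel_measurable borel"
  shows "(\<integral>z. g (z + a *\<^sub>R axis j 1) \<partial>gauss) = (\<integral>z. g z * exp (a * z $ j - a\<^sup>2 / 2) \<partial>gauss)"
proof -
  let ?c = "a *\<^sub>R axis j (1::real) :: real^'n"
  have "(\<integral>z. g (z + ?c) \<partial>gauss) = (\<integral>z. gdens ((?c + z) - ?c) * g (?c + z) \<partial>lborel)"
    unfolding gauss_def by (subst integral_real_density) (auto simp: add.commute)
  also have "\<dots> = (\<integral>z. gdens (z - ?c) * g z \<partial>distr lborel borel ((+) ?c))"
    by (subst integral_distr) auto
  also have "\<dots> = (\<integral>z. gdens (z - ?c) * g z \<partial>lborel)" unfolding lborel_distr_plus ..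
  also have "\<dots> = (\<integral>z. g z * exp (a * z $ j - a\<^sup>2 / 2) \<partial>gauss)"
    unfolding gauss_def by (subst integral_real_density) (auto simp: gdens_shift mult_ac)
  finally show ?thesis .
qed

section \<open>Derivatives of Gaussian averages\<close>

lemma gauss_integrable_bounded:
  fixes g :: "real^'n::finite \<Rightarrow> real"
  assumes [measurable]: "g \<in> borel_measurable borel" and "\<And>z. \<bar>g z\<bar> \<le> B"
  shows "integrable gauss g"
proof -
  interpret prob_space "gauss :: (real^'n) measure" by (rule prob_space_gauss)
  show ?thesis by (rule integrable_const_bound[of _ B]) (use assms in auto)
qed

lemma gauss_integrable_mult_bounded:
  fixes g w :: "real^'n::finite \<Rightarrow> real"
  assumes [measurable]: "g \<in> borel_measurable borel" and B: "\<And>z. \<bar>g z\<bar> \<le> B" and w: "integrable gauss w"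
  shows "integrable gauss (\<lambda>z. w z * g z)"
proof (rule Bochner_Integration.integrable_bound[of _ "\<lambda>z. B * w z"])
  show "AE z in gauss. norm (w z * g z) \<le> norm (B * w z)"
  proof (rule AE_I2)
    fix z :: "real^'n"
    have "\<bar>g z\<bar> \<le> \<bar>B\<bar>" using B[of z] by linarith
    then have "\<bar>w z\<bar> * \<bar>g z\<bar> \<le> \<bar>w z\<bar> * \<bar>B\<bar>" by (intro mult_left_mono) auto
    then show "norm (w z * g z) \<le> norm (B * w z)" by (simp add: abs_mult mult.commute)
  qed
  have [measurable]: "w \<in> borel_measurable gauss" using w by simp
  show "(\<lambda>z. w z * g z) \<in> borel_measurable gauss" by measurable
qed (use w in simp)

text \<open>The smoothing effect of the heat semigroup: the Cameron-Martin formula moves the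
  increment of \<open>x\<close> into the density.\<close>

lemma pder_gauss_average:
  fixes g :: "real^'n::finite \<Rightarrow> real"
  assumes g[measurable]: "g \<in> borel_measurable borel" and B: "\<And>z. \<bar>g z\<bar> \<le> B" and \<sigma>: "0 < \<sigma>"
  shows "pder j (\<lambda>x. \<integral>z. g (x + \<sigma> *\<^sub>R z) \<partial>gauss) (\<lambda>x. (1/\<sigma>) * (\<integral>z. z $ j * g (x + \<sigma> *\<^sub>R z) \<partial>gauss))"
  unfolding pder_def
proof
  fix x :: "real^'n"
  have B0: "0 \<le> B" using B[of 0] by linarith
  define E where "E s z = exp ((s/\<sigma>) * z $ j - (s/\<sigma>)\<^sup>2 / 2)" for s and z :: "real^'n"
  have mE[measurable]: "E s \<in> borel_measurable borel" for s unfolding E_def by measurable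
  have eq: "(\<integral>z. g (x + s *\<^sub>R axis j 1 + \<sigma> *\<^sub>R z) \<partial>gauss) = (\<integral>z. E s z * g (x + \<sigma> *\<^sub>R z) \<partial>gauss)" for s
    using cameron_martin[of "\<lambda>z. g (x + \<sigma> *\<^sub>R z)" "s/\<sigma>" j] \<sigma>
    by (simp add: E_def scaleR_add_right algebra_simps)
  have "((\<lambda>s. \<integral>z. E s z * g (x + \<sigma> *\<^sub>R z) \<partial>gauss) has_real_derivative
     (\<integral>z. (E 0 z * (z $ j / \<sigma> - 0 / \<sigma>\<^sup>2)) * g (x + \<sigma> *\<^sub>R z) \<partial>gauss)) (at 0)"
  proof (rule has_real_derivative_integral_dominated[where d=\<sigma>
        and G'="\<lambda>s z. (E s z * (z $ j / \<sigma> - s / \<sigma>\<^sup>2)) * g (x + \<sigma> *\<^sub>R z)"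
        and W="\<lambda>z. (B / \<sigma>) * exp (2 * \<bar>z $ j\<bar>)"])
    show "integrable gauss (\<lambda>z. E s z * g (x + \<sigma> *\<^sub>R z))" for s
    proof (rule gauss_integrable_mult_bounded[OF _ B])
      have "integrable gauss (\<lambda>z::real^'n. exp ((s/\<sigma>) * z $ j) * exp (- (s/\<sigma>)\<^sup>2 / 2))"
        using gauss_exp_integrable[of "s/\<sigma>" j] by simp
      then show "integrable gauss (E s)" by (simp add: E_def[abs_def] exp_add[symmetric])
    qed auto
    show "((\<lambda>s. E s z * g (x + \<sigma> *\<^sub>R z)) has_real_derivative (E s z * (z $ j / \<sigma> - s / \<sigma>\<^sup>2)) * g (x + \<sigma> *\<^sub>R z)) (at s)" for s z
      unfolding E_def using \<sigma> by (auto intro!: derivative_eq_intros simp: power2_eq_square algebra_simps)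
    show "integrable gauss (\<lambda>z::real^'n. (B / \<sigma>) * exp (2 * \<bar>z $ j\<bar>))"
      using gauss_exp_abs_integrable[of 2 j] by simp
    \<comment> \<open>For \<open>\<bar>s\<bar> < \<sigma>\<close> the scaled shift is at most 1, so
      the density is at most \<open>exp \<bar>z $ j\<bar>\<close> and the factor from its
      logarithmic derivative at most \<open>exp \<bar>z $ j\<bar> / \<sigma>\<close>. Their product
      is the dominating function.\<close>
    fix s z assume s: "\<bar>s\<bar> < \<sigma>"
    have a: "\<bar>s/\<sigma>\<bar> \<le> 1" using s \<sigma> by (simp add: abs_div)
    have "(s/\<sigma>) * z $ j \<le> \<bar>s/\<sigma>\<bar> * \<bar>z $ j\<bar>" by (metis abs_ge_self abs_mult)
    also have "\<dots> \<le> 1 * \<bar>z $ j\<bar>" using a by (intro mult_right_mono) auto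
    finally have E1: "E s z \<le> exp \<bar>z $ j\<bar>" unfolding E_def by (simp add: add_increasing2 diff_le_eq)
    have "z $ j / \<sigma> - s / \<sigma>\<^sup>2 = (z $ j - s/\<sigma>) / \<sigma>"
      by (simp add: power2_eq_square diff_divide_distrib)
    then have "\<bar>z $ j / \<sigma> - s / \<sigma>\<^sup>2\<bar> = \<bar>z $ j - s/\<sigma>\<bar> / \<sigma>" using \<sigma> by simp
    also have "\<dots> \<le> (\<bar>z $ j\<bar> + 1) / \<sigma>" using \<sigma> a by (intro divide_right_mono) (auto simp del: abs_divide)
    also have "\<dots> \<le> exp \<bar>z $ j\<bar> / \<sigma>" 
    proof (intro divide_right_mono)
      show "\<bar>z $ j\<bar> + 1 \<le> exp \<bar>z $ j\<bar>" using exp_ge_add_one_self[of "\<bar>z $ j\<bar>"] by linarith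
    qed (use \<sigma> in auto)
    finally have E2: "\<bar>z $ j / \<sigma> - s / \<sigma>\<^sup>2\<bar> \<le> exp \<bar>z $ j\<bar> / \<sigma>" .
    have "E s z * \<bar>z $ j / \<sigma> - s / \<sigma>\<^sup>2\<bar> * \<bar>g (x + \<sigma> *\<^sub>R z)\<bar> \<le> exp \<bar>z $ j\<bar> * (exp \<bar>z $ j\<bar> / \<sigma>) * B"
      using E1 E2 B B0 \<sigma> by (intro mult_mono) (auto simp: E_def)
    also have "\<dots> = (B / \<sigma>) * exp (2 * \<bar>z $ j\<bar>)" by (simp add: exp_double power2_eq_square)
    finally show "\<bar>E s z * (z $ j / \<sigma> - s / \<sigma>\<^sup>2) * g (x + \<sigma> *\<^sub>R z)\<bar> \<le> (B / \<sigma>) * exp (2 * \<bar>z $ j\<bar>)"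
      by (simp add: abs_mult E_def)
  qed (use \<sigma> in auto)
  moreover have "(\<integral>z. (E 0 z * (z $ j / \<sigma> - 0 / \<sigma>\<^sup>2)) * g (x + \<sigma> *\<^sub>R z) \<partial>gauss) = (1/\<sigma>) * (\<integral>z. z $ j * g (x + \<sigma> *\<^sub>R z) \<partial>gauss)"
    by (simp add: E_def)
  ultimately show "((\<lambda>s. \<integral>z. g (x + s *\<^sub>R axis j 1 + \<sigma> *\<^sub>R z) \<partial>gauss) has_real_derivative (1/\<sigma>) * (\<integral>z. z $ j * g (x + \<sigma> *\<^sub>R z) \<partial>gauss)) (at 0)"
    by (simp only: eq)
qed

lemma pder_translate:
  assumes "pder j g g'"
  shows "pder j (\<lambda>x. g (x + v)) (\<lambda>x. g' (x + v))"
  unfolding pder_def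
proof
  fix x
  have "x + s *\<^sub>R axis j 1 + v = (x + v) + s *\<^sub>R axis j 1" for s by (simp add: add_ac)
  then show "((\<lambda>s. g (x + s *\<^sub>R axis j 1 + v)) has_real_derivative g' (x + v)) (at 0)"
    using assms unfolding pder_def by (simp only:)
qed

lemma pder_unique: "pder j g g1 \<Longrightarrow> pder j g g2 \<Longrightarrow> g1 = g2"
  unfolding pder_def by (intro ext DERIV_unique) (erule spec)+

lemma pder_gauss_average_C1:
  fixes g g' :: "real^'n::finite \<Rightarrow> real"
  assumes [measurable]: "g \<in> borel_measurable borel" "g' \<in> borel_measurable borel"
    and "\<And>z. \<bar>g z\<bar> \<le> B" "\<And>z. \<bar>g' z\<bar> \<le> B'" and "pder j g g'"
  shows "pder j (\<lambda>x. \<integral>z. g (x + \<sigma> *\<^sub>R z) \<partial>gauss) (\<lambda>x. \<integral>z. g' (x + \<sigma> *\<^sub>R z) \<partial>gauss)"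
proof (rule pder_integral[where W="\<lambda>_. B'"])
  interpret prob_space "gauss :: (real^'n) measure" by (rule prob_space_gauss)
  show "integrable gauss (\<lambda>_::real^'n. B')" by simp
  show "integrable gauss (\<lambda>z. g (x + \<sigma> *\<^sub>R z))" for x
    by (rule gauss_integrable_bounded[where B=B]) (use assms(3) in simp_all)
  show "(\<lambda>z. g' (x + \<sigma> *\<^sub>R z)) \<in> borel_measurable gauss" for x by measurable
  show "pder j (\<lambda>x. g (x + \<sigma> *\<^sub>R w)) (\<lambda>x. g' (x + \<sigma> *\<^sub>R w))" for w by (rule pder_translate[OF assms(5)])
  show "\<bar>g' (x + \<sigma> *\<^sub>R w)\<bar> \<le> B'" for x w by (rule assms(4))
qed

text \<open>Up to the factor \<sigma>, both sides are the partial derivative of the same average,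
  computed once on the density and once on \<open>g\<close>; uniqueness of derivatives equates
  them.\<close>

lemma gauss_integration_by_parts:
  fixes g g' :: "real^'n::finite \<Rightarrow> real"
  assumes [measurable]: "g \<in> borel_measurable borel" "g' \<in> borel_measurable borel"
    and "\<And>z. \<bar>g z\<bar> \<le> B" "\<And>z. \<bar>g' z\<bar> \<le> B'" and "pder j g g'" "0 < \<sigma>"
  shows "(\<integral>z. z $ j * g (x + \<sigma> *\<^sub>R z) \<partial>gauss) = \<sigma> * (\<integral>z. g' (x + \<sigma> *\<^sub>R z) \<partial>gauss)"
proof -
  let ?g = "\<lambda>x. \<integral>z. g (x + \<sigma> *\<^sub>R z) \<partial>gauss"
  have 1: "pder j ?g (\<lambda>x. (1/\<sigma>) * (\<integral>z. z $ j * g (x + \<sigma> *\<^sub>R z) \<partial>gauss))"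
    by (rule pder_gauss_average[OF assms(1,3,6)])
  have 2: "pder j ?g (\<lambda>x. \<integral>z. g' (x + \<sigma> *\<^sub>R z) \<partial>gauss)"
    by (rule pder_gauss_average_C1[OF assms(1-5)])
  have "(1/\<sigma>) * (\<integral>z. z $ j * g (x + \<sigma> *\<^sub>R z) \<partial>gauss) = (\<integral>z. g' (x + \<sigma> *\<^sub>R z) \<partial>gauss)"
    using fun_cong[OF pder_unique[OF 1 2], of x] .
  from arg_cong[OF this, of "(*) \<sigma>"] assms(6) show ?thesis by simp
qed

section \<open>Partial derivatives and Duhamel's identity\<close>

text \<open>Continuity of the partial derivatives upgrades them to a total derivative, which is what
  the chain rule needs when a moving point is inserted into a coefficient.\<close>

lemma has_derivative_from_partials:
  fixes g :: "'v::euclidean_space \<Rightarrow> real"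
  assumes der: "\<And>b z. b \<in> Basis \<Longrightarrow> ((\<lambda>s. g (z + s *\<^sub>R b)) has_real_derivative D b z) (at 0)"
    and cont: "\<And>b. b \<in> Basis \<Longrightarrow> continuous_on UNIV (D b)"
  shows "(g has_derivative (\<lambda>v. \<Sum>b\<in>Basis. (v \<bullet> b) * D b z)) (at z)"
  unfolding has_derivative_at_alt
proof (intro conjI allI impI)
  show "bounded_linear (\<lambda>v. \<Sum>b\<in>Basis. (v \<bullet> b) * D b z)"
    by (intro bounded_linear_sum bounded_linear_mult_const bounded_linear_inner_left)
  fix e :: real assume e: "0 < e"
  let ?N = "real DIM('v)"
  have N: "0 < ?N" by simp
  have line: "((\<lambda>s. g (w + s *\<^sub>R b)) has_real_derivative D b (w + s *\<^sub>R b)) (at s)" if "b \<in> Basis" for w s b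
  proof -
    have "((\<lambda>r. g ((w + s *\<^sub>R b) + r *\<^sub>R b)) has_real_derivative D b (w + s *\<^sub>R b)) (at 0)"
      using der[OF that] by simp
    then have "((\<lambda>r. g (w + (r + s) *\<^sub>R b)) has_real_derivative D b (w + s *\<^sub>R b)) (at 0)"
      by (simp add: scaleR_add_left add.assoc add.commute add.left_commute)
    then show ?thesis using DERIV_shift[of "\<lambda>r. g (w + r *\<^sub>R b)" _ 0 s] by simp
  qed
  have "\<forall>b\<in>Basis. \<exists>d>0. \<forall>w. dist w z < d \<longrightarrow> dist (D b w) (D b z) < e / ?N"
  proof
    fix b :: 'v assume b: "b \<in> Basis"
    have "e / ?N > 0" using e N by simp
    then show "\<exists>d>0. \<forall>w. dist w z < d \<longrightarrow> dist (D b w) (D b z) < e / ?N"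
      using cont[OF b] unfolding continuous_on_iff by blast
  qed
  then obtain dd where dd: "\<And>b. b \<in> Basis \<Longrightarrow> dd b > 0"
    "\<And>b w. b \<in> Basis \<Longrightarrow> dist w z < dd b \<Longrightarrow> dist (D b w) (D b z) < e / ?N" by metis
  define d where "d = Min (dd ` Basis)"
  have d: "d > 0" "\<And>b w. b \<in> Basis \<Longrightarrow> dist w z < d \<Longrightarrow> dist (D b w) (D b z) < e / ?N"
    using dd by (auto simp: d_def)
  show "\<exists>d>0. \<forall>y. norm (y - z) < d \<longrightarrow> norm (g y - g z - (\<Sum>b\<in>Basis. ((y - z) \<bullet> b) * D b z)) \<le> e * norm (y - z)"
  proof (intro exI[of _ "d / ?N"] conjI allI impI)
    show "d / ?N > 0" using d N by simp
    fix y assume y: "norm (y - z) < d / ?N"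
    define v where "v = y - z"
    have proj: "norm ((\<Sum>b\<in>S. (v \<bullet> b) *\<^sub>R b) + s *\<^sub>R b0) < d"
      if "S \<subseteq> Basis" "b0 \<in> Basis" "b0 \<notin> S" "\<bar>s\<bar> \<le> \<bar>v \<bullet> b0\<bar>" for S b0 s
    proof -
      have fS: "finite S" using that finite_subset finite_Basis by blast
      have "norm ((\<Sum>b\<in>S. (v \<bullet> b) *\<^sub>R b) + s *\<^sub>R b0) \<le> (\<Sum>b\<in>S. norm ((v \<bullet> b) *\<^sub>R b)) + norm (s *\<^sub>R b0)"
        using norm_triangle_ineq[of "\<Sum>b\<in>S. (v \<bullet> b) *\<^sub>R b" "s *\<^sub>R b0"] norm_sum[of "\<lambda>b. (v \<bullet> b) *\<^sub>R b" S] by linarith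
      also have "\<dots> \<le> (\<Sum>b\<in>S. norm v) + norm v"
        using that by (intro add_mono sum_mono) (auto simp: subset_iff Basis_le_norm intro: order_trans)
      also have "\<dots> = real (card (insert b0 S)) * norm v" using fS that by (simp add: algebra_simps)
      also have "\<dots> \<le> ?N * norm v"
        using that by (intro mult_right_mono) (auto intro!: card_mono)
      also have "\<dots> < d" using y N by (simp add: v_def field_simps)
      finally show ?thesis .
    qed
    \<comment> \<open>The coordinates of \<open>v\<close> are switched on one at a time; each one
      costs at most \<open>e / DIM('v) * norm v\<close> by the mean value inequality, since all
      intermediate points stay within distance \<open>d\<close> of \<open>z\<close>.\<close>
    have main: "\<bar>g (z + (\<Sum>b\<in>S. (v \<bullet> b) *\<^sub>R b)) - g z - (\<Sum>b\<in>S. (v \<bullet> b) * D b z)\<bar> \<le> real (card S) * (e / ?N * norm v)"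
      if "finite S" "S \<subseteq> Basis" for S
      using that
    proof (induction S rule: finite_induct)
      case (insert b0 S)
      let ?w = "z + (\<Sum>b\<in>S. (v \<bullet> b) *\<^sub>R b)"
      have b0: "b0 \<in> Basis" using insert by auto
      have "norm ((g (?w + (v \<bullet> b0) *\<^sub>R b0) - (v \<bullet> b0) * D b0 z) - (g (?w + 0 *\<^sub>R b0) - 0 * D b0 z))
          \<le> (e / ?N) * norm ((v \<bullet> b0) - 0)"
      proof (rule field_differentiable_bound[where S="{-\<bar>v \<bullet> b0\<bar>..\<bar>v \<bullet> b0\<bar>}"
            and f="\<lambda>s. g (?w + s *\<^sub>R b0) - s * D b0 z" and f'="\<lambda>s. D b0 (?w + s *\<^sub>R b0) - D b0 z"])
        fix s assume s: "s \<in> {-\<bar>v \<bullet> b0\<bar>..\<bar>v \<bullet> b0\<bar>}"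
        show "((\<lambda>s. g (?w + s *\<^sub>R b0) - s * D b0 z) has_field_derivative D b0 (?w + s *\<^sub>R b0) - D b0 z) (at s within {-\<bar>v \<bullet> b0\<bar>..\<bar>v \<bullet> b0\<bar>})"
          by (rule has_field_derivative_at_within) (auto intro!: derivative_eq_intros line[OF b0])
        have "dist (?w + s *\<^sub>R b0) z < d"
          using proj[of S b0 s] insert s by (auto simp: dist_norm add.assoc)
        then show "norm (D b0 (?w + s *\<^sub>R b0) - D b0 z) \<le> e / ?N"
          using d(2)[OF b0] by (auto simp: dist_norm less_imp_le)
      qed auto
      also have "\<dots> \<le> (e / ?N) * norm v"
        using e N Basis_le_norm[OF b0, of v] by (intro mult_left_mono) auto
      finally have 1: "\<bar>g (?w + (v \<bullet> b0) *\<^sub>R b0) - g ?w - (v \<bullet> b0) * D b0 z\<bar> \<le> (e / ?N) * norm v"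
        by (simp add: algebra_simps)
      have 2: "z + (\<Sum>b\<in>insert b0 S. (v \<bullet> b) *\<^sub>R b) = ?w + (v \<bullet> b0) *\<^sub>R b0"
        using insert by (simp add: add_ac)
      have 3: "(\<Sum>b\<in>insert b0 S. (v \<bullet> b) * D b z) = (v \<bullet> b0) * D b0 z + (\<Sum>b\<in>S. (v \<bullet> b) * D b z)"
        using insert by simp
      have 4: "real (card (insert b0 S)) * (e / ?N * norm v) = e / ?N * norm v + real (card S) * (e / ?N * norm v)"
        using insert.hyps by (simp add: distrib_right add_divide_distrib)
      have IH: "\<bar>g ?w - g z - (\<Sum>b\<in>S. (v \<bullet> b) * D b z)\<bar> \<le> real (card S) * (e / ?N * norm v)"
        using insert by auto
      show ?case unfolding 2 3 4 using 1 IH by linarith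
    qed simp
    have "\<bar>g (z + v) - g z - (\<Sum>b\<in>Basis. (v \<bullet> b) * D b z)\<bar> \<le> ?N * (e / ?N * norm v)"
      using main[of Basis] by (simp add: euclidean_representation)
    then show "norm (g y - g z - (\<Sum>b\<in>Basis. ((y - z) \<bullet> b) * D b z)) \<le> e * norm (y - z)"
      using N by (simp add: v_def)
  qed
qed

lemma abs_diff_le_from_partials:
  fixes g :: "'v::euclidean_space \<Rightarrow> real"
  assumes der: "\<And>b z. b \<in> Basis \<Longrightarrow> ((\<lambda>s. g (z + s *\<^sub>R b)) has_real_derivative D b z) (at 0)"
    and cont: "\<And>b. b \<in> Basis \<Longrightarrow> continuous_on UNIV (D b)"
    and bd: "\<And>b z. b \<in> Basis \<Longrightarrow> \<bar>D b z\<bar> \<le> M b"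
  shows "\<bar>g w - g z\<bar> \<le> (\<Sum>b\<in>Basis. M b * \<bar>(w - z) \<bullet> b\<bar>)"
proof -
  have "norm (g (z + 1 *\<^sub>R (w - z)) - g (z + 0 *\<^sub>R (w - z))) \<le> (\<Sum>b\<in>Basis. M b * \<bar>(w - z) \<bullet> b\<bar>) * norm (1 - 0 :: real)"
  proof (rule field_differentiable_bound[where S=UNIV and f="\<lambda>s. g (z + s *\<^sub>R (w - z))"
        and f'="\<lambda>s. \<Sum>b\<in>Basis. ((w - z) \<bullet> b) * D b (z + s *\<^sub>R (w - z))"])
    fix s
    have "((\<lambda>s. g (z + s *\<^sub>R (w - z))) has_derivative (\<lambda>r. \<Sum>b\<in>Basis. ((r *\<^sub>R (w - z)) \<bullet> b) * D b (z + s *\<^sub>R (w - z)))) (at s)"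
      by (rule has_derivative_compose[where f="\<lambda>s. z + s *\<^sub>R (w - z)", OF _ has_derivative_from_partials[OF der cont]])
        (auto intro!: derivative_eq_intros)
    then show "((\<lambda>s. g (z + s *\<^sub>R (w - z))) has_field_derivative (\<Sum>b\<in>Basis. ((w - z) \<bullet> b) * D b (z + s *\<^sub>R (w - z)))) (at s within UNIV)"
      unfolding has_field_derivative_def
      by (rule has_derivative_eq_rhs) (simp add: fun_eq_iff sum_distrib_left mult_ac)
    show "norm (\<Sum>b\<in>Basis. ((w - z) \<bullet> b) * D b (z + s *\<^sub>R (w - z))) \<le> (\<Sum>b\<in>Basis. M b * \<bar>(w - z) \<bullet> b\<bar>)"
    proof (rule order_trans[OF norm_sum sum_mono])
      fix b :: 'v assume b: "b \<in> Basis"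
      show "norm (((w - z) \<bullet> b) * D b (z + s *\<^sub>R (w - z))) \<le> M b * \<bar>(w - z) \<bullet> b\<bar>"
        using mult_right_mono[OF bd[OF b, of "z + s *\<^sub>R (w - z)"], of "\<bar>(w - z) \<bullet> b\<bar>"]
        by (simp add: abs_mult mult.commute)
    qed
  qed auto
  then show ?thesis by simp
qed

lemma sum_Basis_vec: "(\<Sum>b\<in>Basis. f b) = (\<Sum>i\<in>UNIV. f (axis i 1 :: real^'n::finite))"
proof -
  have B: "(Basis :: (real^'n) set) = range (\<lambda>i. axis i 1)" by (auto simp: Basis_vec_def)
  have "inj (\<lambda>i::'n. axis i (1::real))" by (auto simp: inj_on_def axis_eq_axis)
  then show ?thesis unfolding B by (simp add: sum.reindex)
qed

lemma pder_has_derivative: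
  fixes g :: "real^'n::finite \<Rightarrow> real"
  assumes "\<And>j. pder j g (D j)" "\<And>j. continuous_on UNIV (D j)"
  shows "(g has_derivative (\<lambda>v. \<Sum>j\<in>UNIV. v $ j * D j z)) (at z)"
proof -
  have *: "\<exists>j. b = axis j 1" if "b \<in> Basis" for b :: "real^'n" using that by (auto simp: Basis_vec_def)
  \<comment> \<open>Partial derivatives are indexed by coordinates here and by basis vectors in the
    general lemma; \<open>axis\<close> is injective in the index, so the description picks the right
    one.\<close>
  define D' where "D' b = D (THE j. b = axis j (1::real))" for b :: "real^'n"
  have D': "D' (axis j 1) = D j" for j by (simp add: D'_def axis_eq_axis)
  have "(g has_derivative (\<lambda>v. \<Sum>b\<in>Basis. (v \<bullet> b) * D' b z)) (at z)"
    by (rule has_derivative_from_partials) (use assms D' in \<open>auto dest!: * simp: pder_def\<close>)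
  then show ?thesis by (simp add: sum_Basis_vec D' inner_axis)
qed

lemma pder_abs_diff_le:
  fixes g :: "real^'n::finite \<Rightarrow> real"
  assumes "\<And>j. pder j g (D j)" "\<And>j. continuous_on UNIV (D j)" "\<And>j z. \<bar>D j z\<bar> \<le> M"
  shows "\<bar>g w - g z\<bar> \<le> M * (\<Sum>j\<in>UNIV. \<bar>w $ j - z $ j\<bar>)"
proof -
  have *: "\<exists>j. b = axis j 1" if "b \<in> Basis" for b :: "real^'n" using that by (auto simp: Basis_vec_def)
  define D' where "D' b = D (THE j. b = axis j (1::real))" for b :: "real^'n"
  have D': "D' (axis j 1) = D j" for j by (simp add: D'_def axis_eq_axis)
  have "\<bar>g w - g z\<bar> \<le> (\<Sum>b\<in>Basis. M * \<bar>(w - z) \<bullet> b\<bar>)"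
    by (rule abs_diff_le_from_partials[where D=D']) (use assms D' in \<open>auto dest!: * simp: pder_def\<close>)
  then show ?thesis by (simp add: sum_Basis_vec inner_axis sum_distrib_left)
qed

text \<open>Duhamel's formula along a fixed space point: with \<open>J \<rho> r\<close> the average at scale \<open>\<rho>\<close> of the source
  at time \<open>r\<close>, the singularity of the heat kernel disappears after the substitution \<open>s - r = \<rho>\<^sup>2\<close>.\<close>

lemma duhamel_identity:
  fixes J J' :: "real \<Rightarrow> real \<Rightarrow> real"
  assumes t: "0 \<le> t"
    and cJ: "continuous_on (UNIV \<times> {0..t}) (\<lambda>p. J (fst p) (snd p))"
    and cJ': "continuous_on (UNIV \<times> {0..t}) (\<lambda>p. J' (fst p) (snd p))"
    and der: "\<And>\<rho> r. r \<in> {0..t} \<Longrightarrow> ((\<lambda>\<rho>. J \<rho> r) has_real_derivative J' \<rho> r) (at \<rho>)"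
  shows "((\<lambda>s. J 0 s + sqrt s * integral {0..1} (\<lambda>\<theta>. J' (sqrt s * \<theta>) (s * (1 - \<theta>\<^sup>2))))
    has_integral (t * integral {0..1} (\<lambda>\<theta>. 2 * \<theta> * J (sqrt t * \<theta>) (t * (1 - \<theta>\<^sup>2))))) {0..t}"
proof -
  have comp: "continuous_on A (\<lambda>a. J (f a) (g a))" "continuous_on A (\<lambda>a. J' (f a) (g a))"
    if "continuous_on A f" "continuous_on A g" "\<And>a. a \<in> A \<Longrightarrow> g a \<in> {0..t}"
    for A :: "'c::topological_space set" and f g
    using continuous_on_compose2[OF cJ, of A "\<lambda>a. (f a, g a)"] continuous_on_compose2[OF cJ', of A "\<lambda>a. (f a, g a)"] that
    by (auto simp: image_subset_iff intro!: continuous_on_Pair)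
  \<comment> \<open>\<open>K\<close> and \<open>K'\<close> are one region, described by
    \<open>(\<rho>, r)\<close> and by \<open>(\<rho>, s)\<close> with
    \<open>s = r + \<rho>\<^sup>2\<close>. Integrating first over \<open>\<rho>\<close> in each
    description gives the two sides of the identity: for fixed \<open>r\<close> the fundamental
    theorem of calculus applies to \<open>J\<close>, for fixed \<open>s\<close> the integral over
    \<open>[0, sqrt s]\<close> is rescaled to \<open>[0, 1]\<close>.\<close>
  define K where "K = {p :: real \<times> real. 0 \<le> fst p \<and> 0 \<le> snd p \<and> snd p + (fst p)\<^sup>2 \<le> t}"
  define K' where "K' = {p :: real \<times> real. 0 \<le> fst p \<and> (fst p)\<^sup>2 \<le> snd p \<and> snd p \<le> t}"
  define H where "H \<rho> r = indicator K (\<rho>, r) *\<^sub>R J' \<rho> r" for \<rho> r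
  define G where "G \<rho> s = indicator K' (\<rho>, s) *\<^sub>R J' \<rho> (s - \<rho>\<^sup>2)" for \<rho> s
  have sq: "\<rho> \<le> sqrt t" if "\<rho>\<^sup>2 \<le> t" for \<rho> using that real_le_rsqrt by blast
  have cK: "compact K"
  proof -
    have "closed K" unfolding K_def by (intro closed_Collect_conj closed_Collect_le continuous_intros)
    moreover have "K \<subseteq> cbox (0,0) (sqrt t, t)"
    proof
      fix p assume p: "p \<in> K"
      then have "(fst p)\<^sup>2 \<le> t" "snd p \<le> t" unfolding K_def by auto (smt (verit) zero_le_power2)
      with p sq show "p \<in> cbox (0,0) (sqrt t, t)" by (cases p) (auto simp: K_def)
    qed
    ultimately show ?thesis using compact_Int_closed[OF compact_cbox[of "(0,0)" "(sqrt t, t)"]]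
      by (metis inf.absorb_iff2)
  qed
  have cK': "compact K'"
  proof -
    have "closed K'" unfolding K'_def by (intro closed_Collect_conj closed_Collect_le continuous_intros)
    moreover have "K' \<subseteq> cbox (0,0) (sqrt t, t)"
    proof
      fix p assume p: "p \<in> K'"
      then have "(fst p)\<^sup>2 \<le> t" "0 \<le> snd p" unfolding K'_def by auto (smt (verit) zero_le_power2)
      with p sq show "p \<in> cbox (0,0) (sqrt t, t)" by (cases p) (auto simp: K'_def)
    qed
    ultimately show ?thesis using compact_Int_closed[OF compact_cbox[of "(0,0)" "(sqrt t, t)"]]
      by (metis inf.absorb_iff2)
  qed
  have sK: "r \<in> {0..t}" if "(\<rho>, r) \<in> K" for \<rho> r
    using that unfolding K_def by auto (smt (verit) zero_le_power2)
  have iH: "integrable (lborel \<Otimes>\<^sub>M lborel) (\<lambda>(\<rho>, r). H \<rho> r)"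
  proof -
    have "continuous_on K (\<lambda>p. J' (fst p) (snd p))"
      by (rule continuous_on_subset[OF cJ']) (use sK in auto)
    from borel_integrable_compact[OF cK this] show ?thesis
      by (simp add: lborel_prod H_def case_prod_beta')
  qed
  have iG: "integrable (lborel \<Otimes>\<^sub>M lborel) (\<lambda>(\<rho>, s). G \<rho> s)"
  proof -
    have "snd p - (fst p)\<^sup>2 \<in> {0..t}" if "p \<in> K'" for p
      using that unfolding K'_def by auto (smt (verit) zero_le_power2)
    then have "continuous_on K' (\<lambda>p. J' (fst p) (snd p - (fst p)\<^sup>2))"
      by (intro comp continuous_intros) auto
    from borel_integrable_compact[OF cK' this] show ?thesis
      by (simp add: lborel_prod G_def case_prod_beta')
  qed
  have GH: "G \<rho> (\<rho>\<^sup>2 + r) = H \<rho> r" for \<rho> r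
    by (auto simp: G_def H_def K_def K'_def indicator_def add.commute)
  have shift: "(\<integral>s. G \<rho> s \<partial>lborel) = (\<integral>r. H \<rho> r \<partial>lborel)" for \<rho>
    using lborel_integral_real_affine[of 1 "G \<rho>" "\<rho>\<^sup>2"] by (simp add: GH)
  define I where "I = (\<integral>r. (\<integral>\<rho>. H \<rho> r \<partial>lborel) \<partial>lborel)"
  have I': "(\<integral>s. (\<integral>\<rho>. G \<rho> s \<partial>lborel) \<partial>lborel) = I"
    unfolding I_def lborel_pair.Fubini_integral[OF iG] lborel_pair.Fubini_integral[OF iH] shift ..
  have innerH: "(\<integral>\<rho>. H \<rho> r \<partial>lborel) = (if r \<in> {0..t} then J (sqrt (t - r)) r - J 0 r else 0)" for r
  proof (cases "r \<in> {0..t}")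
    case True
    have iff: "0 \<le> \<rho> \<and> r + \<rho>\<^sup>2 \<le> t \<longleftrightarrow> \<rho> \<in> {0..sqrt (t - r)}" for \<rho>
      using True by (auto intro: real_le_rsqrt simp: algebra_simps dest!: real_le_rsqrt)
        (metis add.commute diff_ge_0_iff_ge le_diff_eq real_sqrt_le_iff real_sqrt_pow2_iff power_mono)
    have "(\<integral>\<rho>. H \<rho> r \<partial>lborel) = (\<integral>\<rho>. indicator {0..sqrt (t - r)} \<rho> *\<^sub>R J' \<rho> r \<partial>lborel)"
      using True iff by (intro Bochner_Integration.integral_cong) (auto simp: H_def K_def indicator_def)
    also have "\<dots> = J (sqrt (t - r)) r - J 0 r"
    proof (rule integral_FTC_atLeastAtMost)
      show "0 \<le> sqrt (t - r)" using True by simp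
      show "((\<lambda>\<rho>. J \<rho> r) has_vector_derivative J' \<rho> r) (at \<rho> within {0..sqrt (t - r)})" for \<rho>
        using der[OF True] has_real_derivative_iff_has_vector_derivative has_vector_derivative_at_within by blast
      show "continuous_on {0..sqrt (t - r)} (\<lambda>\<rho>. J' \<rho> r)"
        using True by (intro comp continuous_intros) auto
    qed
    finally show ?thesis using True by simp
  next
    case False
    then have "H \<rho> r = 0" for \<rho> using sK[of \<rho> r] by (auto simp: H_def indicator_def)
    then show ?thesis using False by (simp only: if_False) simp
  qed
  have innerG: "(\<integral>\<rho>. G \<rho> s \<partial>lborel) = (if s \<in> {0..t} then sqrt s * integral {0..1} (\<lambda>\<theta>. J' (sqrt s * \<theta>) (s * (1 - \<theta>\<^sup>2))) else 0)" for s
  proof (cases "s \<in> {0..t}")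
    case True
    let ?f = "\<lambda>\<rho>. J' \<rho> (s - \<rho>\<^sup>2)"
    have le: "\<rho>\<^sup>2 \<le> s" if "0 \<le> \<rho>" "\<rho> \<le> sqrt s" for \<rho>
      using power_mono[OF that(2,1), of 2] True by simp
    have iff: "0 \<le> \<rho> \<and> \<rho>\<^sup>2 \<le> s \<longleftrightarrow> \<rho> \<in> {0..sqrt s}" for \<rho>
      using le real_le_rsqrt by auto
    have c: "continuous_on {0..sqrt s} ?f"
    proof (intro comp continuous_intros)
      fix \<rho> assume "\<rho> \<in> {0..sqrt s}"
      then show "s - \<rho>\<^sup>2 \<in> {0..t}" using le[of \<rho>] True by auto (smt (verit) zero_le_power2)
    qed
    have "(\<integral>\<rho>. G \<rho> s \<partial>lborel) = (LINT \<rho>:{0..sqrt s}|lborel. ?f \<rho>)"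
      unfolding set_lebesgue_integral_def
      using True iff by (intro Bochner_Integration.integral_cong) (auto simp: G_def K'_def indicator_def)
    also have "\<dots> = integral {0..sqrt s} ?f"
      by (rule set_borel_integral_eq_integral(2)[OF borel_integrable_atLeastAtMost'[OF c]])
    also have "\<dots> = sqrt s * integral {0..1} (\<lambda>\<theta>. J' (sqrt s * \<theta>) (s * (1 - \<theta>\<^sup>2)))"
    proof -
      have "((\<lambda>\<theta>. sqrt s *\<^sub>R ?f (sqrt s * \<theta>)) has_integral (integral {sqrt s * 0..sqrt s * 1} ?f)) {0..1}"
        by (rule has_integral_substitution[where c=0 and d="sqrt s"])
          (use True c in \<open>auto intro!: derivative_eq_intros mult_left_le\<close>)
      moreover have "?f (sqrt s * \<theta>) = J' (sqrt s * \<theta>) (s * (1 - \<theta>\<^sup>2))" for \<theta>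
        using True by (simp add: power_mult_distrib right_diff_distrib)
      ultimately have "((\<lambda>\<theta>. sqrt s *\<^sub>R J' (sqrt s * \<theta>) (s * (1 - \<theta>\<^sup>2))) has_integral (integral {0..sqrt s} ?f)) {0..1}"
        by simp
      from integral_unique[OF this] show ?thesis by simp
    qed
    finally show ?thesis using True by simp
  next
    case False
    have "s \<in> {0..t}" if "(\<rho>, s) \<in> K'" for \<rho>
      using that unfolding K'_def by auto (smt (verit) zero_le_power2)
    then have "G \<rho> s = 0" for \<rho> using False by (auto simp: G_def indicator_def)
    then show ?thesis using False by (simp only: if_False) simp
  qed
  have A: "((\<lambda>s. sqrt s * integral {0..1} (\<lambda>\<theta>. J' (sqrt s * \<theta>) (s * (1 - \<theta>\<^sup>2)))) has_integral I) {0..t}"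
    using has_integral_integral_lborel[OF lborel_pair.integrable_snd[OF iG]]
    unfolding innerG I'[unfolded innerG] has_integral_restrict_UNIV .
  have B: "((\<lambda>r. J (sqrt (t - r)) r - J 0 r) has_integral I) {0..t}"
    using has_integral_integral_lborel[OF lborel_pair.integrable_snd[OF iH]]
    unfolding innerH I_def[unfolded innerH, symmetric] has_integral_restrict_UNIV .
  have cJ0: "continuous_on {0..t} (J 0)"
    by (intro comp continuous_intros) auto
  have cJs: "continuous_on {0..t} (\<lambda>r. J (sqrt (t - r)) r)"
    by (intro comp continuous_intros) auto
  have iJ0: "(J 0 has_integral integral {0..t} (J 0)) {0..t}"
    using integrable_continuous_real[OF cJ0] by (rule integrable_integral)
  have "integral {0..t} (\<lambda>r. J (sqrt (t - r)) r) = integral {0..t} (J 0) + I"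
    using has_integral_add[OF iJ0 B] by (simp add: integral_unique)
  \<comment> \<open>Substitution \<open>r = t * (1 - \<theta>\<^sup>2)\<close>, for which
    \<open>sqrt (t - r) = sqrt t * \<theta>\<close>.\<close>
  moreover have "integral {0..t} (\<lambda>r. J (sqrt (t - r)) r) = t * integral {0..1} (\<lambda>\<theta>. 2 * \<theta> * J (sqrt t * \<theta>) (t * (1 - \<theta>\<^sup>2)))"
  proof -
    let ?g = "\<lambda>\<theta>::real. t * (1 - \<theta>\<^sup>2)" and ?f = "\<lambda>r. J (sqrt (t - r)) r"
    have "((\<lambda>\<theta>. (- 2 * t * \<theta>) *\<^sub>R ?f (?g \<theta>)) has_integral (integral {?g 0..?g 1} ?f - integral {?g 1..?g 0} ?f)) {0..1}"
    proof (rule has_integral_substitution_general[where c=0 and d=t and s="{}"])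
      show "?g ` {0..1} \<subseteq> {0..t}"
        using t by (auto simp: power_le_one mult_left_le)
      show "(?g has_field_derivative - 2 * t * \<theta>) (at \<theta> within {0..1})" for \<theta>
        by (auto intro!: derivative_eq_intros)
    qed (use cJs in \<open>auto intro!: continuous_intros\<close>)
    from integral_unique[OF this]
    have "integral {0..1} (\<lambda>\<theta>. (- 2 * t * \<theta>) *\<^sub>R ?f (?g \<theta>)) = integral {t..0} ?f - integral {0..t} ?f"
      by simp
    moreover have "integral {t..0} ?f = 0" using t by (cases "t = 0") auto
    moreover have "integral {0..1} (\<lambda>\<theta>. (- 2 * t * \<theta>) *\<^sub>R ?f (?g \<theta>)) = integral {0..1} (\<lambda>\<theta>. (- t) * (2 * \<theta> * J (sqrt t * \<theta>) (t * (1 - \<theta>\<^sup>2))))"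
      using t by (intro integral_cong) (simp add: right_diff_distrib real_sqrt_mult)
    ultimately show ?thesis by simp
  qed
  ultimately show ?thesis using has_integral_add[OF iJ0 A] by simp
qed

section \<open>The heat flow and its time averages\<close>

definition cstrip :: "real \<Rightarrow> (real \<Rightarrow> 'a::topological_space \<Rightarrow> real) \<Rightarrow> bool" where
  "cstrip \<tau> g \<longleftrightarrow> continuous_on ({0..\<tau>} \<times> UNIV) (\<lambda>q. g (fst q) (snd q))"

lemma cstrip_comp:
  assumes "cstrip \<tau> g" "continuous_on A f" "continuous_on A h" "\<And>a. a \<in> A \<Longrightarrow> f a \<in> {0..\<tau>}"
  shows "continuous_on A (\<lambda>a. g (f a) (h a))"
  using continuous_on_compose2[OF assms(1)[unfolded cstrip_def], of A "\<lambda>a. (f a, h a)"] assms(2-)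
  by (auto simp: image_subset_iff intro!: continuous_on_Pair)

lemma cstrip_slice: "cstrip \<tau> g \<Longrightarrow> t \<in> {0..\<tau>} \<Longrightarrow> continuous_on UNIV (g t)"
  by (rule cstrip_comp) auto

lemma cstrip_slice_measurable: "cstrip \<tau> g \<Longrightarrow> t \<in> {0..\<tau>} \<Longrightarrow> g t \<in> borel_measurable borel"
  by (intro borel_measurable_continuous_onI cstrip_slice)

section \<open>Averages over a uniform time variable and a Gaussian space variable\<close>

definition U01 :: "real measure" where
  "U01 = density lborel (\<lambda>\<theta>. ennreal (indicator {0..1} \<theta>))"

lemma sets_U01[simp, measurable_cong]: "sets U01 = sets borel"
  by (simp add: U01_def)

lemma space_U01[simp]: "space U01 = UNIV"
  by (simp add: U01_def)

lemma prob_space_U01: "prob_space U01"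
  by (rule prob_spaceI) (simp add: U01_def emeasure_density ennreal_indicator)

text \<open>The point 0 is removed because the Gaussian average at scale
  \<open>c * sqrt t * \<theta>\<close> smooths only for positive \<theta>.\<close>

lemma AE_U01: "AE \<theta> in U01. 0 < \<theta> \<and> \<theta> \<le> 1"
proof -
  have "AE \<theta> in lborel. \<theta> \<noteq> (0::real)" by (rule AE_lborel_singleton)
  then show ?thesis unfolding U01_def
    by (subst AE_density) (auto simp: indicator_def split: if_splits)
qed

lemma integral_U01:
  fixes f :: "real \<Rightarrow> real"
  assumes [measurable]: "f \<in> borel_measurable borel"
  shows "(\<integral>\<theta>. f \<theta> \<partial>U01) = (\<integral>\<theta>. indicator {0..1} \<theta> * f \<theta> \<partial>lborel)"
  unfolding U01_def by (subst integral_real_density) auto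

lemma integral_U01_eq_integral:
  fixes f g :: "real \<Rightarrow> real"
  assumes [measurable]: "f \<in> borel_measurable borel" and c: "continuous_on {0..1} g"
    and eq: "\<And>\<theta>. \<theta> \<in> {0..1} \<Longrightarrow> f \<theta> = g \<theta>"
  shows "(\<integral>\<theta>. f \<theta> \<partial>U01) = integral {0..1} g"
proof -
  have "(\<integral>\<theta>. f \<theta> \<partial>U01) = (\<integral>\<theta>. indicator {0..1} \<theta> * g \<theta> \<partial>lborel)"
    unfolding integral_U01[OF assms(1)] using eq
    by (intro Bochner_Integration.integral_cong) (auto simp: indicator_def)
  then show ?thesis
    using set_borel_integral_eq_integral(2)[OF borel_integrable_atLeastAtMost'[OF c]]
    by (simp add: set_lebesgue_integral_def)
qed

definition QQ :: "(real \<times> (real^'n::finite)) measure" where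
  "QQ = U01 \<Otimes>\<^sub>M gauss"

lemma sets_QQ[simp, measurable_cong]: "sets QQ = sets borel"
  unfolding QQ_def by (subst borel_prod[symmetric]) (rule sets_pair_measure_cong; simp)

lemma space_QQ[simp]: "space QQ = UNIV"
  by (simp add: QQ_def space_pair_measure)

lemma pair_prob_space_QQ: "pair_prob_space U01 gauss"
  by (simp add: pair_prob_space_def pair_sigma_finite_def prob_space_U01 prob_space_gauss
      prob_space_imp_sigma_finite)

lemma prob_space_QQ: "prob_space QQ"
proof -
  interpret pair_prob_space U01 gauss by (rule pair_prob_space_QQ)
  show ?thesis unfolding QQ_def by (rule prob_space_axioms)
qed

lemma QQ_product:
  fixes a :: "real \<Rightarrow> real" and b :: "real^'n::finite \<Rightarrow> real"
  assumes a: "integrable U01 a" and b: "integrable gauss b"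
  shows "integrable QQ (\<lambda>p. a (fst p) * b (snd p))"
    and "(\<integral>p. a (fst p) * b (snd p) \<partial>QQ) = (\<integral>\<theta>. a \<theta> \<partial>U01) * (\<integral>z. b z \<partial>gauss)"
proof -
  interpret pair_prob_space U01 "gauss :: (real^'n) measure" by (rule pair_prob_space_QQ)
  have [measurable]: "a \<in> borel_measurable U01" "b \<in> borel_measurable gauss" using a b by auto
  have i: "integrable (U01 \<Otimes>\<^sub>M gauss) (\<lambda>p. a (fst p) * b (snd p))"
    by (rule Fubini_integrable) (use a b in \<open>auto simp: abs_mult\<close>)
  then show "integrable QQ (\<lambda>p. a (fst p) * b (snd p))" by (simp add: QQ_def)
  show "(\<integral>p. a (fst p) * b (snd p) \<partial>QQ) = (\<integral>\<theta>. a \<theta> \<partial>U01) * (\<integral>z. b z \<partial>gauss)"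
    unfolding QQ_def integral_fst'[OF i, symmetric] by simp
qed

text \<open>For \<open>\<theta>\<close> uniform on \<open>[0,1]\<close> and \<open>z\<close> standard normal, \<open>avg\<close> is the time integral of the heat flow of \<open>g\<close>
  after the substitution \<open>s = t (1 - \<theta>\<^sup>2)\<close>; the truncation \<open>max 0\<close> is inactive on \<open>[0,1]\<close> and only keeps the
  time argument in \<open>[0,t]\<close> for all real \<open>\<theta>\<close>.\<close>

definition avg :: "real \<Rightarrow> (real \<times> (real^'n::finite) \<Rightarrow> real) \<Rightarrow> (real \<Rightarrow> real^'n \<Rightarrow> real) \<Rightarrow> real \<Rightarrow> real^'n \<Rightarrow> real" where
  "avg c k g t x = (\<integral>p. k p * g (t * max 0 (1 - (fst p)\<^sup>2)) (x + (c * sqrt t * fst p) *\<^sub>R snd p) \<partial>QQ)"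

text \<open>Equals \<open>2 * \<theta>\<close> on the unit interval, the Jacobian of the time
  substitution divided by \<open>t\<close>. The minimum and the absolute value keep it bounded and
  nonnegative for all real \<theta>.\<close>

definition k0 :: "real \<times> (real^'n::finite) \<Rightarrow> real" where "k0 p = 2 * min 1 \<bar>fst p\<bar>"

text \<open>The weight left when a derivative in direction \<open>j\<close> falls on the Gaussian
  density; it replaces \<open>k0\<close> because its factor \<open>1 / \<theta>\<close> cancels the
  Jacobian.\<close>

definition kz :: "'n \<Rightarrow> real \<times> (real^'n::finite) \<Rightarrow> real" where "kz j p = snd p $ j"

lemma tm_mem: "t \<in> {0..\<tau>} \<Longrightarrow> t * max 0 (1 - \<theta>\<^sup>2) \<in> {0..\<tau>}" for t \<theta> :: real
  by (auto simp: mult_left_le intro: order_trans[of _ t])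

lemma tm_le: "0 \<le> t \<Longrightarrow> t * max 0 (1 - \<theta>\<^sup>2) \<le> t" for t \<theta> :: real
  using tm_mem[of t t \<theta>] by auto

lemma k0_measurable[measurable]: "k0 \<in> borel_measurable borel"
  unfolding k0_def[abs_def] by (intro borel_measurable_continuous_onI continuous_intros)

lemma kz_measurable[measurable]: "kz j \<in> borel_measurable borel"
  unfolding kz_def[abs_def] by (intro borel_measurable_continuous_onI continuous_intros)

lemma k0_integrable: "integrable QQ k0"
proof -
  interpret prob_space "QQ :: (real \<times> (real^'a)) measure" by (rule prob_space_QQ)
  show ?thesis by (rule integrable_const_bound[of _ 2]) (auto simp: k0_def intro!: AE_I2)
qed

lemma kz_integrable: "integrable QQ (kz j)"
proof -
  interpret prob_space U01 by (rule prob_space_U01)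
  have "integrable gauss (\<lambda>z::real^'a. z $ j)"
    by (rule Bochner_Integration.integrable_bound[OF gauss_abs_integrable[of j]]) auto
  from QQ_product(1)[OF _ this, of "\<lambda>_. 1"] show ?thesis by (simp add: kz_def[abs_def])
qed

context
  fixes \<tau> B c :: real and g :: "real \<Rightarrow> real^'n::finite \<Rightarrow> real"
  assumes g: "cstrip \<tau> g" and B: "\<And>t x. t \<in> {0..\<tau>} \<Longrightarrow> \<bar>g t x\<bar> \<le> B"
begin

lemma avg_kernel_measurable:
  "t \<in> {0..\<tau>} \<Longrightarrow> (\<lambda>p. g (t * max 0 (1 - (fst p)\<^sup>2)) (x + (c * sqrt t * fst p) *\<^sub>R snd p)) \<in> borel_measurable borel"
  by (intro borel_measurable_continuous_onI cstrip_comp[OF g] continuous_intros tm_mem)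

lemma avg_integrable:
  assumes k: "integrable QQ k" and t: "t \<in> {0..\<tau>}"
  shows "integrable QQ (\<lambda>p. k p * g (t * max 0 (1 - (fst p)\<^sup>2)) (x + (c * sqrt t * fst p) *\<^sub>R snd p))"
proof (rule Bochner_Integration.integrable_bound[of _ "\<lambda>p. B * k p"])
  have [measurable]: "k \<in> borel_measurable QQ" using k by simp
  note avg_kernel_measurable[OF t, measurable]
  show "(\<lambda>p. k p * g (t * max 0 (1 - (fst p)\<^sup>2)) (x + (c * sqrt t * fst p) *\<^sub>R snd p)) \<in> borel_measurable QQ"
    by measurable
  show "AE p in QQ. norm (k p * g (t * max 0 (1 - (fst p)\<^sup>2)) (x + (c * sqrt t * fst p) *\<^sub>R snd p)) \<le> norm (B * k p)"
  proof (rule AE_I2)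
    fix p :: "real \<times> (real^'n)"
    have "\<bar>g (t * max 0 (1 - (fst p)\<^sup>2)) (x + (c * sqrt t * fst p) *\<^sub>R snd p)\<bar> \<le> \<bar>B\<bar>"
      using B[OF tm_mem[OF t, of "fst p"]] by (rule order_trans) simp
    from mult_left_mono[OF this, of "\<bar>k p\<bar>"]
    show "norm (k p * g (t * max 0 (1 - (fst p)\<^sup>2)) (x + (c * sqrt t * fst p) *\<^sub>R snd p)) \<le> norm (B * k p)"
      by (simp add: abs_mult mult.commute)
  qed
qed (use k in simp)

lemma avg_cstrip:
  assumes k: "integrable QQ k"
  shows "cstrip \<tau> (avg c k g)"
  unfolding cstrip_def avg_def
proof (rule continuous_on_integral_dominated[where W="\<lambda>p. \<bar>k p\<bar> * B"])
  fix q :: "real \<times> (real^'n)" and p :: "real \<times> (real^'n)" assume q: "q \<in> {0..\<tau>} \<times> UNIV"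
  then have "fst q \<in> {0..\<tau>}" by auto
  then show "(\<lambda>p. k p * g (fst q * max 0 (1 - (fst p)\<^sup>2)) (snd q + (c * sqrt (fst q) * fst p) *\<^sub>R snd p)) \<in> borel_measurable QQ"
    using avg_integrable[OF k] by (intro borel_measurable_integrable)
  show "\<bar>k p * g (fst q * max 0 (1 - (fst p)\<^sup>2)) (snd q + (c * sqrt (fst q) * fst p) *\<^sub>R snd p)\<bar> \<le> \<bar>k p\<bar> * B"
    unfolding abs_mult using B tm_mem[OF \<open>fst q \<in> {0..\<tau>}\<close>] by (intro mult_left_mono) auto
next
  fix p :: "real \<times> (real^'n)"
  have "fst q * max 0 (1 - (fst p)\<^sup>2) \<in> {0..\<tau>}" if "q \<in> {0..\<tau>} \<times> (UNIV :: (real^'n) set)" for q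
    using that by (intro tm_mem) auto
  then show "continuous_on ({0..\<tau>} \<times> UNIV) (\<lambda>q. k p * g (fst q * max 0 (1 - (fst p)\<^sup>2)) (snd q + (c * sqrt (fst q) * fst p) *\<^sub>R snd p))"
    by (intro continuous_intros cstrip_comp[OF g])
qed (use k in auto)

lemma avg_pder:
  assumes k: "integrable QQ k" and t: "t \<in> {0..\<tau>}"
    and g': "cstrip \<tau> g'" "\<And>t x. t \<in> {0..\<tau>} \<Longrightarrow> \<bar>g' t x\<bar> \<le> B'"
    and d: "\<And>t. t \<in> {0..\<tau>} \<Longrightarrow> pder j (g t) (g' t)"
  shows "pder j (avg c k g t) (avg c k g' t)"
  unfolding avg_def
proof (rule pder_integral[where W="\<lambda>p. \<bar>k p\<bar> * B'"])
  show "integrable QQ (\<lambda>p. k p * g (t * max 0 (1 - (fst p)\<^sup>2)) (x + (c * sqrt t * fst p) *\<^sub>R snd p))" for x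
    by (rule avg_integrable[OF k t])
  have [measurable]: "k \<in> borel_measurable QQ" using k by simp
  have [measurable]: "(\<lambda>p. g' (t * max 0 (1 - (fst p)\<^sup>2)) (x + (c * sqrt t * fst p) *\<^sub>R snd p)) \<in> borel_measurable borel" for x
    by (intro borel_measurable_continuous_onI cstrip_comp[OF g'(1)] continuous_intros tm_mem[OF t])
  show "(\<lambda>p. k p * g' (t * max 0 (1 - (fst p)\<^sup>2)) (x + (c * sqrt t * fst p) *\<^sub>R snd p)) \<in> borel_measurable QQ" for x
    by measurable
  fix p :: "real \<times> (real^'n)"
  let ?s = "t * max 0 (1 - (fst p)\<^sup>2)"
  have s: "?s \<in> {0..\<tau>}" by (rule tm_mem[OF t])
  show "\<bar>k p * g' ?s (x + (c * sqrt t * fst p) *\<^sub>R snd p)\<bar> \<le> \<bar>k p\<bar> * B'" for x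
    unfolding abs_mult using g'(2)[OF s] by (intro mult_left_mono) auto
  have "pder j (\<lambda>x. g ?s (x + (c * sqrt t * fst p) *\<^sub>R snd p)) (\<lambda>x. g' ?s (x + (c * sqrt t * fst p) *\<^sub>R snd p))"
    by (rule pder_translate[OF d[OF s]])
  then show "pder j (\<lambda>x. k p * g ?s (x + (c * sqrt t * fst p) *\<^sub>R snd p)) (\<lambda>x. k p * g' ?s (x + (c * sqrt t * fst p) *\<^sub>R snd p))"
    unfolding pder_def by (auto intro!: DERIV_cmult)
qed (use k in auto)

lemma avg_fubini:
  assumes k: "integrable QQ k" and t: "t \<in> {0..\<tau>}"
  shows "integrable U01 (\<lambda>\<theta>. \<integral>z. k (\<theta>, z) * g (t * max 0 (1 - \<theta>\<^sup>2)) (x + (c * sqrt t * \<theta>) *\<^sub>R z) \<partial>gauss)"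
    and "avg c k g t x = (\<integral>\<theta>. (\<integral>z. k (\<theta>, z) * g (t * max 0 (1 - \<theta>\<^sup>2)) (x + (c * sqrt t * \<theta>) *\<^sub>R z) \<partial>gauss) \<partial>U01)"
proof -
  interpret pair_prob_space U01 "gauss :: (real^'n) measure" by (rule pair_prob_space_QQ)
  note i = avg_integrable[OF k t, unfolded QQ_def]
  show "integrable U01 (\<lambda>\<theta>. \<integral>z. k (\<theta>, z) * g (t * max 0 (1 - \<theta>\<^sup>2)) (x + (c * sqrt t * \<theta>) *\<^sub>R z) \<partial>gauss)"
    using integrable_fst'[OF i] by simp
  show "avg c k g t x = (\<integral>\<theta>. (\<integral>z. k (\<theta>, z) * g (t * max 0 (1 - \<theta>\<^sup>2)) (x + (c * sqrt t * \<theta>) *\<^sub>R z) \<partial>gauss) \<partial>U01)"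
    using integral_fst'[OF i] by (simp add: avg_def QQ_def)
qed

text \<open>One derivative is gained from a mere sup bound on \<open>g\<close>: differentiating the
  average at scale \<open>c * sqrt t * \<theta>\<close> produces the inverse of that scale, and the
  Jacobian \<open>2 * t * \<theta>\<close> turns it into the integrable constant
  \<open>2 * sqrt t / c\<close>.\<close>

lemma avg_smoothing:
  assumes t: "t \<in> {0..\<tau>}" and c: "0 < c"
  shows "pder j (\<lambda>x. t * avg c k0 g t x) (\<lambda>x. (2 * sqrt t / c) * avg c (kz j) g t x)"
proof (cases "t = 0")
  case True then show ?thesis by (simp add: pder_def)
next
  case False
  then have t0: "0 < t" using t by auto
  have s: "t * max 0 (1 - \<theta>\<^sup>2) \<in> {0..\<tau>}" for \<theta> by (rule tm_mem[OF t])
  define A where "A x \<theta> = (\<integral>z. g (t * max 0 (1 - \<theta>\<^sup>2)) (x + (c * sqrt t * \<theta>) *\<^sub>R z) \<partial>gauss)" for x \<theta>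
  define A' where "A' x \<theta> = (\<integral>z. z $ j * g (t * max 0 (1 - \<theta>\<^sup>2)) (x + (c * sqrt t * \<theta>) *\<^sub>R z) \<partial>gauss)" for x \<theta>
  \<comment> \<open>The indicator excludes \<theta> = 0, where the average need not be
    differentiable in \<open>x\<close>; this changes the integrals only by a null set.\<close>
  define G where "G x \<theta> = indicator {0<..1} \<theta> * (2 * t * \<theta> * A x \<theta>)" for x \<theta>
  define G' where "G' x \<theta> = indicator {0<..1} \<theta> * ((2 * sqrt t / c) * A' x \<theta>)" for x \<theta>
  have B0: "0 \<le> B" using B[OF t, of 0] by linarith
  define m where "m = (\<integral>z. \<bar>(z::real^'n) $ j\<bar> \<partial>gauss)"
  have i0: "integrable U01 (\<lambda>\<theta>. 2 * min 1 \<bar>\<theta>\<bar> * A x \<theta>)" for x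
    using avg_fubini(1)[OF k0_integrable t, of x] by (simp add: k0_def A_def mult.assoc)
  have iz: "integrable U01 (A' x)" for x
    using avg_fubini(1)[OF kz_integrable t, of j x] by (simp add: kz_def A'_def[abs_def])
  have [measurable]: "(\<lambda>\<theta>. 2 * min 1 \<bar>\<theta>\<bar> * A x \<theta>) \<in> borel_measurable borel" for x
    using borel_measurable_integrable[OF i0] by simp
  have [measurable]: "A' x \<in> borel_measurable borel" for x
    using borel_measurable_integrable[OF iz] by simp
  have G0: "G x \<theta> = indicator {0<..1} \<theta> * (t * (2 * min 1 \<bar>\<theta>\<bar> * A x \<theta>))" for x \<theta>
    by (auto simp: G_def indicator_def)
  have [measurable]: "G x \<in> borel_measurable borel" for x
    unfolding G0[abs_def] by measurable
  have iG: "integrable U01 (G x)" for x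
    by (rule Bochner_Integration.integrable_bound[OF integrable_mult_right[OF i0[of x], of t]])
      (auto simp: G0 indicator_def)
  have "pder j (\<lambda>x. \<integral>\<theta>. G x \<theta> \<partial>U01) (\<lambda>x. \<integral>\<theta>. G' x \<theta> \<partial>U01)"
  proof (rule pder_integral[where W="\<lambda>_. (2 * sqrt t / c) * (m * B)"])
    interpret prob_space U01 by (rule prob_space_U01)
    show "integrable U01 (\<lambda>_. (2 * sqrt t / c) * (m * B))" by simp
    show "G' x \<in> borel_measurable U01" for x unfolding G'_def[abs_def] by measurable
    have mm: "0 \<le> m" unfolding m_def by simp
    fix \<theta>
    let ?g = "g (t * max 0 (1 - \<theta>\<^sup>2))"
    have gm[measurable]: "?g \<in> borel_measurable borel" by (rule cstrip_slice_measurable[OF g s])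
    show "\<bar>G' x \<theta>\<bar> \<le> (2 * sqrt t / c) * (m * B)" for x
    proof -
      have "\<bar>A' x \<theta>\<bar> \<le> (\<integral>z. \<bar>z $ j * ?g (x + (c * sqrt t * \<theta>) *\<^sub>R z)\<bar> \<partial>gauss)"
        unfolding A'_def by (rule integral_abs_bound)
      also have "\<dots> \<le> (\<integral>z. \<bar>z $ j\<bar> * B \<partial>gauss)"
      proof (rule integral_mono')
        show "integrable gauss (\<lambda>z::real^'n. \<bar>z $ j\<bar> * B)" using gauss_abs_integrable[of j] by simp
        show "\<bar>z $ j * ?g (x + (c * sqrt t * \<theta>) *\<^sub>R z)\<bar> \<le> \<bar>z $ j\<bar> * B" for z
          unfolding abs_mult by (intro mult_left_mono B[OF s]) auto
        show "0 \<le> \<bar>z $ j\<bar> * B" for z :: "real^'n" using B0 by auto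
      qed
      also have "\<dots> = m * B" by (simp add: m_def)
      finally have "\<bar>A' x \<theta>\<bar> \<le> m * B" .
      from mult_left_mono[OF this, of "2 * sqrt t / c"] show ?thesis
        using c t0 mm B0 by (auto simp: G'_def indicator_def abs_mult)
    qed
    show "pder j (\<lambda>x. G x \<theta>) (\<lambda>x. G' x \<theta>)"
    proof (cases "0 < \<theta> \<and> \<theta> \<le> 1")
      case False then show ?thesis by (auto simp: G_def G'_def indicator_def pder_def)
    next
      case True
      have "pder j (\<lambda>x. A x \<theta>) (\<lambda>x. (1 / (c * sqrt t * \<theta>)) * A' x \<theta>)"
        unfolding A_def A'_def by (rule pder_gauss_average[OF gm B[OF s]]) (use c t0 True in auto)
      then have "pder j (\<lambda>x. (2 * t * \<theta>) * A x \<theta>) (\<lambda>x. (2 * t * \<theta>) * ((1 / (c * sqrt t * \<theta>)) * A' x \<theta>))"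
        unfolding pder_def by (intro allI DERIV_cmult) (erule spec)
      moreover have "(2 * t * \<theta>) * ((1 / (c * sqrt t * \<theta>)) * a) = (2 * sqrt t / c) * a" for a
        using c t0 True by (simp add: field_simps)
      ultimately show ?thesis using True by (simp add: G_def G'_def indicator_def)
    qed
  qed (rule iG)
  moreover have "(\<integral>\<theta>. G x \<theta> \<partial>U01) = t * avg c k0 g t x" for x
  proof -
    have "(\<integral>\<theta>. G x \<theta> \<partial>U01) = (\<integral>\<theta>. t * (2 * min 1 \<bar>\<theta>\<bar> * A x \<theta>) \<partial>U01)"
    proof (rule integral_cong_AE)
      show "AE \<theta> in U01. G x \<theta> = t * (2 * min 1 \<bar>\<theta>\<bar> * A x \<theta>)"
        using AE_U01 by eventually_elim (auto simp: G0)
    qed auto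
    also have "\<dots> = t * (\<integral>\<theta>. 2 * min 1 \<bar>\<theta>\<bar> * A x \<theta> \<partial>U01)" by simp
    finally show ?thesis by (simp add: avg_fubini(2)[OF k0_integrable t] k0_def A_def mult.assoc)
  qed
  moreover have "(\<integral>\<theta>. G' x \<theta> \<partial>U01) = (2 * sqrt t / c) * avg c (kz j) g t x" for x
  proof -
    have "(\<integral>\<theta>. G' x \<theta> \<partial>U01) = (\<integral>\<theta>. (2 * sqrt t / c) * A' x \<theta> \<partial>U01)"
    proof (rule integral_cong_AE)
      show "AE \<theta> in U01. G' x \<theta> = (2 * sqrt t / c) * A' x \<theta>"
        using AE_U01 by eventually_elim (auto simp: G'_def)
    qed (auto simp: G'_def[abs_def])
    also have "\<dots> = (2 * sqrt t / c) * (\<integral>\<theta>. A' x \<theta> \<partial>U01)" by simp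
    finally show ?thesis by (simp add: avg_fubini(2)[OF kz_integrable t] kz_def A'_def)
  qed
  ultimately show ?thesis by simp
qed

end

text \<open>Source of the factor \<open>1 / sqrt \<mu>\<close> that makes the Duhamel map contract.
  With \<open>a = sqrt (\<mu> * t)\<close> the integrand is \<open>exp (\<mu> * t)\<close> times
  \<open>exp (- (a * \<theta>)\<^sup>2)\<close>, which is at most
  \<open>1 / (1 + (a * \<theta>)\<^sup>2)\<close>; the primitive of \<open>a\<close> times this
  bound is an arctangent, below 2 uniformly in \<open>t\<close>.\<close>

lemma U01_exp_bound:
  assumes t: "0 \<le> t" and lam: "0 < \<mu>"
  shows "integrable U01 (\<lambda>\<theta>. exp (\<mu> * (t * max 0 (1 - \<theta>\<^sup>2))))"
    and "sqrt t * (\<integral>\<theta>. exp (\<mu> * (t * max 0 (1 - \<theta>\<^sup>2))) \<partial>U01) \<le> (2 / sqrt \<mu>) * exp (\<mu> * t)"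
proof -
  interpret prob_space U01 by (rule prob_space_U01)
  have [measurable]: "(\<lambda>\<theta>. exp (\<mu> * (t * max 0 (1 - \<theta>\<^sup>2)))) \<in> borel_measurable borel"
    by (intro borel_measurable_continuous_onI continuous_intros)
  show i: "integrable U01 (\<lambda>\<theta>. exp (\<mu> * (t * max 0 (1 - \<theta>\<^sup>2))))"
    using tm_le[OF t] lam by (intro integrable_const_bound[of _ "exp (\<mu> * t)"]) (auto intro!: AE_I2)
  define a where "a = sqrt (\<mu> * t)"
  have sa: "sqrt t = a / sqrt \<mu>" using lam by (simp add: a_def real_sqrt_mult)
  have a0: "0 \<le> a" using t lam by (simp add: a_def)
  have a2: "a\<^sup>2 = \<mu> * t" using t lam by (simp add: a_def)
  have pos: "1 + (a * \<theta>)\<^sup>2 > 0" for \<theta> by (simp add: add_pos_nonneg)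
  have c: "continuous_on {0..1} (\<lambda>\<theta>. a / (1 + (a * \<theta>)\<^sup>2))"
    using pos by (intro continuous_intros ballI) (metis less_irrefl)
  have FTC: "(\<integral>\<theta>. indicator {0..1} \<theta> *\<^sub>R (a / (1 + (a * \<theta>)\<^sup>2)) \<partial>lborel) = arctan (a * 1) - arctan (a * 0)"
  proof (rule integral_FTC_atLeastAtMost)
    fix \<theta> :: real
    have "((\<lambda>\<theta>. arctan (a * \<theta>)) has_real_derivative a / (1 + (a * \<theta>)\<^sup>2)) (at \<theta> within {0..1})"
      by (rule has_field_derivative_at_within)
        (auto intro!: derivative_eq_intros simp: divide_inverse)
    then show "((\<lambda>\<theta>. arctan (a * \<theta>)) has_vector_derivative a / (1 + (a * \<theta>)\<^sup>2)) (at \<theta> within {0..1})"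
      by (simp add: has_real_derivative_iff_has_vector_derivative)
  qed (use c in auto)
  have int1: "integrable lborel (\<lambda>\<theta>. indicator {0..1} \<theta> *\<^sub>R (a / (1 + (a * \<theta>)\<^sup>2)))"
    using borel_integrable_atLeastAtMost'[OF c] by (simp add: set_integrable_def)
  have "a * (\<integral>\<theta>. exp (\<mu> * (t * max 0 (1 - \<theta>\<^sup>2))) \<partial>U01) = (\<integral>\<theta>. indicator {0..1} \<theta> * (a * exp (\<mu> * (t * max 0 (1 - \<theta>\<^sup>2)))) \<partial>lborel)"
    by (subst integral_U01) (auto simp: mult.left_commute)
  also have "\<dots> \<le> (\<integral>\<theta>. exp (\<mu> * t) * (indicator {0..1} \<theta> *\<^sub>R (a / (1 + (a * \<theta>)\<^sup>2))) \<partial>lborel)"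
  proof (rule integral_mono')
    fix \<theta> :: real
    show "indicator {0..1} \<theta> * (a * exp (\<mu> * (t * max 0 (1 - \<theta>\<^sup>2)))) \<le> exp (\<mu> * t) * (indicator {0..1} \<theta> *\<^sub>R (a / (1 + (a * \<theta>)\<^sup>2)))"
    proof (cases "\<theta> \<in> {0..1}")
      case True
      then have mx: "max 0 (1 - \<theta>\<^sup>2) = 1 - \<theta>\<^sup>2" by (auto simp: power_le_one)
      have "exp (\<mu> * (t * (1 - \<theta>\<^sup>2))) = exp (\<mu> * t) * exp (- (a * \<theta>)\<^sup>2)"
        by (simp add: exp_add[symmetric] power_mult_distrib a2 algebra_simps)
      also have "exp (- (a * \<theta>)\<^sup>2) \<le> 1 / (1 + (a * \<theta>)\<^sup>2)"
        using exp_ge_add_one_self[of "(a * \<theta>)\<^sup>2"] pos[of \<theta>]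
        by (simp add: exp_minus inverse_eq_divide frac_le del: exp_ge_add_one_self)
      finally have "exp (\<mu> * (t * (1 - \<theta>\<^sup>2))) \<le> exp (\<mu> * t) * (1 / (1 + (a * \<theta>)\<^sup>2))" by simp
      from mult_left_mono[OF this a0] True mx show ?thesis by (simp add: mult_ac)
    qed auto
    show "0 \<le> exp (\<mu> * t) * (indicator {0..1} \<theta> *\<^sub>R (a / (1 + (a * \<theta>)\<^sup>2)))"
      using a0 pos[of \<theta>] by (intro mult_nonneg_nonneg) (auto simp: indicator_def less_imp_le)
  qed (use int1 in \<open>simp only: integrable_mult_right\<close>)
  also have "\<dots> = exp (\<mu> * t) * arctan a" by (subst integral_mult_right_zero, subst FTC) simp
  also have "\<dots> \<le> exp (\<mu> * t) * 2"
    using arctan_bounded[of a] pi_less_4 by (intro mult_left_mono) auto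
  finally have "a * (\<integral>\<theta>. exp (\<mu> * (t * max 0 (1 - \<theta>\<^sup>2))) \<partial>U01) \<le> exp (\<mu> * t) * 2" .
  from divide_right_mono[OF this, of "sqrt \<mu>"] lam
  show "sqrt t * (\<integral>\<theta>. exp (\<mu> * (t * max 0 (1 - \<theta>\<^sup>2))) \<partial>U01) \<le> (2 / sqrt \<mu>) * exp (\<mu> * t)"
    by (simp add: sa mult_ac)
qed

text \<open>The kernel is bounded by a function of the Gaussian variable alone, so the double
  integral factorises and \<open>U01_exp_bound\<close> takes care of time.\<close>

lemma avg_weighted_bound:
  fixes g :: "real \<Rightarrow> real^'n::finite \<Rightarrow> real" and \<kappa> :: "real^'n \<Rightarrow> real"
  assumes t: "t \<in> {0..\<tau>}" and lam: "0 < \<mu>"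
    and g: "\<And>s y. s \<in> {0..\<tau>} \<Longrightarrow> \<bar>g s y\<bar> \<le> D * exp (\<mu> * s)"
    and k: "\<And>p. \<bar>k p\<bar> \<le> \<kappa> (snd p)" and \<kappa>: "integrable gauss \<kappa>"
  shows "sqrt t * \<bar>avg c k g t x\<bar> \<le> (D * (2 / sqrt \<mu>) * (\<integral>z. \<kappa> z \<partial>gauss)) * exp (\<mu> * t)"
proof -
  let ?s = "\<lambda>\<theta>. t * max 0 (1 - \<theta>\<^sup>2)"
  have t0: "0 \<le> t" using t by auto
  have \<kappa>0: "0 \<le> \<kappa> z" for z using k[of "(0,z)"] by (simp add: order_trans[OF abs_ge_zero])
  have D0: "0 \<le> D"
  proof -
    have "0 \<le> D * exp (\<mu> * t)" using g[OF t, of 0] by linarith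
    then show ?thesis by (simp add: zero_le_mult_iff)
  qed
  note E = U01_exp_bound[OF t0 lam]
  have iD: "integrable U01 (\<lambda>\<theta>. D * exp (\<mu> * ?s \<theta>))" using E(1) by simp
  have "\<bar>avg c k g t x\<bar> \<le> (\<integral>p. \<bar>k p * g (?s (fst p)) (x + (c * sqrt t * fst p) *\<^sub>R snd p)\<bar> \<partial>QQ)"
    unfolding avg_def by (rule integral_abs_bound)
  also have "\<dots> \<le> (\<integral>p. (D * exp (\<mu> * ?s (fst p))) * \<kappa> (snd p) \<partial>QQ)"
  proof (rule integral_mono'[OF QQ_product(1)[OF iD \<kappa>]])
    fix p
    have "\<bar>k p\<bar> * \<bar>g (?s (fst p)) (x + (c * sqrt t * fst p) *\<^sub>R snd p)\<bar> \<le> \<kappa> (snd p) * (D * exp (\<mu> * ?s (fst p)))"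
      using \<kappa>0 by (intro mult_mono k g tm_mem[OF t]) auto
    then show "\<bar>k p * g (?s (fst p)) (x + (c * sqrt t * fst p) *\<^sub>R snd p)\<bar> \<le> (D * exp (\<mu> * ?s (fst p))) * \<kappa> (snd p)"
      by (simp add: abs_mult mult_ac)
    show "0 \<le> (D * exp (\<mu> * ?s (fst p))) * \<kappa> (snd p)" using D0 \<kappa>0 by auto
  qed
  also have "\<dots> = D * (\<integral>\<theta>. exp (\<mu> * ?s \<theta>) \<partial>U01) * (\<integral>z. \<kappa> z \<partial>gauss)"
    unfolding QQ_product(2)[OF iD \<kappa>] by simp
  finally have "sqrt t * \<bar>avg c k g t x\<bar> \<le> sqrt t * (D * (\<integral>\<theta>. exp (\<mu> * ?s \<theta>) \<partial>U01) * (\<integral>z. \<kappa> z \<partial>gauss))"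
    by (intro mult_left_mono) (use t0 in auto)
  also have "\<dots> = D * (\<integral>z. \<kappa> z \<partial>gauss) * (sqrt t * (\<integral>\<theta>. exp (\<mu> * ?s \<theta>) \<partial>U01))" by (simp add: mult_ac)
  also have "\<dots> \<le> D * (\<integral>z. \<kappa> z \<partial>gauss) * ((2 / sqrt \<mu>) * exp (\<mu> * t))"
    using D0 \<kappa>0 by (intro mult_left_mono E(2) mult_nonneg_nonneg integral_nonneg_AE) auto
  finally show ?thesis by (simp add: mult_ac)
qed

lemma avg_diff:
  fixes g1 g2 :: "real \<Rightarrow> real^'n::finite \<Rightarrow> real"
  assumes "cstrip \<tau> g1" "\<And>t x. t \<in> {0..\<tau>} \<Longrightarrow> \<bar>g1 t x\<bar> \<le> B1"
    and "cstrip \<tau> g2" "\<And>t x. t \<in> {0..\<tau>} \<Longrightarrow> \<bar>g2 t x\<bar> \<le> B2"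
    and "integrable QQ k" "t \<in> {0..\<tau>}"
  shows "avg c k g1 t x - avg c k g2 t x = avg c k (\<lambda>s y. g1 s y - g2 s y) t x"
  unfolding avg_def
  using avg_integrable[OF assms(1,2,5,6), of x c] avg_integrable[OF assms(3,4,5,6), of x c]
  by (subst Bochner_Integration.integral_diff[symmetric]) (auto simp: right_diff_distrib)

text \<open>Only times up to \<open>t\<close> are evaluated, for every real \<theta> thanks to the
  truncation in \<open>avg\<close>. Hence measurability of \<open>g\<close> up to time
  \<open>t\<close> suffices: the Duhamel integral is nonanticipating.\<close>

lemma avg_measurable_param:
  fixes g :: "'w \<Rightarrow> real \<Rightarrow> real^'n::finite \<Rightarrow> real"
  assumes t: "t \<in> {0..\<tau>}" and k[measurable]: "k \<in> borel_measurable borel"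
    and g: "\<And>w. w \<in> space N \<Longrightarrow> cstrip \<tau> (g w)"
    and m: "\<And>s y. s \<in> {0..t} \<Longrightarrow> (\<lambda>w. g w s y) \<in> borel_measurable N"
  shows "(\<lambda>w. avg c k (g w) t x) \<in> borel_measurable N"
proof -
  interpret prob_space "QQ :: (real \<times> (real^'n)) measure" by (rule prob_space_QQ)
  define f where "f p w = g w (t * max 0 (1 - (fst p)\<^sup>2)) (x + (c * sqrt t * fst p) *\<^sub>R snd p)"
    for p :: "real \<times> (real^'n)" and w
  have "(\<lambda>q. f (snd q) (fst q)) \<in> borel_measurable (N \<Otimes>\<^sub>M (QQ :: (real \<times> (real^'n)) measure))"
  proof (rule measurable_caratheodory_compose[where f="\<lambda>p q. f p (fst q)" and g=snd])
    fix p :: "real \<times> (real^'n)"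
    have "t * max 0 (1 - (fst p)\<^sup>2) \<in> {0..t}" using t by (intro tm_mem) auto
    from m[OF this] have [measurable]: "f p \<in> borel_measurable N" unfolding f_def .
    show "(\<lambda>q. f p (fst q)) \<in> borel_measurable (N \<Otimes>\<^sub>M (QQ :: (real \<times> (real^'n)) measure))" by measurable
  next
    fix q assume "q \<in> space (N \<Otimes>\<^sub>M (QQ :: (real \<times> (real^'n)) measure))"
    then have "fst q \<in> space N" by (auto simp: space_pair_measure)
    then show "continuous_on UNIV (\<lambda>p. f p (fst q))" unfolding f_def
      by (intro cstrip_comp[OF g] continuous_intros tm_mem[OF t])
  next
    have "snd \<in> N \<Otimes>\<^sub>M QQ \<rightarrow>\<^sub>M (QQ :: (real \<times> (real^'n)) measure)" by simp
    then show "snd \<in> borel_measurable (N \<Otimes>\<^sub>M (QQ :: (real \<times> (real^'n)) measure))"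
      by (simp cong: measurable_cong_sets)
  qed
  then have "(\<lambda>(w, p). k p * f p w) \<in> borel_measurable (N \<Otimes>\<^sub>M QQ)"
    by (simp add: case_prod_beta')
  then show ?thesis unfolding avg_def f_def by (rule borel_measurable_lebesgue_integral)
qed

section \<open>The heat semigroup and the equations solved by the two Duhamel terms\<close>

definition heat :: "real \<Rightarrow> (real^'n::finite \<Rightarrow> real) \<Rightarrow> real \<Rightarrow> real^'n \<Rightarrow> real" where
  "heat c h t x = (\<integral>z. h (x + (c * sqrt t) *\<^sub>R z) \<partial>gauss)"

lemma heat_cstrip:
  fixes h :: "real^'n::finite \<Rightarrow> real"
  assumes h: "continuous_on UNIV h" "\<And>x. \<bar>h x\<bar> \<le> B"
  shows "cstrip \<tau> (heat c h)"
  unfolding cstrip_def heat_def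
proof (rule continuous_on_integral_dominated[where W="\<lambda>_. B"])
  interpret prob_space "gauss :: (real^'n) measure" by (rule prob_space_gauss)
  show "integrable gauss (\<lambda>_ :: real^'n. B)" by simp
  have [measurable]: "h \<in> borel_measurable borel" by (rule borel_measurable_continuous_onI[OF h(1)])
  show "(\<lambda>z. h (snd a + (c * sqrt (fst a)) *\<^sub>R z)) \<in> borel_measurable gauss" for a :: "real \<times> (real^'n)"
    by measurable
  show "continuous_on ({0..\<tau>} \<times> UNIV) (\<lambda>a. h (snd a + (c * sqrt (fst a)) *\<^sub>R z))" for z
    by (rule continuous_on_compose2[OF h(1)]) (auto intro!: continuous_intros)
qed (use h in auto)

lemma heat_bound:
  fixes h :: "real^'n::finite \<Rightarrow> real"
  assumes h: "continuous_on UNIV h" "\<And>x. \<bar>h x\<bar> \<le> B"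
  shows "\<bar>heat c h t x\<bar> \<le> B"
proof -
  interpret prob_space "gauss :: (real^'n) measure" by (rule prob_space_gauss)
  have B0: "0 \<le> B" using h(2)[of 0] by linarith
  have "\<bar>heat c h t x\<bar> \<le> (\<integral>z. \<bar>h (x + (c * sqrt t) *\<^sub>R z)\<bar> \<partial>gauss)"
    unfolding heat_def by (rule integral_abs_bound)
  also have "\<dots> \<le> (\<integral>z. B \<partial>(gauss :: (real^'n) measure))"
    by (rule integral_mono') (use h B0 in auto)
  finally show ?thesis by (simp add: prob_space[simplified])
qed

lemma heat_pder:
  assumes "continuous_on UNIV h" "\<And>x. \<bar>h x\<bar> \<le> B" "continuous_on UNIV h'" "\<And>x. \<bar>h' x\<bar> \<le> B'"
    and "pder j h h'"
  shows "pder j (heat c h t) (heat c h' t)"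
  unfolding heat_def
  by (rule pder_gauss_average_C1[OF _ _ assms(2,4,5)])
    (use assms in \<open>auto intro!: borel_measurable_continuous_onI\<close>)

lemma heat_measurable_param:
  fixes h :: "'w \<Rightarrow> real^'n::finite \<Rightarrow> real"
  assumes h: "\<And>w. w \<in> space N \<Longrightarrow> continuous_on UNIV (h w)"
    and m: "\<And>y. (\<lambda>w. h w y) \<in> borel_measurable N"
  shows "(\<lambda>w. heat c (h w) t x) \<in> borel_measurable N"
proof -
  interpret prob_space "gauss :: (real^'n) measure" by (rule prob_space_gauss)
  have "(\<lambda>q. h (fst q) (x + (c * sqrt t) *\<^sub>R snd q)) \<in> borel_measurable (N \<Otimes>\<^sub>M gauss)"
  proof (rule measurable_caratheodory_compose[where f="\<lambda>z q. h (fst q) (x + (c * sqrt t) *\<^sub>R z)" and g=snd])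
    fix z :: "real^'n"
    note m[measurable]
    show "(\<lambda>q. h (fst q) (x + (c * sqrt t) *\<^sub>R z)) \<in> borel_measurable (N \<Otimes>\<^sub>M (gauss :: (real^'n) measure))" by measurable
  next
    fix q assume "q \<in> space (N \<Otimes>\<^sub>M (gauss :: (real^'n) measure))"
    then have "fst q \<in> space N" by (auto simp: space_pair_measure)
    then show "continuous_on UNIV (\<lambda>z. h (fst q) (x + (c * sqrt t) *\<^sub>R z))"
      by (intro continuous_on_compose2[OF h] continuous_intros) auto
  next
    have "snd \<in> N \<Otimes>\<^sub>M gauss \<rightarrow>\<^sub>M (gauss :: (real^'n) measure)" by simp
    then show "snd \<in> borel_measurable (N \<Otimes>\<^sub>M (gauss :: (real^'n) measure))"
      by (simp cong: measurable_cong_sets)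
  qed
  then have "(\<lambda>(w, z). h w (x + (c * sqrt t) *\<^sub>R z)) \<in> borel_measurable (N \<Otimes>\<^sub>M gauss)"
    by (simp add: case_prod_beta')
  then show ?thesis unfolding heat_def by (rule borel_measurable_lebesgue_integral)
qed

text \<open>Differentiating in the scale instead of in time keeps the formula valid at scale 0; time
  enters later through the square root of time.\<close>

lemma gauss_average_scale_derivative:
  fixes g :: "real^'n::finite \<Rightarrow> real"
  assumes g: "continuous_on UNIV g" "\<And>x. \<bar>g x\<bar> \<le> B"
    and dg: "\<And>j. continuous_on UNIV (dg j)" "\<And>j x. \<bar>dg j x\<bar> \<le> B'" "\<And>j. pder j g (dg j)"
  shows "((\<lambda>\<rho>. \<integral>z. g (x + (c * \<rho>) *\<^sub>R z) \<partial>gauss) has_real_derivative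
     c * (\<Sum>j\<in>UNIV. \<integral>z. z $ j * dg j (x + (c * \<rho>) *\<^sub>R z) \<partial>gauss)) (at \<rho>)"
proof -
  have [measurable]: "g \<in> borel_measurable borel" by (rule borel_measurable_continuous_onI[OF g(1)])
  have dgm[measurable]: "dg j \<in> borel_measurable borel" for j by (rule borel_measurable_continuous_onI[OF dg(1)])
  have "((\<lambda>s. \<integral>z. g (x + (c * (s + \<rho>)) *\<^sub>R z) \<partial>gauss) has_real_derivative
     (\<integral>z. (\<Sum>j\<in>UNIV. (c * z $ j) * dg j (x + (c * (0 + \<rho>)) *\<^sub>R z)) \<partial>gauss)) (at 0)"
  proof (rule has_real_derivative_integral_dominated[where d=1
        and G'="\<lambda>s z. \<Sum>j\<in>UNIV. (c * z $ j) * dg j (x + (c * (s + \<rho>)) *\<^sub>R z)" and W="\<lambda>z. \<Sum>j\<in>UNIV. \<bar>c\<bar> * \<bar>z $ j\<bar> * B'"])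
    show "integrable gauss (\<lambda>z. g (x + (c * (s + \<rho>)) *\<^sub>R z))" for s
      by (rule gauss_integrable_bounded[where B=B]) (use g in simp_all)
    show "((\<lambda>s. g (x + (c * (s + \<rho>)) *\<^sub>R z)) has_real_derivative (\<Sum>j\<in>UNIV. (c * z $ j) * dg j (x + (c * (s + \<rho>)) *\<^sub>R z))) (at s)" for s z
    proof -
      have "((\<lambda>s. g (x + (c * (s + \<rho>)) *\<^sub>R z)) has_derivative (\<lambda>r. \<Sum>j\<in>UNIV. ((c * r) *\<^sub>R z) $ j * dg j (x + (c * (s + \<rho>)) *\<^sub>R z))) (at s)"
        by (rule has_derivative_compose[where f="\<lambda>s. x + (c * (s + \<rho>)) *\<^sub>R z", OF _ pder_has_derivative[OF dg(3,1)]])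
          (auto intro!: derivative_eq_intros)
      then show ?thesis unfolding has_field_derivative_def
        by (rule has_derivative_eq_rhs) (simp add: fun_eq_iff sum_distrib_left mult_ac)
    qed
    show "integrable gauss (\<lambda>z::real^'n. \<Sum>j\<in>UNIV. \<bar>c\<bar> * \<bar>z $ j\<bar> * B')"
      using gauss_abs_integrable by (intro Bochner_Integration.integrable_sum integrable_mult_left integrable_mult_right)
    show "\<bar>\<Sum>j\<in>UNIV. (c * z $ j) * dg j (x + (c * (s + \<rho>)) *\<^sub>R z)\<bar> \<le> (\<Sum>j\<in>UNIV. \<bar>c\<bar> * \<bar>z $ j\<bar> * B')" for s z
      by (rule order_trans[OF sum_abs sum_mono]) (auto simp: abs_mult intro!: mult_left_mono dg(2))
  qed auto
  moreover have "(\<integral>z. (\<Sum>j\<in>UNIV. (c * z $ j) * dg j (x + (c * (0 + \<rho>)) *\<^sub>R z)) \<partial>gauss) = c * (\<Sum>j\<in>UNIV. \<integral>z. z $ j * dg j (x + (c * \<rho>) *\<^sub>R z) \<partial>gauss)"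
  proof -
    have i: "integrable gauss (\<lambda>z. z $ j * dg j (x + (c * \<rho>) *\<^sub>R z))" for j
    proof (rule gauss_integrable_mult_bounded[where B=B'])
      show "integrable gauss (\<lambda>z::real^'n. z $ j)"
        by (rule Bochner_Integration.integrable_bound[OF gauss_abs_integrable[of j]]) auto
    qed (use dg in simp_all)
    then show ?thesis by (simp add: mult.assoc sum_distrib_left[symmetric])
  qed
  ultimately show ?thesis
    using DERIV_shift[of "\<lambda>\<rho>. \<integral>z. g (x + (c * \<rho>) *\<^sub>R z) \<partial>gauss" _ 0 \<rho>] by simp
qed

lemma heat_zero: "heat c h 0 x = h x"
proof -
  interpret prob_space "gauss :: (real^'a) measure" by (rule prob_space_gauss)
  show ?thesis by (simp add: heat_def prob_space[simplified])
qed

text \<open>The scale derivative is the average of \<open>z $ j * dh j\<close>; integration by parts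
  turns it into second derivatives times \<open>c * sqrt s\<close>, and the derivative
  \<open>1 / (2 * sqrt s)\<close> of the square root leaves
  \<open>c\<^sup>2 / 2 = \<nu>\<close>.\<close>

lemma heat_solves_heat_equation:
  fixes h :: "real^'n::finite \<Rightarrow> real"
  assumes h: "continuous_on UNIV h" "\<And>x. \<bar>h x\<bar> \<le> B"
    and dh: "\<And>j. continuous_on UNIV (dh j)" "\<And>j x. \<bar>dh j x\<bar> \<le> B" "\<And>j. pder j h (dh j)"
    and ddh: "\<And>j. continuous_on UNIV (ddh j)" "\<And>j x. \<bar>ddh j x\<bar> \<le> B" "\<And>j. pder j (dh j) (ddh j)"
    and c: "0 < c" and nu: "c\<^sup>2 = 2 * \<nu>" and t: "0 \<le> t"
  shows "((\<lambda>s. \<nu> * (\<Sum>j\<in>UNIV. heat c (ddh j) s x)) has_integral (heat c h t x - h x)) {0..t}"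
proof -
  have "((\<lambda>s. \<nu> * (\<Sum>j\<in>UNIV. heat c (ddh j) s x)) has_integral (heat c h t x - heat c h 0 x)) {0..t}"
  \<comment> \<open>The square root is not differentiable at 0, so only continuity is used at the
    endpoint.\<close>
  proof (rule fundamental_theorem_of_calculus_interior[OF t])
    show "continuous_on {0..t} (\<lambda>s. heat c h s x)"
      by (rule cstrip_comp[OF heat_cstrip[OF h]]) (auto intro!: continuous_intros)
    fix s assume s: "s \<in> {0<..<t}"
    have ibp: "(\<integral>z. z $ j * dh j (x + (c * sqrt s) *\<^sub>R z) \<partial>gauss) = (c * sqrt s) * heat c (ddh j) s x" for j
      unfolding heat_def
      by (rule gauss_integration_by_parts[where B=B and B'=B])
        (use dh ddh c s in \<open>auto intro!: borel_measurable_continuous_onI\<close>)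
    have "((\<lambda>s. \<integral>z. h (x + (c * sqrt s) *\<^sub>R z) \<partial>gauss) has_real_derivative
       (c * (\<Sum>j\<in>UNIV. \<integral>z. z $ j * dh j (x + (c * sqrt s) *\<^sub>R z) \<partial>gauss)) * (inverse (sqrt s) / 2)) (at s)"
      by (rule DERIV_chain2[where f="\<lambda>\<rho>. \<integral>z. h (x + (c * \<rho>) *\<^sub>R z) \<partial>gauss" and g=sqrt])
        (use gauss_average_scale_derivative[OF h dh] s in \<open>auto intro!: DERIV_real_sqrt\<close>)
    also have "(c * (\<Sum>j\<in>UNIV. \<integral>z. z $ j * dh j (x + (c * sqrt s) *\<^sub>R z) \<partial>gauss)) * (inverse (sqrt s) / 2)
       = (c\<^sup>2 / 2) * (\<Sum>j\<in>UNIV. heat c (ddh j) s x)"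
      unfolding ibp sum_distrib_left[symmetric] using s by (simp add: power2_eq_square field_simps)
    also have "c\<^sup>2 / 2 = \<nu>" using nu by simp
    finally show "((\<lambda>s. heat c h s x) has_vector_derivative \<nu> * (\<Sum>j\<in>UNIV. heat c (ddh j) s x)) (at s)"
      by (simp add: heat_def[abs_def] has_real_derivative_iff_has_vector_derivative)
  qed
  then show ?thesis by (simp add: heat_zero)
qed

text \<open>The source is differentiable only once, so the Laplacian of the Duhamel term appears in
  smoothed form, with one derivative on \<open>g\<close> and one on the kernel. This is
  \<open>duhamel_identity\<close> for the Gaussian averages \<open>J\<close> of the source, the
  factor \<open>c\<close> in \<open>J'\<close> being converted by
  \<open>c\<^sup>2 = 2 * \<nu>\<close>.\<close>

lemma avg_solves_heat_equation:
  fixes g :: "real \<Rightarrow> real^'n::finite \<Rightarrow> real"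
  assumes g: "cstrip \<tau> g" "\<And>t x. t \<in> {0..\<tau>} \<Longrightarrow> \<bar>g t x\<bar> \<le> B"
    and dg: "\<And>j. cstrip \<tau> (dg j)" "\<And>j t x. t \<in> {0..\<tau>} \<Longrightarrow> \<bar>dg j t x\<bar> \<le> B'"
      "\<And>j t. t \<in> {0..\<tau>} \<Longrightarrow> pder j (g t) (dg j t)"
    and c: "0 < c" and nu: "c\<^sup>2 = 2 * \<nu>" and t: "t \<in> {0..\<tau>}"
  shows "((\<lambda>s. \<nu> * (\<Sum>j\<in>UNIV. (2 * sqrt s / c) * avg c (kz j) (dg j) s x) + g s x)
     has_integral (t * avg c k0 g t x)) {0..t}"
proof -
  define J where "J \<rho> r = (\<integral>z. g r (x + (c * \<rho>) *\<^sub>R z) \<partial>gauss)" for \<rho> r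
  define A where "A j \<rho> r = (\<integral>z. z $ j * dg j r (x + (c * \<rho>) *\<^sub>R z) \<partial>gauss)" for j \<rho> r
  define J' where "J' \<rho> r = c * (\<Sum>j\<in>UNIV. A j \<rho> r)" for \<rho> r
  interpret prob_space "gauss :: (real^'n) measure" by (rule prob_space_gauss)
  have sub: "r \<in> {0..\<tau>}" if "r \<in> {0..t}" for r using that t by auto
  have cJ: "continuous_on (UNIV \<times> {0..t}) (\<lambda>p. J (fst p) (snd p))"
    unfolding J_def
  proof (rule continuous_on_integral_dominated[where W="\<lambda>_. B"])
    fix p :: "real \<times> real" assume "p \<in> UNIV \<times> {0..t}"
    then have r: "snd p \<in> {0..\<tau>}" using sub by auto
    note cstrip_slice_measurable[OF g(1) r, measurable]
    show "(\<lambda>z. g (snd p) (x + (c * fst p) *\<^sub>R z)) \<in> borel_measurable gauss" by measurable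
    show "\<bar>g (snd p) (x + (c * fst p) *\<^sub>R z)\<bar> \<le> B" for z by (rule g(2)[OF r])
  next
    show "continuous_on (UNIV \<times> {0..t}) (\<lambda>p. g (snd p) (x + (c * fst p) *\<^sub>R z))" for z
      by (intro cstrip_comp[OF g(1)] continuous_intros) (use sub in auto)
  qed auto
  have cA: "continuous_on (UNIV \<times> {0..t}) (\<lambda>p. A j (fst p) (snd p))" for j
    unfolding A_def
  proof (rule continuous_on_integral_dominated[where W="\<lambda>z. \<bar>z $ j\<bar> * B'"])
    fix p :: "real \<times> real" assume "p \<in> UNIV \<times> {0..t}"
    then have r: "snd p \<in> {0..\<tau>}" using sub by auto
    note cstrip_slice_measurable[OF dg(1) r, measurable]
    show "(\<lambda>z. z $ j * dg j (snd p) (x + (c * fst p) *\<^sub>R z)) \<in> borel_measurable gauss" by measurable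
    show "\<bar>z $ j * dg j (snd p) (x + (c * fst p) *\<^sub>R z)\<bar> \<le> \<bar>z $ j\<bar> * B'" for z
      unfolding abs_mult by (intro mult_left_mono dg(2)[OF r]) auto
  next
    show "continuous_on (UNIV \<times> {0..t}) (\<lambda>p. z $ j * dg j (snd p) (x + (c * fst p) *\<^sub>R z))" for z
      by (intro continuous_on_mult continuous_on_const cstrip_comp[OF dg(1)] continuous_intros) (use sub in auto)
  qed (use gauss_abs_integrable in auto)
  have cJ': "continuous_on (UNIV \<times> {0..t}) (\<lambda>p. J' (fst p) (snd p))"
    unfolding J'_def by (intro continuous_intros cA)
  have der: "((\<lambda>\<rho>. J \<rho> r) has_real_derivative J' \<rho> r) (at \<rho>)" if "r \<in> {0..t}" for \<rho> r
    unfolding J_def J'_def A_def using sub[OF that]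
    by (intro gauss_average_scale_derivative[where B=B and B'=B'] cstrip_slice[OF g(1)] cstrip_slice[OF dg(1)] g(2) dg(2,3))
  have mx: "max 0 (1 - \<theta>\<^sup>2) = 1 - \<theta>\<^sup>2" if "\<theta> \<in> {0..1}" for \<theta> :: real using that by (auto simp: power_le_one)
  have mem: "s * (1 - \<theta>\<^sup>2) \<in> {0..t}" if "\<theta> \<in> {0..1}" "s \<in> {0..t}" for \<theta> s
    using tm_mem[OF that(2), of \<theta>] mx[OF that(1)] by simp
  have comp: "continuous_on {0..1} (\<lambda>\<theta>. H (sqrt s * \<theta>) (s * (1 - \<theta>\<^sup>2)))"
    if "continuous_on (UNIV \<times> {0..t}) (\<lambda>p. H (fst p) (snd p))" "s \<in> {0..t}" for H :: "real \<Rightarrow> real \<Rightarrow> real" and s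
    using continuous_on_compose2[OF that(1), of "{0..1}" "\<lambda>\<theta>. (sqrt s * \<theta>, s * (1 - \<theta>\<^sup>2))"] mem that(2)
    by (simp add: image_subset_iff continuous_intros)
  have e0: "avg c k0 g t x = integral {0..1} (\<lambda>\<theta>. 2 * \<theta> * J (sqrt t * \<theta>) (t * (1 - \<theta>\<^sup>2)))"
  proof -
    note av = avg_fubini[where B=B and c=c and x=x, OF g(1) _ k0_integrable t]
    show ?thesis
  proof (subst av(2)[OF g(2)], assumption, rule integral_U01_eq_integral)
    show "(\<lambda>\<theta>. \<integral>z. k0 (\<theta>, z) * g (t * max 0 (1 - \<theta>\<^sup>2)) (x + (c * sqrt t * \<theta>) *\<^sub>R z) \<partial>gauss) \<in> borel_measurable borel"
      using borel_measurable_integrable[OF av(1)[OF g(2)]] by simp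
    show "continuous_on {0..1} (\<lambda>\<theta>. 2 * \<theta> * J (sqrt t * \<theta>) (t * (1 - \<theta>\<^sup>2)))"
      using t by (intro continuous_intros comp[OF cJ]) auto
    show "(\<integral>z. k0 (\<theta>, z) * g (t * max 0 (1 - \<theta>\<^sup>2)) (x + (c * sqrt t * \<theta>) *\<^sub>R z) \<partial>gauss) = 2 * \<theta> * J (sqrt t * \<theta>) (t * (1 - \<theta>\<^sup>2))"
      if "\<theta> \<in> {0..1}" for \<theta>
      using that mx[OF that] by (simp add: k0_def J_def mult.assoc)
  qed
  qed
  have e1: "avg c (kz j) (dg j) s x = integral {0..1} (\<lambda>\<theta>. A j (sqrt s * \<theta>) (s * (1 - \<theta>\<^sup>2)))" if s: "s \<in> {0..t}" for s j
  proof -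
    note av = avg_fubini[where B=B' and c=c and x=x, OF dg(1) _ kz_integrable sub[OF s]]
    show ?thesis
  proof (subst av(2)[OF dg(2)], assumption, rule integral_U01_eq_integral)
    show "(\<lambda>\<theta>. \<integral>z. kz j (\<theta>, z) * dg j (s * max 0 (1 - \<theta>\<^sup>2)) (x + (c * sqrt s * \<theta>) *\<^sub>R z) \<partial>gauss) \<in> borel_measurable borel"
      using borel_measurable_integrable[OF av(1)[OF dg(2)]] by simp
    show "continuous_on {0..1} (\<lambda>\<theta>. A j (sqrt s * \<theta>) (s * (1 - \<theta>\<^sup>2)))" by (rule comp[OF cA s])
    show "(\<integral>z. kz j (\<theta>, z) * dg j (s * max 0 (1 - \<theta>\<^sup>2)) (x + (c * sqrt s * \<theta>) *\<^sub>R z) \<partial>gauss) = A j (sqrt s * \<theta>) (s * (1 - \<theta>\<^sup>2))"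
      if "\<theta> \<in> {0..1}" for \<theta>
      using mx[OF that] by (simp add: kz_def A_def mult.assoc)
  qed
  qed
  have e2: "integral {0..1} (\<lambda>\<theta>. J' (sqrt s * \<theta>) (s * (1 - \<theta>\<^sup>2))) = c * (\<Sum>j\<in>UNIV. avg c (kz j) (dg j) s x)" if s: "s \<in> {0..t}" for s
  proof -
    have "((\<lambda>\<theta>. c * (\<Sum>j\<in>UNIV. A j (sqrt s * \<theta>) (s * (1 - \<theta>\<^sup>2)))) has_integral (c * (\<Sum>j\<in>UNIV. avg c (kz j) (dg j) s x))) {0..1}"
      unfolding e1[OF s]
      by (intro has_integral_mult_right has_integral_sum integrable_integral integrable_continuous_real comp[OF cA s]) auto
    then show ?thesis unfolding J'_def by (rule integral_unique)
  qed
  have J0: "J 0 s = g s x" for s by (simp add: J_def prob_space[simplified])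
  have "((\<lambda>s. J 0 s + sqrt s * integral {0..1} (\<lambda>\<theta>. J' (sqrt s * \<theta>) (s * (1 - \<theta>\<^sup>2)))) has_integral (t * avg c k0 g t x)) {0..t}"
    unfolding e0 by (rule duhamel_identity[OF _ cJ cJ' der]) (use t in auto)
  then show ?thesis
  proof (rule has_integral_eq[rotated])
    fix s assume s: "s \<in> {0..t}"
    have nu': "\<nu> = c * c / 2" using nu by (simp add: power2_eq_square)
    show "J 0 s + sqrt s * integral {0..1} (\<lambda>\<theta>. J' (sqrt s * \<theta>) (s * (1 - \<theta>\<^sup>2))) = \<nu> * (\<Sum>j\<in>UNIV. (2 * sqrt s / c) * avg c (kz j) (dg j) s x) + g s x"
      unfolding e2[OF s] J0 sum_distrib_left[symmetric] nu' using c by simp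
  qed
qed

section \<open>The truncated equation\<close>

lemma half_square_pos_part_derivative:
  "((\<lambda>u::real. (max 0 u)\<^sup>2 / 2) has_real_derivative max 0 u) (at u)"
proof -
  consider "u > 0" | "u < 0" | "u = 0" by linarith
  then show ?thesis
  proof cases
    case 1
    have "((\<lambda>u::real. u\<^sup>2 / 2) has_real_derivative max 0 u) (at u)"
      using 1 by (auto intro!: derivative_eq_intros)
    then show ?thesis
      by (rule has_field_derivative_transform_within_open[where S="{0<..}"]) (use 1 in auto)
  next
    case 2
    have "((\<lambda>u::real. 0) has_real_derivative max 0 u) (at u)"
      using 2 by (auto intro!: derivative_eq_intros)
    then show ?thesis
      by (rule has_field_derivative_transform_within_open[where S="{..<0}"]) (use 2 in auto)
  next
    case 3
    have "((\<lambda>h::real. ((max 0 h)\<^sup>2 / 2) / h) \<longlongrightarrow> 0) (at 0)"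
    proof (rule Lim_null_comparison)
      show "\<forall>\<^sub>F h in at 0. norm (((max 0 h)\<^sup>2 / 2) / h) \<le> \<bar>h\<bar>"
      proof (rule always_eventually, rule allI)
        fix h :: real
        show "norm (((max 0 h)\<^sup>2 / 2) / h) \<le> \<bar>h\<bar>"
          by (cases "h > 0") (auto simp: power2_eq_square)
      qed
      show "((\<lambda>h::real. \<bar>h\<bar>) \<longlongrightarrow> 0) (at 0)" by (auto intro!: tendsto_eq_intros)
    qed
    then show ?thesis using 3 by (simp add: has_field_derivative_iff)
  qed
qed

text \<open>Clipping at level \<open>R\<close> would not do: the differentiated equation contains
  \<open>tr'\<close>, and the contraction estimate needs it to be Lipschitz.\<close>

lemma smooth_truncation_exists:
  assumes R: "0 \<le> (R::real)"
  obtains tr tr' :: "real \<Rightarrow> real" where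
    "\<And>r. (tr has_real_derivative tr' r) (at r)" "\<And>r. \<bar>tr' r\<bar> \<le> 1" "\<And>r s. \<bar>tr' r - tr' s\<bar> \<le> \<bar>r - s\<bar>"
    "\<And>r. \<bar>tr r\<bar> \<le> R + 1" "\<And>r. \<bar>r\<bar> \<le> R \<Longrightarrow> tr r = r"
proof -
  define q where "q u = (max 0 u)\<^sup>2 / 2" for u :: real
  \<comment> \<open>The derivative of \<open>q\<close> is the positive part, so four shifted copies
    add up to the trapezoid \<open>tr'\<close>, equal to 1 on \<open>[-R, R]\<close> and to 0
    outside \<open>[-R-1, R+1]\<close>. The constant normalises \<open>tr 0 = 0\<close>.\<close>
  define tr where "tr r = q (r + R + 1) - q (r + R) - q (r - R) + q (r - R - 1) - (R + 1/2)" for r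
  define tr' where "tr' r = max 0 (min 1 (R + 1 - \<bar>r\<bar>))" for r
  have dq: "(q has_real_derivative max 0 u) (at u)" for u
    unfolding q_def by (rule half_square_pos_part_derivative)
  have tr'_eq: "tr' r = max 0 (r + R + 1) - max 0 (r + R) - max 0 (r - R) + max 0 (r - R - 1)" for r
    using R unfolding tr'_def by (auto simp: max_def min_def abs_if)
  have d: "(tr has_real_derivative tr' r) (at r)" for r
    unfolding tr_def[abs_def] tr'_eq
    by (auto intro!: derivative_eq_intros DERIV_chain2[OF dq])
  have b: "\<bar>tr' r\<bar> \<le> 1" for r by (auto simp: tr'_def)
  have l: "\<bar>tr' r - tr' s\<bar> \<le> \<bar>r - s\<bar>" for r s by (auto simp: tr'_def max_def min_def abs_if)
  have lin: "tr r = r" if "\<bar>r\<bar> \<le> R" for r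
    using that R by (auto simp: tr_def q_def abs_le_iff max_def power2_eq_square algebra_simps)
  have lip: "\<bar>tr r - tr s\<bar> \<le> \<bar>r - s\<bar>" for r s
    using field_differentiable_bound[where S=UNIV and f=tr and f'=tr' and B=1, OF _ _ _ _, of s r] d b by auto
  have cl: "tr r = tr (max (- R - 1) (min (R + 1) r))" for r
  proof -
    have up: "tr r = R + 1/2" if "r \<ge> R + 1" for r
      using that R by (auto simp: tr_def q_def max_def power2_eq_square algebra_simps) (auto simp: field_simps)
    have dn: "tr r = - (R + 1/2)" if "r \<le> - R - 1" for r
      using that R by (auto simp: tr_def q_def max_def)
    show ?thesis using up dn[of r] dn[of "- R - 1"] R by (auto simp: max_def min_def)
  qed
  have "\<bar>tr r\<bar> \<le> R + 1" for r
  proof -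
    let ?r = "max (- R - 1) (min (R + 1) r)"
    have "\<bar>tr ?r - tr 0\<bar> \<le> \<bar>?r - 0\<bar>" by (rule lip)
    moreover have "tr 0 = 0" using lin[of 0] R by simp
    moreover have "\<bar>?r\<bar> \<le> R + 1" using R by auto
    ultimately show ?thesis unfolding cl[of r] by simp
  qed
  then show thesis using that d b l lin by blast
qed

lemma pder_add: "pder j g g' \<Longrightarrow> pder j h h' \<Longrightarrow> pder j (\<lambda>x. g x + h x) (\<lambda>x. g' x + h' x)"
  unfolding pder_def by (intro allI DERIV_add) (erule spec)+

lemma pder_cmult: "pder j g g' \<Longrightarrow> pder j (\<lambda>x. k * g x) (\<lambda>x. k * g' x)"
  unfolding pder_def by (intro allI DERIV_cmult) (erule spec)

text \<open>Needed to keep the derivative relations when passing to the Picard limit; uniform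
  convergence is required of the derivatives only.\<close>

lemma pder_uniform_limit:
  fixes g g' :: "nat \<Rightarrow> real^'n::finite \<Rightarrow> real"
  assumes d: "\<And>m. pder j (g m) (g' m)" and g: "\<And>x. (\<lambda>m. g m x) \<longlonglongrightarrow> G x"
    and g': "uniform_limit UNIV g' G' sequentially"
  shows "pder j G G'"
  unfolding pder_def
proof
  fix x
  let ?e = "axis j 1 :: real^'n"
  have "\<exists>H. \<forall>s\<in>UNIV. (\<lambda>m. g m (x + s *\<^sub>R ?e)) \<longlonglongrightarrow> H s \<and> (H has_derivative (\<lambda>r. G' (x + s *\<^sub>R ?e) * r)) (at s within UNIV)"
  proof (rule has_derivative_sequence[where f'="\<lambda>m s r. g' m (x + s *\<^sub>R ?e) * r" and ?x0.0=0 and l="G (x + 0 *\<^sub>R ?e)"])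
    show "((\<lambda>s. g m (x + s *\<^sub>R ?e)) has_derivative (\<lambda>r. g' m (x + s *\<^sub>R ?e) * r)) (at s within UNIV)" for m s
      using pder_line[OF d] by (simp add: has_field_derivative_def)
    fix e :: real assume "e > 0"
    from uniform_limitD[OF g' this] show "\<forall>\<^sub>F m in sequentially. \<forall>s\<in>UNIV. \<forall>r. norm (g' m (x + s *\<^sub>R ?e) * r - G' (x + s *\<^sub>R ?e) * r) \<le> e * norm r"
    proof eventually_elim
      case (elim m)
      show ?case
      proof (intro ballI allI)
        fix s r :: real
        have "\<bar>g' m (x + s *\<^sub>R ?e) - G' (x + s *\<^sub>R ?e)\<bar> * \<bar>r\<bar> \<le> e * \<bar>r\<bar>"
          using elim by (intro mult_right_mono) (auto simp: dist_real_def less_imp_le)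
        then show "norm (g' m (x + s *\<^sub>R ?e) * r - G' (x + s *\<^sub>R ?e) * r) \<le> e * norm r"
          by (simp add: left_diff_distrib[symmetric] abs_mult)
      qed
    qed
  qed (use g[of "x + 0 *\<^sub>R ?e"] in auto)
  then obtain H where H: "\<And>s. (\<lambda>m. g m (x + s *\<^sub>R ?e)) \<longlonglongrightarrow> H s"
    "\<And>s. (H has_derivative (\<lambda>r. G' (x + s *\<^sub>R ?e) * r)) (at s)" by auto
  have "H = (\<lambda>s. G (x + s *\<^sub>R ?e))" using H(1) g LIMSEQ_unique by blast
  then show "((\<lambda>s. G (x + s *\<^sub>R ?e)) has_real_derivative G' x) (at 0)"
    using H(2)[of 0] by (simp add: has_field_derivative_def)
qed

lemma abs_sum_le_card:
  fixes F :: "'n::finite \<Rightarrow> real"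
  assumes "\<And>j. \<bar>F j\<bar> \<le> C"
  shows "\<bar>\<Sum>j\<in>UNIV. F j\<bar> \<le> real CARD('n) * C"
  using sum_norm_bound[of UNIV F C] assms by auto

lemma abs_mult_diff_le:
  fixes x y x' y' :: real
  assumes "\<bar>x - x'\<bar> \<le> d1" "\<bar>y\<bar> \<le> Y" "\<bar>x'\<bar> \<le> X" "\<bar>y - y'\<bar> \<le> d2"
  shows "\<bar>x * y - x' * y'\<bar> \<le> d1 * Y + X * d2"
proof -
  have "x * y - x' * y' = (x - x') * y + x' * (y - y')" by (simp add: algebra_simps)
  then have "\<bar>x * y - x' * y'\<bar> \<le> \<bar>x - x'\<bar> * \<bar>y\<bar> + \<bar>x'\<bar> * \<bar>y - y'\<bar>"
    using abs_triangle_ineq[of "(x - x') * y" "x' * (y - y')"] by (simp only: abs_mult)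
  also have "\<dots> \<le> d1 * Y + X * d2" using assms by (intro add_mono mult_mono) auto
  finally show ?thesis .
qed

lemma has_derivative_vec_lambda:
  fixes g :: "'n::finite \<Rightarrow> 'v::real_normed_vector \<Rightarrow> real"
  assumes "\<And>l. (g l has_derivative g' l) (at x within S)"
  shows "((\<lambda>s. \<chi> l. g l s) has_derivative (\<lambda>r. \<chi> l. g' l r)) (at x within S)"
  by (rule has_derivative_componentwise_within[THEN iffD2])
    (use assms in \<open>auto simp: Basis_vec_def inner_axis\<close>)

text \<open>Indices of the state: a component of the solution, of its gradient and of its Hessian;
  \<open>I2 k i j\<close> stands for the derivative in direction \<open>j\<close> of \<open>I1 k i\<close>.\<close>

datatype 'n ix = I0 'n | I1 'n 'n | I2 'n 'n 'n

text \<open>Free of assumptions, so that the equations of \<open>Phi\<close> hold for the data at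
  every \<omega>. The measurability argument unfolds them under an abstraction over \<omega>, where
  no regularity is available outside the full measure set.\<close>

locale burgers_operator =
  fixes c :: real and tr tr' :: "real \<Rightarrow> real"
    and a :: "'n::finite \<Rightarrow> real \<Rightarrow> real^'n \<Rightarrow> real" and da :: "'n \<Rightarrow> 'n \<Rightarrow> real \<Rightarrow> real^'n \<Rightarrow> real"
    and f :: "'n \<Rightarrow> real \<Rightarrow> (real^'n) \<times> (real^'n) \<Rightarrow> real"
    and fx fy :: "'n \<Rightarrow> 'n \<Rightarrow> real \<Rightarrow> (real^'n) \<times> (real^'n) \<Rightarrow> real"
    and h :: "'n \<Rightarrow> real^'n \<Rightarrow> real" and dh :: "'n \<Rightarrow> 'n \<Rightarrow> real^'n \<Rightarrow> real"
    and ddh :: "'n \<Rightarrow> 'n \<Rightarrow> 'n \<Rightarrow> real^'n \<Rightarrow> real"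
begin

definition uvec :: "('n ix \<times> real \<times> (real^'n) \<Rightarrow> real) \<Rightarrow> real \<Rightarrow> real^'n \<Rightarrow> real^'n" where
  "uvec U t x = (\<chi> l. U (I0 l, t, x))"

definition N0 :: "('n ix \<times> real \<times> (real^'n) \<Rightarrow> real) \<Rightarrow> 'n \<Rightarrow> real \<Rightarrow> real^'n \<Rightarrow> real" where
  "N0 U k t x = f k t (x, uvec U t x) - (\<Sum>j\<in>UNIV. (a j t x + U (I0 j, t, x)) * tr (U (I1 k j, t, x)))"

text \<open>The derivative of \<open>N0 U k\<close> in direction \<open>i\<close> as it comes out of
  the chain rule, provided the components of \<open>U\<close> really are derivatives of one another;
  see \<open>N0_pder\<close>.\<close>

definition N1 :: "('n ix \<times> real \<times> (real^'n) \<Rightarrow> real) \<Rightarrow> 'n \<Rightarrow> 'n \<Rightarrow> real \<Rightarrow> real^'n \<Rightarrow> real" where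
  "N1 U k i t x = fx k i t (x, uvec U t x) + (\<Sum>l\<in>UNIV. fy k l t (x, uvec U t x) * U (I1 l i, t, x))
     - (\<Sum>j\<in>UNIV. (da j i t x + U (I1 j i, t, x)) * tr (U (I1 k j, t, x))
          + (a j t x + U (I0 j, t, x)) * (tr' (U (I1 k j, t, x)) * U (I2 k j i, t, x)))"

text \<open>In the first two clauses the derivative goes to the data, in the third it goes to the
  kernel: \<open>N1\<close> already involves the Hessian components and could not be differentiated
  again.\<close>

fun Phi :: "('n ix \<times> real \<times> (real^'n) \<Rightarrow> real) \<Rightarrow> 'n ix \<times> real \<times> (real^'n) \<Rightarrow> real" where
  "Phi U (I0 k, t, x) = heat c (h k) t x + t * avg c k0 (N0 U k) t x"
| "Phi U (I1 k i, t, x) = heat c (dh k i) t x + t * avg c k0 (N1 U k i) t x"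
| "Phi U (I2 k i j, t, x) = heat c (ddh k i j) t x + (2 * sqrt t / c) * avg c (kz j) (N1 U k i) t x"

end

text \<open>One constant \<open>B\<close> bounds all data and their derivatives. It serves the fixed
  point argument and may be arbitrarily large; the length of the time interval will be governed by a
  different constant. The coefficients \<open>f\<close>, \<open>fx\<close>, \<open>fy\<close> have
  to be Lipschitz in the second variable only, since this is where the unknown is inserted.\<close>

locale burgers = burgers_operator c tr tr' a da f fx fy h dh ddh
  for c :: real and tr tr' :: "real \<Rightarrow> real"
    and a :: "'n::finite \<Rightarrow> real \<Rightarrow> real^'n \<Rightarrow> real" and da :: "'n \<Rightarrow> 'n \<Rightarrow> real \<Rightarrow> real^'n \<Rightarrow> real"
    and f :: "'n \<Rightarrow> real \<Rightarrow> (real^'n) \<times> (real^'n) \<Rightarrow> real"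
    and fx fy :: "'n \<Rightarrow> 'n \<Rightarrow> real \<Rightarrow> (real^'n) \<times> (real^'n) \<Rightarrow> real"
    and h :: "'n \<Rightarrow> real^'n \<Rightarrow> real" and dh :: "'n \<Rightarrow> 'n \<Rightarrow> real^'n \<Rightarrow> real"
    and ddh :: "'n \<Rightarrow> 'n \<Rightarrow> 'n \<Rightarrow> real^'n \<Rightarrow> real" +
  fixes \<tau> \<nu> B R :: real
  assumes tau: "0 < \<tau>" and c: "0 < c" and nu: "c\<^sup>2 = 2 * \<nu>" and R: "0 \<le> R"
    and tr_deriv: "\<And>r. (tr has_real_derivative tr' r) (at r)" and tr'_le: "\<And>r. \<bar>tr' r\<bar> \<le> 1"
    and tr'_lip: "\<And>r s. \<bar>tr' r - tr' s\<bar> \<le> \<bar>r - s\<bar>"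
    and tr_le: "\<And>r. \<bar>tr r\<bar> \<le> R + 1" and tr_id: "\<And>r. \<bar>r\<bar> \<le> R \<Longrightarrow> tr r = r"
    and a_c: "\<And>j. cstrip \<tau> (a j)" and a_le: "\<And>j t x. t \<in> {0..\<tau>} \<Longrightarrow> \<bar>a j t x\<bar> \<le> B"
    and da_c: "\<And>j i. cstrip \<tau> (da j i)" and da_le: "\<And>j i t x. t \<in> {0..\<tau>} \<Longrightarrow> \<bar>da j i t x\<bar> \<le> B"
    and a_pder: "\<And>j i t. t \<in> {0..\<tau>} \<Longrightarrow> pder i (a j t) (da j i t)"
    and f_c: "\<And>k. cstrip \<tau> (f k)" and f_le: "\<And>k t p. t \<in> {0..\<tau>} \<Longrightarrow> \<bar>f k t p\<bar> \<le> B"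
    and fx_c: "\<And>k i. cstrip \<tau> (fx k i)" and fx_le: "\<And>k i t p. t \<in> {0..\<tau>} \<Longrightarrow> \<bar>fx k i t p\<bar> \<le> B"
    and fy_c: "\<And>k i. cstrip \<tau> (fy k i)" and fy_le: "\<And>k i t p. t \<in> {0..\<tau>} \<Longrightarrow> \<bar>fy k i t p\<bar> \<le> B"
    and f_deriv: "\<And>k t p. t \<in> {0..\<tau>} \<Longrightarrow> (f k t has_derivative
        (\<lambda>v. (\<Sum>i\<in>UNIV. fst v $ i * fx k i t p) + (\<Sum>l\<in>UNIV. snd v $ l * fy k l t p))) (at p)"
    and fx_lip: "\<And>k i t x y y'. t \<in> {0..\<tau>} \<Longrightarrow> \<bar>fx k i t (x, y) - fx k i t (x, y')\<bar> \<le> B * (\<Sum>l\<in>UNIV. \<bar>y $ l - y' $ l\<bar>)"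
    and fy_lip: "\<And>k i t x y y'. t \<in> {0..\<tau>} \<Longrightarrow> \<bar>fy k i t (x, y) - fy k i t (x, y')\<bar> \<le> B * (\<Sum>l\<in>UNIV. \<bar>y $ l - y' $ l\<bar>)"
    and f_lip: "\<And>k t x y y'. t \<in> {0..\<tau>} \<Longrightarrow> \<bar>f k t (x, y) - f k t (x, y')\<bar> \<le> B * (\<Sum>l\<in>UNIV. \<bar>y $ l - y' $ l\<bar>)"
    and h_c: "\<And>k. continuous_on UNIV (h k)" and h_le: "\<And>k x. \<bar>h k x\<bar> \<le> B"
    and dh_c: "\<And>k i. continuous_on UNIV (dh k i)" and dh_le: "\<And>k i x. \<bar>dh k i x\<bar> \<le> B"
    and ddh_c: "\<And>k i j. continuous_on UNIV (ddh k i j)" and ddh_le: "\<And>k i j x. \<bar>ddh k i j x\<bar> \<le> B"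
    and h_pder: "\<And>k i. pder i (h k) (dh k i)" and dh_pder: "\<And>k i j. pder j (dh k i) (ddh k i j)"
begin

lemma B_nonneg: "0 \<le> B" using h_le[of undefined 0] by linarith

lemma tr_lip: "\<bar>tr r - tr s\<bar> \<le> \<bar>r - s\<bar>"
  using field_differentiable_bound[where S=UNIV and f=tr and f'=tr' and B=1, OF _ _ _ _, of s r] tr_deriv tr'_le by auto

lemma tr_cont: "continuous_on UNIV tr"
  using tr_deriv DERIV_isCont continuous_at_imp_continuous_on by blast

lemma tr'_cont: "continuous_on UNIV tr'"
  unfolding continuous_on_iff by (metis UNIV_I dist_real_def order_le_less_trans tr'_lip)

text \<open>The invariant set of the Duhamel map. Derivatives are separate components tied together
  by \<open>pder\<close>, which makes the set closed under uniform limits. There are two growth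
  rates because the bound on the derivatives depends on the one already established for the
  solution.\<close>

definition Adm :: "real \<Rightarrow> real \<Rightarrow> real \<Rightarrow> real \<Rightarrow> ('n ix \<times> real \<times> (real^'n) \<Rightarrow> real) set" where
  "Adm M0 l0 M1 l1 = {U. (\<forall>q. cstrip \<tau> (\<lambda>t x. U (q, t, x))) \<and>
     (\<forall>t\<in>{0..\<tau>}. \<forall>x k. \<bar>U (I0 k, t, x)\<bar> \<le> M0 * exp (l0 * t)) \<and>
     (\<forall>t\<in>{0..\<tau>}. \<forall>x k i. \<bar>U (I1 k i, t, x)\<bar> \<le> M1 * exp (l1 * t)) \<and>
     (\<forall>t\<in>{0..\<tau>}. \<forall>x k i j. \<bar>U (I2 k i j, t, x)\<bar> \<le> M1 * exp (l1 * t)) \<and>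
     (\<forall>t\<in>{0..\<tau>}. \<forall>k i. pder i (\<lambda>x. U (I0 k, t, x)) (\<lambda>x. U (I1 k i, t, x))) \<and>
     (\<forall>t\<in>{0..\<tau>}. \<forall>k i j. pder j (\<lambda>x. U (I1 k i, t, x)) (\<lambda>x. U (I2 k i j, t, x)))}"

lemma AdmD:
  assumes "U \<in> Adm M0 l0 M1 l1"
  shows "cstrip \<tau> (\<lambda>t x. U (q, t, x))"
    and "t \<in> {0..\<tau>} \<Longrightarrow> \<bar>U (I0 k, t, x)\<bar> \<le> M0 * exp (l0 * t)"
    and "t \<in> {0..\<tau>} \<Longrightarrow> \<bar>U (I1 k i, t, x)\<bar> \<le> M1 * exp (l1 * t)"
    and "t \<in> {0..\<tau>} \<Longrightarrow> \<bar>U (I2 k i j, t, x)\<bar> \<le> M1 * exp (l1 * t)"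
    and "t \<in> {0..\<tau>} \<Longrightarrow> pder i (\<lambda>x. U (I0 k, t, x)) (\<lambda>x. U (I1 k i, t, x))"
    and "t \<in> {0..\<tau>} \<Longrightarrow> pder j (\<lambda>x. U (I1 k i, t, x)) (\<lambda>x. U (I2 k i j, t, x))"
  using assms unfolding Adm_def by blast+

section \<open>Regularity and growth of the nonlinearity along admissible states\<close>

context
  fixes U :: "'n ix \<times> real \<times> (real^'n) \<Rightarrow> real"
  assumes U_c: "\<And>q. cstrip \<tau> (\<lambda>t x. U (q, t, x))"
begin

lemma uvec_c: "continuous_on ({0..\<tau>} \<times> UNIV) (\<lambda>p. uvec U (fst p) (snd p))"
  unfolding uvec_def using U_c by (intro continuous_on_vec_lambda) (auto simp: cstrip_def)

lemma comp_uvec_cstrip: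
  assumes "cstrip \<tau> g"
  shows "cstrip \<tau> (\<lambda>t x. g t (x, uvec U t x))"
  unfolding cstrip_def by (rule cstrip_comp[OF assms]) (auto intro!: continuous_intros uvec_c)

lemma N0_cstrip: "cstrip \<tau> (N0 U k)"
  unfolding N0_def cstrip_def
  by (intro continuous_intros comp_uvec_cstrip[OF f_c, unfolded cstrip_def] a_c[unfolded cstrip_def] U_c[unfolded cstrip_def]
      continuous_on_compose2[OF tr_cont] subset_UNIV)

lemma N1_cstrip: "cstrip \<tau> (N1 U k i)"
  unfolding N1_def cstrip_def
  by (intro continuous_intros comp_uvec_cstrip[OF fx_c, unfolded cstrip_def] comp_uvec_cstrip[OF fy_c, unfolded cstrip_def]
      a_c[unfolded cstrip_def] da_c[unfolded cstrip_def] U_c[unfolded cstrip_def]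
      continuous_on_compose2[OF tr_cont] continuous_on_compose2[OF tr'_cont] subset_UNIV)

end

lemma N0_pder:
  assumes U: "U \<in> Adm M0 l0 M1 l1" and t: "t \<in> {0..\<tau>}"
  shows "pder i (N0 U k t) (N1 U k i t)"
  unfolding pder_def
proof
  fix x
  let ?e = "axis i 1 :: real^'n"
  have u: "((\<lambda>s. U (I0 l, t, x + s *\<^sub>R ?e)) has_real_derivative U (I1 l i, t, x)) (at 0)" for l
    using AdmD(5)[OF U t] by (simp add: pder_def)
  have p: "((\<lambda>s. U (I1 l m, t, x + s *\<^sub>R ?e)) has_real_derivative U (I2 l m i, t, x)) (at 0)" for l m
    using AdmD(6)[OF U t] by (simp add: pder_def)
  have a: "((\<lambda>s. a l t (x + s *\<^sub>R ?e)) has_real_derivative da l i t x) (at 0)" for l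
    using a_pder[OF t] by (simp add: pder_def)
  have trp: "((\<lambda>s. tr (U (I1 l m, t, x + s *\<^sub>R ?e))) has_real_derivative tr' (U (I1 l m, t, x)) * U (I2 l m i, t, x)) (at 0)" for l m
    using DERIV_chain2[OF _ p[of l m], of tr "tr' (U (I1 l m, t, x))"] tr_deriv by simp
  have uv: "((\<lambda>s. uvec U t (x + s *\<^sub>R ?e)) has_derivative (\<lambda>r. \<chi> l. U (I1 l i, t, x) * r)) (at 0)"
    unfolding uvec_def using u by (intro has_derivative_vec_lambda) (auto simp: has_field_derivative_def)
  have cv: "((\<lambda>s. (x + s *\<^sub>R ?e, uvec U t (x + s *\<^sub>R ?e))) has_derivative (\<lambda>r. (r *\<^sub>R ?e, \<chi> l. U (I1 l i, t, x) * r))) (at 0)"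
    by (intro has_derivative_Pair uv) (auto intro!: derivative_eq_intros)
  have "((\<lambda>s. f k t (x + s *\<^sub>R ?e, uvec U t (x + s *\<^sub>R ?e))) has_derivative
     (\<lambda>r. (\<Sum>m\<in>UNIV. (r *\<^sub>R ?e) $ m * fx k m t (x, uvec U t x)) + (\<Sum>l\<in>UNIV. (U (I1 l i, t, x) * r) * fy k l t (x, uvec U t x)))) (at 0)"
    using has_derivative_compose[OF cv, of "f k t" "\<lambda>v. (\<Sum>m\<in>UNIV. fst v $ m * fx k m t (x, uvec U t x)) + (\<Sum>l\<in>UNIV. snd v $ l * fy k l t (x, uvec U t x))"]
      f_deriv[OF t, of k "(x, uvec U t x)"] by simp
  moreover have "(\<Sum>m\<in>UNIV. (r *\<^sub>R ?e) $ m * fx k m t (x, uvec U t x)) = r * fx k i t (x, uvec U t x)" for r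
  proof -
    have "(\<Sum>m\<in>UNIV. (r *\<^sub>R ?e) $ m * fx k m t (x, uvec U t x)) = (\<Sum>m\<in>UNIV. if m = i then r * fx k i t (x, uvec U t x) else 0)"
      by (intro sum.cong) (auto simp: axis_def)
    then show ?thesis by simp
  qed
  ultimately have F: "((\<lambda>s. f k t (x + s *\<^sub>R ?e, uvec U t (x + s *\<^sub>R ?e))) has_real_derivative
     fx k i t (x, uvec U t x) + (\<Sum>l\<in>UNIV. fy k l t (x, uvec U t x) * U (I1 l i, t, x))) (at 0)"
    unfolding has_field_derivative_def
    by (elim has_derivative_eq_rhs) (simp add: fun_eq_iff algebra_simps sum_distrib_left)
  have "((\<lambda>s. (\<Sum>j\<in>UNIV. (a j t (x + s *\<^sub>R ?e) + U (I0 j, t, x + s *\<^sub>R ?e)) * tr (U (I1 k j, t, x + s *\<^sub>R ?e)))) has_real_derivative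
     (\<Sum>j\<in>UNIV. (da j i t x + U (I1 j i, t, x)) * tr (U (I1 k j, t, x))
          + (a j t x + U (I0 j, t, x)) * (tr' (U (I1 k j, t, x)) * U (I2 k j i, t, x)))) (at 0)"
    by (rule DERIV_sum) (auto intro!: derivative_eq_intros a u trp simp: algebra_simps)
  from DERIV_diff[OF F this] show "((\<lambda>s. N0 U k t (x + s *\<^sub>R ?e)) has_real_derivative N1 U k i t x) (at 0)"
    by (simp add: N0_def N1_def)
qed

text \<open>A common constant for both kernels. For \<open>k0\<close> it collects the sup 2 of the
  kernel, the 2 of \<open>U01_exp_bound\<close> and a spare \<open>sqrt \<tau>\<close>; for
  \<open>kz\<close> it collects \<open>2 / c\<close>, again 2, and the first absolute
  moments.\<close>

definition Cw :: real where
  "Cw = 4 * sqrt \<tau> + (4 / c) * (\<Sum>j\<in>UNIV. \<integral>z. \<bar>(z::real^'n) $ j\<bar> \<partial>gauss)"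

lemma Cw_nonneg: "0 \<le> Cw"
  unfolding Cw_def using tau c by (intro add_nonneg_nonneg mult_nonneg_nonneg sum_nonneg integral_nonneg_AE) auto

lemma weighted_bound_k0:
  fixes g :: "real \<Rightarrow> real^'n \<Rightarrow> real"
  assumes t: "t \<in> {0..\<tau>}" and mu: "0 < \<mu>" and g: "\<And>s y. s \<in> {0..\<tau>} \<Longrightarrow> \<bar>g s y\<bar> \<le> D * exp (\<mu> * s)"
  shows "\<bar>t * avg c k0 g t x\<bar> \<le> D * (Cw / sqrt \<mu>) * exp (\<mu> * t)"
proof -
  interpret prob_space "gauss :: (real^'n) measure" by (rule prob_space_gauss)
  have "0 \<le> D * exp (\<mu> * t)" using g[OF t, of 0] by linarith
  then have D0: "0 \<le> D" by (simp add: zero_le_mult_iff)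
  have b: "sqrt t * \<bar>avg c k0 g t x\<bar> \<le> (D * (2 / sqrt \<mu>) * (\<integral>z. 2 \<partial>(gauss :: (real^'n) measure))) * exp (\<mu> * t)"
    by (rule avg_weighted_bound[OF t mu g]) (auto simp: k0_def)
  have "\<bar>t * avg c k0 g t x\<bar> = sqrt t * (sqrt t * \<bar>avg c k0 g t x\<bar>)"
    using t by (simp add: abs_mult mult.assoc[symmetric])
  also have "\<dots> \<le> sqrt \<tau> * ((D * (2 / sqrt \<mu>) * 2) * exp (\<mu> * t))"
  proof (rule mult_mono)
    show "sqrt t * \<bar>avg c k0 g t x\<bar> \<le> (D * (2 / sqrt \<mu>) * 2) * exp (\<mu> * t)"
      using b by (simp add: prob_space[simplified])
  qed (use t tau in auto)
  also have "\<dots> = D * ((4 * sqrt \<tau>) / sqrt \<mu>) * exp (\<mu> * t)" by simp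
  also have "\<dots> \<le> D * (Cw / sqrt \<mu>) * exp (\<mu> * t)"
    using D0 mu c unfolding Cw_def
    by (intro mult_right_mono mult_left_mono divide_right_mono) (auto intro!: divide_nonneg_nonneg mult_nonneg_nonneg sum_nonneg integral_nonneg_AE)
  finally show ?thesis .
qed

lemma weighted_bound_kz:
  fixes g :: "real \<Rightarrow> real^'n \<Rightarrow> real"
  assumes t: "t \<in> {0..\<tau>}" and mu: "0 < \<mu>" and g: "\<And>s y. s \<in> {0..\<tau>} \<Longrightarrow> \<bar>g s y\<bar> \<le> D * exp (\<mu> * s)"
  shows "\<bar>(2 * sqrt t / c) * avg c (kz j) g t x\<bar> \<le> D * (Cw / sqrt \<mu>) * exp (\<mu> * t)"
proof -
  have "0 \<le> D * exp (\<mu> * t)" using g[OF t, of 0] by linarith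
  then have D0: "0 \<le> D" by (simp add: zero_le_mult_iff)
  let ?m = "\<integral>z. \<bar>(z::real^'n) $ j\<bar> \<partial>gauss"
  have b: "sqrt t * \<bar>avg c (kz j) g t x\<bar> \<le> (D * (2 / sqrt \<mu>) * ?m) * exp (\<mu> * t)"
    by (rule avg_weighted_bound[OF t mu g]) (auto simp: kz_def gauss_abs_integrable)
  have "\<bar>(2 * sqrt t / c) * avg c (kz j) g t x\<bar> = (2 / c) * (sqrt t * \<bar>avg c (kz j) g t x\<bar>)"
    using t c by (simp add: abs_mult)
  also have "\<dots> \<le> (2 / c) * ((D * (2 / sqrt \<mu>) * ?m) * exp (\<mu> * t))"
    using c b by (intro mult_left_mono) auto
  also have "\<dots> = D * (((4 / c) * ?m) / sqrt \<mu>) * exp (\<mu> * t)" by simp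
  also have "\<dots> \<le> D * (Cw / sqrt \<mu>) * exp (\<mu> * t)"
  proof (intro mult_right_mono mult_left_mono divide_right_mono)
    have "?m \<le> (\<Sum>j\<in>UNIV. \<integral>z. \<bar>(z::real^'n) $ j\<bar> \<partial>gauss)"
      by (rule member_le_sum) auto
    then have "(4 / c) * ?m \<le> (4 / c) * (\<Sum>j\<in>UNIV. \<integral>z. \<bar>(z::real^'n) $ j\<bar> \<partial>gauss)"
      using c by (intro mult_left_mono) auto
    then show "(4 / c) * ?m \<le> Cw" unfolding Cw_def using tau by (simp add: add_increasing)
  qed (use D0 mu in auto)
  finally show ?thesis .
qed

text \<open>Whatever the constant \<open>A\<close> of the nonlinearity, a large exponent beats it.
  The interval length \<tau> is thereby left free.\<close>

lemma exists_weight: "\<exists>l>0. A * (Cw / sqrt l) \<le> 1/2"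
proof (intro exI conjI)
  let ?d = "2 * \<bar>A\<bar> * Cw + 1"
  have d: "?d > 0" using Cw_nonneg by (simp add: add_nonneg_pos)
  show "?d\<^sup>2 > 0" using d by simp
  have "A * Cw \<le> \<bar>A\<bar> * Cw" using Cw_nonneg by (intro mult_right_mono) auto
  then have "A * Cw \<le> (1/2) * ?d" by simp
  then show "A * (Cw / sqrt (?d\<^sup>2)) \<le> 1/2" using d by (simp add: pos_divide_le_eq)
qed

text \<open>Truncating the gradient makes the transport term affine in the solution, so the
  exponential growth rate \<open>l0\<close> is reproduced.\<close>

lemma N0_le:
  assumes U: "U \<in> Adm M0 l0 M1 l1" and t: "t \<in> {0..\<tau>}" and M0: "0 \<le> M0" and l0: "0 \<le> l0"
  shows "\<bar>N0 U k t x\<bar> \<le> ((real CARD('n) * (R + 1) + 1) * (B + 1) * (1 + M0)) * exp (l0 * t)"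
proof -
  define e where "e = exp (l0 * t)"
  have e: "1 \<le> e" using l0 t by (simp add: e_def)
  have key: "B + M0 * e \<le> (B + 1) * (1 + M0) * e"
  proof -
    have "B * 1 \<le> B * e" "0 \<le> B * M0 * e" using e B_nonneg M0 by (intro mult_left_mono mult_nonneg_nonneg; simp)+
    moreover have "(B + 1) * (1 + M0) * e = B * e + M0 * e + e + B * M0 * e" by (simp add: algebra_simps)
    ultimately show ?thesis using e by linarith
  qed
  have keyB: "B \<le> (B + 1) * (1 + M0) * e" using key mult_nonneg_nonneg[OF M0, of e] e by linarith
  have "\<bar>(a j t x + U (I0 j, t, x)) * tr (U (I1 k j, t, x))\<bar> \<le> (B + M0 * e) * (R + 1)" for j
    unfolding abs_mult using a_le[OF t, of j x] AdmD(2)[OF U t, of j x, folded e_def] tr_le B_nonneg M0 R e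
    by (intro mult_mono) auto
  then have "\<bar>\<Sum>j\<in>UNIV. (a j t x + U (I0 j, t, x)) * tr (U (I1 k j, t, x))\<bar> \<le> real CARD('n) * ((B + M0 * e) * (R + 1))"
    by (rule abs_sum_le_card)
  then have "\<bar>N0 U k t x\<bar> \<le> B + real CARD('n) * ((B + M0 * e) * (R + 1))"
    using f_le[OF t, of k "(x, uvec U t x)"] unfolding N0_def by linarith
  also have "\<dots> \<le> (B + 1) * (1 + M0) * e + real CARD('n) * (((B + 1) * (1 + M0) * e) * (R + 1))"
    using key keyB R by (intro add_mono mult_left_mono mult_right_mono) auto
  finally show ?thesis by (simp add: algebra_simps e_def)
qed

text \<open>Products of two unknown derivatives occur only with one factor inside the bounded
  functions \<open>tr\<close> or \<open>tr'\<close>. Once the solution is bounded by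
  \<open>M0 * exp (l0 * \<tau>)\<close>, what remains is affine in the derivatives.\<close>

lemma N1_le:
  assumes U: "U \<in> Adm M0 l0 M1 l1" and t: "t \<in> {0..\<tau>}" and M0: "0 \<le> M0" and M1: "0 \<le> M1"
    and l0: "0 \<le> l0" and l1: "0 \<le> l1"
  shows "\<bar>N1 U k i t x\<bar> \<le> ((B + real CARD('n) * B + real CARD('n) * ((B + 1) * (R + 1) + (B + M0 * exp (l0 * \<tau>)))) * (1 + M1)) * exp (l1 * t)"
proof -
  let ?X = "M1 * exp (l1 * t)" and ?M = "M0 * exp (l0 * \<tau>)" and ?Y = "(1 + M1) * exp (l1 * t)"
  have e: "1 \<le> exp (l1 * t)" using l1 t by simp
  have X0: "0 \<le> ?X" using M1 by simp
  have XY: "?X \<le> ?Y" and Y1: "1 \<le> ?Y" using e X0 unfolding distrib_right by linarith+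
  have U0: "\<bar>U (I0 j, t, x)\<bar> \<le> ?M" for j
  proof (rule order_trans[OF AdmD(2)[OF U t]])
    show "M0 * exp (l0 * t) \<le> ?M" using M0 l0 t by (intro mult_left_mono) (auto intro!: mult_left_mono)
  qed
  have M: "0 \<le> ?M" using M0 by simp
  have 1: "\<bar>(da j i t x + U (I1 j i, t, x)) * tr (U (I1 k j, t, x)) + (a j t x + U (I0 j, t, x)) * (tr' (U (I1 k j, t, x)) * U (I2 k j i, t, x))\<bar>
      \<le> (B + ?X) * (R + 1) + (B + ?M) * (1 * ?X)" for j
  proof (rule order_trans[OF abs_triangle_ineq], rule add_mono)
    show "\<bar>(da j i t x + U (I1 j i, t, x)) * tr (U (I1 k j, t, x))\<bar> \<le> (B + ?X) * (R + 1)"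
      unfolding abs_mult using da_le[OF t, of j i x] AdmD(3)[OF U t, of j i x] tr_le B_nonneg X0
      by (intro mult_mono) auto
    show "\<bar>(a j t x + U (I0 j, t, x)) * (tr' (U (I1 k j, t, x)) * U (I2 k j i, t, x))\<bar> \<le> (B + ?M) * (1 * ?X)"
      unfolding abs_mult using a_le[OF t, of j x] U0[of j] tr'_le AdmD(4)[OF U t, of k j i x] B_nonneg X0 M
      by (intro mult_mono) auto
  qed
  have 2: "\<bar>fy k l t (x, uvec U t x) * U (I1 l i, t, x)\<bar> \<le> B * ?X" for l
    unfolding abs_mult using fy_le[OF t] AdmD(3)[OF U t] B_nonneg by (intro mult_mono) auto
  have S1: "\<bar>\<Sum>j\<in>UNIV. (da j i t x + U (I1 j i, t, x)) * tr (U (I1 k j, t, x)) + (a j t x + U (I0 j, t, x)) * (tr' (U (I1 k j, t, x)) * U (I2 k j i, t, x))\<bar>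
      \<le> real CARD('n) * ((B + ?X) * (R + 1) + (B + ?M) * (1 * ?X))" using 1 by (rule abs_sum_le_card)
  have S2: "\<bar>\<Sum>l\<in>UNIV. fy k l t (x, uvec U t x) * U (I1 l i, t, x)\<bar> \<le> real CARD('n) * (B * ?X)" using 2 by (rule abs_sum_le_card)
  have "\<bar>N1 U k i t x\<bar> \<le> B + real CARD('n) * (B * ?X) + real CARD('n) * ((B + ?X) * (R + 1) + (B + ?M) * (1 * ?X))"
    using S1 S2 fx_le[OF t, of k i "(x, uvec U t x)"] unfolding N1_def by linarith
  also have "\<dots> \<le> B * ?Y + real CARD('n) * (B * ?Y) + real CARD('n) * (((B + 1) * ?Y) * (R + 1) + (B + ?M) * ?Y)"
  proof (intro add_mono mult_left_mono mult_right_mono)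
    show "B \<le> B * ?Y" using mult_left_mono[OF Y1 B_nonneg] by simp
    then show "B + ?X \<le> (B + 1) * ?Y" using XY by (simp only: distrib_right[of B 1])
  qed (use XY B_nonneg R M in auto)
  finally show ?thesis by (simp add: algebra_simps)
qed

lemma Phi_Adm:
  assumes U: "U \<in> Adm (2 * B + 1) l0 (2 * B + 1) l1" and l0: "0 < l0" and l1: "0 < l1"
    and w0: "((real CARD('n) * (R + 1) + 1) * (B + 1)) * (Cw / sqrt l0) \<le> 1/2"
    and w1: "(B + real CARD('n) * B + real CARD('n) * ((B + 1) * (R + 1) + (B + (2 * B + 1) * exp (l0 * \<tau>)))) * (Cw / sqrt l1) \<le> 1/2"
  shows "Phi U \<in> Adm (2 * B + 1) l0 (2 * B + 1) l1"
proof -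
  let ?M = "2 * B + 1"
  let ?A0 = "(real CARD('n) * (R + 1) + 1) * (B + 1)" and ?A1 = "B + real CARD('n) * B + real CARD('n) * ((B + 1) * (R + 1) + (B + ?M * exp (l0 * \<tau>)))"
  have M: "0 \<le> ?M" using B_nonneg by simp
  note Uc = AdmD(1)[OF U]
  have b0: "\<bar>N0 U k t x\<bar> \<le> (?A0 * (1 + ?M)) * exp (l0 * t)" if "t \<in> {0..\<tau>}" for k t x
    using N0_le[OF U that M] l0 by simp
  have b1: "\<bar>N1 U k i t x\<bar> \<le> (?A1 * (1 + ?M)) * exp (l1 * t)" if "t \<in> {0..\<tau>}" for k i t x
    using N1_le[OF U that M M] l0 l1 by simp
  have unif: "\<bar>g t x\<bar> \<le> \<bar>D\<bar> * exp (l * \<tau>)" if "\<And>t x. t \<in> {0..\<tau>} \<Longrightarrow> \<bar>g t x\<bar> \<le> D * exp (l * t)" "0 < l" "t \<in> {0..\<tau>}"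
    for g :: "real \<Rightarrow> real^'n \<Rightarrow> real" and D l t x
  proof -
    have "\<bar>g t x\<bar> \<le> D * exp (l * t)" using that by blast
    also have "\<dots> \<le> \<bar>D\<bar> * exp (l * \<tau>)" using that by (intro mult_mono) auto
    finally show ?thesis .
  qed
  have u0: "\<bar>N0 U k t x\<bar> \<le> \<bar>?A0 * (1 + ?M)\<bar> * exp (l0 * \<tau>)" if "t \<in> {0..\<tau>}" for k t x
    by (rule unif[OF b0 l0 that])
  have u1: "\<bar>N1 U k i t x\<bar> \<le> \<bar>?A1 * (1 + ?M)\<bar> * exp (l1 * \<tau>)" if "t \<in> {0..\<tau>}" for k i t x
    by (rule unif[OF b1 l1 that])
  have ctx: "continuous_on ({0..\<tau>} \<times> UNIV) (\<lambda>p. fst p * avg c k0 g (fst p) (snd p))"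
    "continuous_on ({0..\<tau>} \<times> UNIV) (\<lambda>p. (2 * sqrt (fst p) / c) * avg c (kz j) g (fst p) (snd p))"
    if "cstrip \<tau> g" "\<And>t x. t \<in> {0..\<tau>} \<Longrightarrow> \<bar>g t x\<bar> \<le> B'" for g :: "real \<Rightarrow> real^'n \<Rightarrow> real" and B' j
    using avg_cstrip[OF that k0_integrable, unfolded cstrip_def, of c] avg_cstrip[OF that kz_integrable[of j], unfolded cstrip_def, of c] c
    by (auto intro!: continuous_intros)
  \<comment> \<open>The heat term contributes \<open>B\<close> and the Duhamel term half of
    \<open>1 + M\<close>; the value \<open>M = 2 * B + 1\<close> is the one that solves
    \<open>B + (1 + M) / 2 = M\<close>.\<close>
  have step: "B + D * (1 + ?M) * (Cw / sqrt l) * e \<le> ?M * e" if "D * (Cw / sqrt l) \<le> 1/2" "1 \<le> e" for D l e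
  proof -
    have "D * (1 + ?M) * (Cw / sqrt l) * e = (D * (Cw / sqrt l)) * ((1 + ?M) * e)" by simp
    also have "\<dots> \<le> (1/2) * ((1 + ?M) * e)" using that M by (intro mult_right_mono) auto
    finally show ?thesis using mult_left_mono[OF that(2) B_nonneg] by (simp add: algebra_simps)
  qed
  show ?thesis unfolding Adm_def
  proof (intro CollectI conjI allI ballI)
    fix q
    show "cstrip \<tau> (\<lambda>t x. Phi U (q, t, x))"
    proof (cases q)
      case (I0 k)
      then show ?thesis using heat_cstrip[OF h_c h_le, of \<tau> c k] ctx(1)[OF N0_cstrip[OF Uc] u0, of k]
        by (auto simp: cstrip_def intro!: continuous_intros)
    next
      case (I1 k i)
      then show ?thesis using heat_cstrip[OF dh_c dh_le, of \<tau> c k i] ctx(1)[OF N1_cstrip[OF Uc] u1, of k i]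
        by (auto simp: cstrip_def intro!: continuous_intros)
    next
      case (I2 k i j)
      then show ?thesis using heat_cstrip[OF ddh_c ddh_le, of \<tau> c k i j] ctx(2)[OF N1_cstrip[OF Uc] u1, of j k i]
        by (auto simp: cstrip_def intro!: continuous_on_add)
    qed
  next
    fix t x k assume t: "t \<in> {0..\<tau>}"
    have "\<bar>Phi U (I0 k, t, x)\<bar> \<le> B + ?A0 * (1 + ?M) * (Cw / sqrt l0) * exp (l0 * t)"
      unfolding Phi.simps
      by (rule order_trans[OF abs_triangle_ineq add_mono[OF heat_bound[OF h_c h_le] weighted_bound_k0[OF t l0 b0]]])
    also have "\<dots> \<le> ?M * exp (l0 * t)" by (rule step[OF w0]) (use l0 t in auto)
    finally show "\<bar>Phi U (I0 k, t, x)\<bar> \<le> ?M * exp (l0 * t)" .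
  next
    fix t x k i assume t: "t \<in> {0..\<tau>}"
    have "\<bar>Phi U (I1 k i, t, x)\<bar> \<le> B + ?A1 * (1 + ?M) * (Cw / sqrt l1) * exp (l1 * t)"
      unfolding Phi.simps
      by (rule order_trans[OF abs_triangle_ineq add_mono[OF heat_bound[OF dh_c dh_le] weighted_bound_k0[OF t l1 b1]]])
    also have "\<dots> \<le> ?M * exp (l1 * t)" by (rule step[OF w1]) (use l1 t in auto)
    finally show "\<bar>Phi U (I1 k i, t, x)\<bar> \<le> ?M * exp (l1 * t)" .
  next
    fix t x k i j assume t: "t \<in> {0..\<tau>}"
    have "\<bar>Phi U (I2 k i j, t, x)\<bar> \<le> B + ?A1 * (1 + ?M) * (Cw / sqrt l1) * exp (l1 * t)"
      unfolding Phi.simps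
      by (rule order_trans[OF abs_triangle_ineq add_mono[OF heat_bound[OF ddh_c ddh_le] weighted_bound_kz[OF t l1 b1]]])
    also have "\<dots> \<le> ?M * exp (l1 * t)" by (rule step[OF w1]) (use l1 t in auto)
    finally show "\<bar>Phi U (I2 k i j, t, x)\<bar> \<le> ?M * exp (l1 * t)" .
  next
    fix t k i assume t: "t \<in> {0..\<tau>}"
    have "pder i (heat c (h k) t) (heat c (dh k i) t)"
      by (rule heat_pder[OF h_c h_le dh_c dh_le h_pder])
    moreover have "pder i (avg c k0 (N0 U k) t) (avg c k0 (N1 U k i) t)"
      by (rule avg_pder[OF N0_cstrip[OF Uc] u0 k0_integrable t N1_cstrip[OF Uc] u1 N0_pder[OF U]])
    ultimately show "pder i (\<lambda>x. Phi U (I0 k, t, x)) (\<lambda>x. Phi U (I1 k i, t, x))"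
      unfolding Phi.simps by (intro pder_add pder_cmult)
  next
    fix t k i j assume t: "t \<in> {0..\<tau>}"
    have "pder j (heat c (dh k i) t) (heat c (ddh k i j) t)"
      by (rule heat_pder[OF dh_c dh_le ddh_c ddh_le dh_pder])
    moreover have "pder j (\<lambda>x. t * avg c k0 (N1 U k i) t x) (\<lambda>x. (2 * sqrt t / c) * avg c (kz j) (N1 U k i) t x)"
      by (rule avg_smoothing[OF N1_cstrip[OF Uc] u1 t c])
    ultimately show "pder j (\<lambda>x. Phi U (I1 k i, t, x)) (\<lambda>x. Phi U (I2 k i j, t, x))"
      unfolding Phi.simps by (rule pder_add)
  qed
qed

end

section \<open>Contraction, fixed point and the differential equation\<close>

context burgers
begin

text \<open>Pointwise in time and space, so that any weight can be inserted later. The Lipschitz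
  constant depends on the common bound \<open>M\<close>, because the Hessian is multiplied by
  functions of the other components.\<close>

lemma nonlinearity_lipschitz:
  assumes t: "t \<in> {0..\<tau>}" and M: "\<And>q. \<bar>U (q, t, x)\<bar> \<le> M" "\<And>q. \<bar>V (q, t, x)\<bar> \<le> M"
    and d: "\<And>q. \<bar>U (q, t, x) - V (q, t, x)\<bar> \<le> \<delta>"
  shows "\<bar>N0 U k t x - N0 V k t x\<bar> \<le> (real CARD('n) * B + real CARD('n) * ((R + 1) + (B + M))) * \<delta>" (is ?T0)
    and "\<bar>N1 U k i t x - N1 V k i t x\<bar> \<le> (real CARD('n) * B + real CARD('n) * (real CARD('n) * B * M + B)
        + real CARD('n) * ((R + 1) + (B + M) + (M + (B + M) * (M + 1)))) * \<delta>" (is ?T1)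
proof -
  let ?n = "real CARD('n)"
  have M0: "0 \<le> M" using M(1)[of undefined] by linarith
  have d0: "0 \<le> \<delta>" using d[of undefined] by linarith
  have trd: "\<bar>tr (U (q, t, x)) - tr (V (q, t, x))\<bar> \<le> \<delta>" "\<bar>tr' (U (q, t, x)) - tr' (V (q, t, x))\<bar> \<le> \<delta>" for q
    using tr_lip tr'_lip d order_trans by blast+
  have uv: "B * (\<Sum>l\<in>UNIV. \<bar>uvec U t x $ l - uvec V t x $ l\<bar>) \<le> ?n * B * \<delta>"
  proof -
    have "(\<Sum>l\<in>UNIV. \<bar>uvec U t x $ l - uvec V t x $ l\<bar>) \<le> ?n * \<delta>"
      using sum_bounded_above[of UNIV "\<lambda>l. \<bar>uvec U t x $ l - uvec V t x $ l\<bar>" \<delta>] d by (simp add: uvec_def)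
    from mult_left_mono[OF this B_nonneg] show ?thesis by (simp add: mult_ac)
  qed
  have aV: "\<bar>a j t x + V (q, t, x)\<bar> \<le> B + M" "\<bar>da j i t x + V (q, t, x)\<bar> \<le> B + M" for j q
    using a_le[OF t, of j x] da_le[OF t, of j i x] M(2)[of q] by linarith+
  have add: "\<bar>(b + U (q, t, x)) - (b + V (q, t, x))\<bar> \<le> \<delta>" for b q using d[of q] by simp
  have s1: "\<bar>(a j t x + U (I0 j, t, x)) * tr (U (I1 k j, t, x)) - (a j t x + V (I0 j, t, x)) * tr (V (I1 k j, t, x))\<bar>
      \<le> \<delta> * (R + 1) + (B + M) * \<delta>" for j
    by (rule abs_mult_diff_le[OF add tr_le aV(1) trd(1)])
  have "\<bar>\<Sum>j\<in>UNIV. (a j t x + U (I0 j, t, x)) * tr (U (I1 k j, t, x)) - (a j t x + V (I0 j, t, x)) * tr (V (I1 k j, t, x))\<bar>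
      \<le> ?n * (\<delta> * (R + 1) + (B + M) * \<delta>)" using s1 by (rule abs_sum_le_card)
  then have "\<bar>N0 U k t x - N0 V k t x\<bar> \<le> ?n * B * \<delta> + ?n * (\<delta> * (R + 1) + (B + M) * \<delta>)"
    using order_trans[OF f_lip[OF t] uv, of k x] unfolding N0_def sum_subtractf by linarith
  then show ?T0 by (simp add: algebra_simps)
  have s2: "\<bar>(da j i t x + U (I1 j i, t, x)) * tr (U (I1 k j, t, x)) - (da j i t x + V (I1 j i, t, x)) * tr (V (I1 k j, t, x))\<bar>
      \<le> \<delta> * (R + 1) + (B + M) * \<delta>" for j
    by (rule abs_mult_diff_le[OF add tr_le aV(2) trd(1)])
  have s3: "\<bar>tr' (U (I1 k j, t, x)) * U (I2 k j i, t, x) - tr' (V (I1 k j, t, x)) * V (I2 k j i, t, x)\<bar> \<le> \<delta> * M + 1 * \<delta>" for j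
    by (rule abs_mult_diff_le[OF trd(2) M(1) tr'_le d])
  have s4: "\<bar>tr' (U (I1 k j, t, x)) * U (I2 k j i, t, x)\<bar> \<le> 1 * M" for j
    unfolding abs_mult using tr'_le M(1) by (intro mult_mono) auto
  have s5: "\<bar>(a j t x + U (I0 j, t, x)) * (tr' (U (I1 k j, t, x)) * U (I2 k j i, t, x)) - (a j t x + V (I0 j, t, x)) * (tr' (V (I1 k j, t, x)) * V (I2 k j i, t, x))\<bar>
      \<le> \<delta> * (1 * M) + (B + M) * (\<delta> * M + 1 * \<delta>)" for j
    by (rule abs_mult_diff_le[OF add s4 aV(1) s3])
  have s6: "\<bar>((da j i t x + U (I1 j i, t, x)) * tr (U (I1 k j, t, x)) + (a j t x + U (I0 j, t, x)) * (tr' (U (I1 k j, t, x)) * U (I2 k j i, t, x)))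
     - ((da j i t x + V (I1 j i, t, x)) * tr (V (I1 k j, t, x)) + (a j t x + V (I0 j, t, x)) * (tr' (V (I1 k j, t, x)) * V (I2 k j i, t, x)))\<bar>
      \<le> (\<delta> * (R + 1) + (B + M) * \<delta>) + (\<delta> * (1 * M) + (B + M) * (\<delta> * M + 1 * \<delta>))" for j
    using s2[of j] s5[of j] by linarith
  have S6: "\<bar>\<Sum>j\<in>UNIV. ((da j i t x + U (I1 j i, t, x)) * tr (U (I1 k j, t, x)) + (a j t x + U (I0 j, t, x)) * (tr' (U (I1 k j, t, x)) * U (I2 k j i, t, x)))
     - ((da j i t x + V (I1 j i, t, x)) * tr (V (I1 k j, t, x)) + (a j t x + V (I0 j, t, x)) * (tr' (V (I1 k j, t, x)) * V (I2 k j i, t, x)))\<bar>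
      \<le> ?n * ((\<delta> * (R + 1) + (B + M) * \<delta>) + (\<delta> * (1 * M) + (B + M) * (\<delta> * M + 1 * \<delta>)))"
    using s6 by (rule abs_sum_le_card)
  have s7: "\<bar>fy k l t (x, uvec U t x) * U (I1 l i, t, x) - fy k l t (x, uvec V t x) * V (I1 l i, t, x)\<bar> \<le> (?n * B * \<delta>) * M + B * \<delta>" for l
    by (rule abs_mult_diff_le[OF order_trans[OF fy_lip[OF t] uv] M(1) fy_le[OF t] d])
  have S7: "\<bar>\<Sum>l\<in>UNIV. fy k l t (x, uvec U t x) * U (I1 l i, t, x) - fy k l t (x, uvec V t x) * V (I1 l i, t, x)\<bar> \<le> ?n * ((?n * B * \<delta>) * M + B * \<delta>)"
    using s7 by (rule abs_sum_le_card)
  have "\<bar>N1 U k i t x - N1 V k i t x\<bar> \<le> ?n * B * \<delta> + ?n * ((?n * B * \<delta>) * M + B * \<delta>)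
     + ?n * ((\<delta> * (R + 1) + (B + M) * \<delta>) + (\<delta> * (1 * M) + (B + M) * (\<delta> * M + 1 * \<delta>)))"
    using order_trans[OF fx_lip[OF t] uv, of k i x] S6 S7 unfolding N1_def sum_subtractf by linarith
  then show ?T1 by (simp add: algebra_simps)
qed

abbreviation strip :: "('n ix \<times> real \<times> (real^'n)) set" where
  "strip \<equiv> UNIV \<times> {0..\<tau>} \<times> UNIV"

text \<open>Components for the solution, gradient and Hessian converge uniformly together, hence the
  derivative relations survive the limit.\<close>

lemma Adm_closed:
  assumes X: "\<And>m::nat. X m \<in> Adm M0 l0 M1 l1" and lim: "uniform_limit strip X U sequentially"
  shows "U \<in> Adm M0 l0 M1 l1"
proof -
  have pt: "(\<lambda>m. X m (q, t, x)) \<longlonglongrightarrow> U (q, t, x)" if "t \<in> {0..\<tau>}" for q t x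
    using tendsto_uniform_limitI[OF lim] that by auto
  have ul: "uniform_limit A (\<lambda>m p. X m (g p)) (\<lambda>p. U (g p)) sequentially" if "g ` A \<subseteq> strip" for A :: "'c set" and g
    using lim that unfolding uniform_limit_iff by (fastforce elim!: eventually_mono)
  show ?thesis unfolding Adm_def
  proof (intro CollectI conjI allI ballI)
    fix q
    show "cstrip \<tau> (\<lambda>t x. U (q, t, x))" unfolding cstrip_def
    proof (rule uniform_limit_theorem)
      show "uniform_limit ({0..\<tau>} \<times> UNIV) (\<lambda>m p. X m (q, fst p, snd p)) (\<lambda>p. U (q, fst p, snd p)) sequentially"
        by (rule ul) auto
    qed (use AdmD(1)[OF X, of _ q] in \<open>auto simp: cstrip_def intro!: always_eventually\<close>)
  next
    fix t x k assume t: "t \<in> {0..\<tau>}"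
    show "\<bar>U (I0 k, t, x)\<bar> \<le> M0 * exp (l0 * t)"
      by (rule tendsto_upperbound[OF tendsto_rabs[OF pt[OF t]]]) (auto intro!: always_eventually AdmD(2)[OF X t])
  next
    fix t x k i assume t: "t \<in> {0..\<tau>}"
    show "\<bar>U (I1 k i, t, x)\<bar> \<le> M1 * exp (l1 * t)"
      by (rule tendsto_upperbound[OF tendsto_rabs[OF pt[OF t]]]) (auto intro!: always_eventually AdmD(3)[OF X t])
  next
    fix t x k i j assume t: "t \<in> {0..\<tau>}"
    show "\<bar>U (I2 k i j, t, x)\<bar> \<le> M1 * exp (l1 * t)"
      by (rule tendsto_upperbound[OF tendsto_rabs[OF pt[OF t]]]) (auto intro!: always_eventually AdmD(4)[OF X t])
  next
    fix t k i assume t: "t \<in> {0..\<tau>}"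
    show "pder i (\<lambda>x. U (I0 k, t, x)) (\<lambda>x. U (I1 k i, t, x))"
      by (rule pder_uniform_limit[OF AdmD(5)[OF X t] pt[OF t]]) (rule ul, use t in auto)
  next
    fix t k i j assume t: "t \<in> {0..\<tau>}"
    show "pder j (\<lambda>x. U (I1 k i, t, x)) (\<lambda>x. U (I2 k i j, t, x))"
      by (rule pder_uniform_limit[OF AdmD(6)[OF X t] pt[OF t]]) (rule ul, use t in auto)
  qed
qed

lemma Adm_bound:
  assumes U: "U \<in> Adm M0 l0 M1 l1" and t: "t \<in> {0..\<tau>}" and "0 \<le> M0" "0 \<le> M1" "0 < l0" "0 < l1"
  shows "\<bar>U (q, t, x)\<bar> \<le> M0 * exp (l0 * \<tau>) + M1 * exp (l1 * \<tau>)"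
proof -
  have "M0 * exp (l0 * t) \<le> M0 * exp (l0 * \<tau>)" "M1 * exp (l1 * t) \<le> M1 * exp (l1 * \<tau>)"
    using assms by (auto intro!: mult_left_mono)
  moreover have "0 \<le> M0 * exp (l0 * \<tau>)" "0 \<le> M1 * exp (l1 * \<tau>)" using assms by auto
  moreover have "\<bar>U (q, t, x)\<bar> \<le> M0 * exp (l0 * t) \<or> \<bar>U (q, t, x)\<bar> \<le> M1 * exp (l1 * t)"
    by (cases q) (simp_all add: AdmD[OF U] t[simplified])
  ultimately show ?thesis by linarith
qed

text \<open>The order matters: the condition on \<open>l1\<close> contains
  \<open>exp (l0 * \<tau>)\<close>, so \<open>l0\<close> is fixed first.\<close>

lemma weights_exist:
  obtains l0 l1 where "0 < l0" "0 < l1"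
    "\<And>U. U \<in> Adm (2 * B + 1) l0 (2 * B + 1) l1 \<Longrightarrow> Phi U \<in> Adm (2 * B + 1) l0 (2 * B + 1) l1"
proof -
  obtain l0 where l0: "0 < l0" "((real CARD('n) * (R + 1) + 1) * (B + 1)) * (Cw / sqrt l0) \<le> 1/2"
    using exists_weight by blast
  obtain l1 where l1: "0 < l1" "(B + real CARD('n) * B + real CARD('n) * ((B + 1) * (R + 1) + (B + (2 * B + 1) * exp (l0 * \<tau>)))) * (Cw / sqrt l1) \<le> 1/2"
    using exists_weight by blast
  show thesis by (rule that[OF l0(1) l1(1) Phi_Adm[OF _ l0(1) l1(1) l0(2) l1(2)]])
qed

lemma zero_Adm: "(\<lambda>_. 0) \<in> Adm (2 * B + 1) l0 (2 * B + 1) l1"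
  using B_nonneg by (auto simp: Adm_def cstrip_def pder_def)

text \<open>Continuity in time and space is what turns measurability at each fixed point into joint
  measurability of the iterates under the integrals.\<close>

lemma iterates_cstrip: "cstrip \<tau> (\<lambda>t x. (Phi ^^ m) (\<lambda>_. 0) (q, t, x))"
proof -
  obtain l0 l1 where l: "\<And>U. U \<in> Adm (2 * B + 1) l0 (2 * B + 1) l1 \<Longrightarrow> Phi U \<in> Adm (2 * B + 1) l0 (2 * B + 1) l1"
    using weights_exist by blast
  have "(Phi ^^ m) (\<lambda>_. 0) \<in> Adm (2 * B + 1) l0 (2 * B + 1) l1"
    by (induction m) (auto intro: l zero_Adm)
  then show ?thesis by (rule AdmD(1))
qed

lemma mild_solution_exists:
  obtains U l0 l1 where "0 < l0" "0 < l1" "U \<in> Adm (2 * B + 1) l0 (2 * B + 1) l1"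
    "\<And>q t x. t \<in> {0..\<tau>} \<Longrightarrow> Phi U (q, t, x) = U (q, t, x)"
    "\<And>q t x. t \<in> {0..\<tau>} \<Longrightarrow> (\<lambda>m. (Phi ^^ m) (\<lambda>_. 0) (q, t, x)) \<longlonglongrightarrow> U (q, t, x)"
proof -
  obtain l0 l1 where l: "0 < l0" "0 < l1"
    and inv: "\<And>U. U \<in> Adm (2 * B + 1) l0 (2 * B + 1) l1 \<Longrightarrow> Phi U \<in> Adm (2 * B + 1) l0 (2 * B + 1) l1"
    using weights_exist by blast
  let ?\<A> = "Adm (2 * B + 1) l0 (2 * B + 1) l1"
  define M where "M = (2 * B + 1) * exp (l0 * \<tau>) + (2 * B + 1) * exp (l1 * \<tau>)"
  have b: "0 \<le> 2 * B + 1" using B_nonneg by simp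
  have M: "\<bar>U (q, t, x)\<bar> \<le> M" if "U \<in> ?\<A>" "t \<in> {0..\<tau>}" for U q t x
    unfolding M_def by (rule Adm_bound[OF that b b l])
  have M0: "0 \<le> M" using b by (simp add: M_def)
  let ?n = "real CARD('n)"
  define A0 where "A0 = ?n * B + ?n * ((R + 1) + (B + M))"
  define A1 where "A1 = ?n * B + ?n * (?n * B * M + B) + ?n * ((R + 1) + (B + M) + (M + (B + M) * (M + 1)))"
  have A: "0 \<le> A0" "0 \<le> A1" unfolding A0_def A1_def using B_nonneg M0 R by auto
  \<comment> \<open>A third exponent, for the contraction only: the Lipschitz constants depend on
    \<open>M\<close>, hence on the exponents \<open>l0\<close> and \<open>l1\<close> of the
    invariant set.\<close>
  obtain \<mu> where mu: "0 < \<mu>" "(A0 + A1) * (Cw / sqrt \<mu>) \<le> 1/2" using exists_weight by blast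
  define w :: "'n ix \<times> real \<times> (real^'n) \<Rightarrow> real" where "w a = exp (\<mu> * fst (snd a))" for a
  have small: "A * D * (Cw / sqrt \<mu>) * e \<le> (D / 2) * e" if "A = A0 \<or> A = A1" "0 \<le> D" "0 \<le> e" for A D e
  proof -
    have "A * (Cw / sqrt \<mu>) \<le> (A0 + A1) * (Cw / sqrt \<mu>)"
      using that A Cw_nonneg mu by (intro mult_right_mono) auto
    then have "A * (Cw / sqrt \<mu>) \<le> 1/2" using mu by linarith
    then have "(A * (Cw / sqrt \<mu>)) * (D * e) \<le> (1/2) * (D * e)" using that by (intro mult_right_mono) auto
    then show ?thesis by (simp add: mult_ac)
  qed
  obtain U where U: "U \<in> ?\<A>" "\<And>a. a \<in> strip \<Longrightarrow> Phi U a = U a"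
    "\<And>a. a \<in> strip \<Longrightarrow> (\<lambda>m. (Phi ^^ m) (\<lambda>_. 0) a) \<longlonglongrightarrow> U a"
  proof (rule picard_iteration_converges[of "\<lambda>_. 0" ?\<A> Phi strip w "exp (\<mu> * \<tau>)" M])
    show "0 \<le> w a \<and> w a \<le> exp (\<mu> * \<tau>)" if "a \<in> strip" for a using that mu by (auto simp: w_def)
    show "\<bar>Phi (\<lambda>_. 0) a - 0\<bar> \<le> M * w a" if a: "a \<in> strip" for a
    proof -
      obtain q t x where [simp]: "a = (q, t, x)" and t: "t \<in> {0..\<tau>}" using a by (cases a) auto
      have "\<bar>Phi (\<lambda>_. 0) a\<bar> \<le> M * 1" using M[OF inv[OF zero_Adm] t] by simp
      also have "\<dots> \<le> M * w a" using M0 mu t by (intro mult_left_mono) (auto simp: w_def)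
      finally show ?thesis by simp
    qed
    show "U \<in> ?\<A>" if "\<And>m::nat. X m \<in> ?\<A>" "uniform_limit strip X U sequentially" for X U
      by (rule Adm_closed[OF that])
    fix U V D a assume UV: "U \<in> ?\<A>" "V \<in> ?\<A>" and D: "0 \<le> D"
      and diff: "\<And>a. a \<in> strip \<Longrightarrow> \<bar>U a - V a\<bar> \<le> D * w a" and a: "a \<in> strip"
    obtain q t x where [simp]: "a = (q, t, x)" and t: "t \<in> {0..\<tau>}" using a by (cases a) auto
    have d: "\<bar>U (q, s, y) - V (q, s, y)\<bar> \<le> D * exp (\<mu> * s)" if "s \<in> {0..\<tau>}" for q s y
      using diff[of "(q, s, y)"] that by (auto simp: w_def)
    have n0: "\<bar>N0 U k s y - N0 V k s y\<bar> \<le> (A0 * D) * exp (\<mu> * s)" if s: "s \<in> {0..\<tau>}" for k s y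
      using nonlinearity_lipschitz(1)[where U=U and V=V and x=y and k=k, OF s M[OF UV(1) s] M[OF UV(2) s] d[OF s]] by (simp add: A0_def mult.assoc)
    have n1: "\<bar>N1 U k i s y - N1 V k i s y\<bar> \<le> (A1 * D) * exp (\<mu> * s)" if s: "s \<in> {0..\<tau>}" for k i s y
      using nonlinearity_lipschitz(2)[where U=U and V=V and x=y and k=k and i=i, OF s M[OF UV(1) s] M[OF UV(2) s] d[OF s]] by (simp add: A1_def mult.assoc)
    have bd0: "\<exists>C. \<forall>s y. s \<in> {0..\<tau>} \<longrightarrow> \<bar>N0 Z k s y\<bar> \<le> C" "\<exists>C. \<forall>s y. s \<in> {0..\<tau>} \<longrightarrow> \<bar>N1 Z k i s y\<bar> \<le> C" if "Z \<in> ?\<A>" for Z k i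
    proof -
      let ?C0 = "((?n * (R + 1) + 1) * (B + 1) * (1 + (2 * B + 1)))"
      let ?C1 = "(B + ?n * B + ?n * ((B + 1) * (R + 1) + (B + (2 * B + 1) * exp (l0 * \<tau>)))) * (1 + (2 * B + 1))"
      have C: "0 \<le> ?C0" "0 \<le> ?C1" using B_nonneg R by (auto intro!: mult_nonneg_nonneg add_nonneg_nonneg)
      have "\<bar>N0 Z k s y\<bar> \<le> ?C0 * exp (l0 * \<tau>)" if s: "s \<in> {0..\<tau>}" for s y
        by (rule order_trans[OF N0_le[OF \<open>Z \<in> ?\<A>\<close> s b]]) (use l s C in \<open>auto intro!: mult_left_mono\<close>)
      then show "\<exists>C. \<forall>s y. s \<in> {0..\<tau>} \<longrightarrow> \<bar>N0 Z k s y\<bar> \<le> C" by blast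
      have "\<bar>N1 Z k i s y\<bar> \<le> ?C1 * exp (l1 * \<tau>)" if s: "s \<in> {0..\<tau>}" for s y
        by (rule order_trans[OF N1_le[OF \<open>Z \<in> ?\<A>\<close> s b b]]) (use l s C in \<open>auto intro!: mult_left_mono\<close>)
      then show "\<exists>C. \<forall>s y. s \<in> {0..\<tau>} \<longrightarrow> \<bar>N1 Z k i s y\<bar> \<le> C" by blast
    qed
    have av0: "avg c kk (N0 U k) t x - avg c kk (N0 V k) t x = avg c kk (\<lambda>s y. N0 U k s y - N0 V k s y) t x" if "integrable QQ kk" for kk k
    proof -
      obtain C1 where C1: "\<And>s y. s \<in> {0..\<tau>} \<Longrightarrow> \<bar>N0 U k s y\<bar> \<le> C1" using bd0(1)[OF UV(1)] by blast
      obtain C2 where C2: "\<And>s y. s \<in> {0..\<tau>} \<Longrightarrow> \<bar>N0 V k s y\<bar> \<le> C2" using bd0(1)[OF UV(2)] by blast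
      show ?thesis by (rule avg_diff[OF N0_cstrip[OF AdmD(1)[OF UV(1)]] C1 N0_cstrip[OF AdmD(1)[OF UV(2)]] C2 that t])
    qed
    have av1: "avg c kk (N1 U k i) t x - avg c kk (N1 V k i) t x = avg c kk (\<lambda>s y. N1 U k i s y - N1 V k i s y) t x" if "integrable QQ kk" for kk k i
    proof -
      obtain C1 where C1: "\<And>s y. s \<in> {0..\<tau>} \<Longrightarrow> \<bar>N1 U k i s y\<bar> \<le> C1" using bd0(2)[OF UV(1)] by blast
      obtain C2 where C2: "\<And>s y. s \<in> {0..\<tau>} \<Longrightarrow> \<bar>N1 V k i s y\<bar> \<le> C2" using bd0(2)[OF UV(2)] by blast
      show ?thesis by (rule avg_diff[OF N1_cstrip[OF AdmD(1)[OF UV(1)]] C1 N1_cstrip[OF AdmD(1)[OF UV(2)]] C2 that t])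
    qed
    have fin: "(A * D) * (Cw / sqrt \<mu>) * exp (\<mu> * t) \<le> (D / 2) * w a" if "A = A0 \<or> A = A1" for A
      using small[OF that D, of "exp (\<mu> * t)"] by (simp add: w_def)
    show "\<bar>Phi U a - Phi V a\<bar> \<le> (D / 2) * w a"
    proof (cases q)
      case (I0 k)
      have "Phi U a - Phi V a = t * avg c k0 (\<lambda>s y. N0 U k s y - N0 V k s y) t x"
        by (simp add: I0 av0[OF k0_integrable, symmetric] right_diff_distrib)
      then show ?thesis by (simp only:) (rule order_trans[OF weighted_bound_k0[OF t mu(1) n0] fin[OF disjI1[OF refl]]])
    next
      case (I1 k i)
      have "Phi U a - Phi V a = t * avg c k0 (\<lambda>s y. N1 U k i s y - N1 V k i s y) t x"
        by (simp add: I1 av1[OF k0_integrable, symmetric] right_diff_distrib)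
      then show ?thesis by (simp only:) (rule order_trans[OF weighted_bound_k0[OF t mu(1) n1] fin[OF disjI2[OF refl]]])
    next
      case (I2 k i j)
      have "Phi U a - Phi V a = (2 * sqrt t / c) * avg c (kz j) (\<lambda>s y. N1 U k i s y - N1 V k i s y) t x"
        by (simp add: I2 av1[OF kz_integrable, symmetric] right_diff_distrib diff_divide_distrib)
      then show ?thesis by (simp only:) (rule order_trans[OF weighted_bound_kz[OF t mu(1) n1] fin[OF disjI2[OF refl]]])
    qed
  qed (auto intro: inv zero_Adm M0)
  show thesis by (rule that[OF l U(1)]) (use U in auto)
qed

text \<open>The two heat equations are added; by the fixed point equation the Hessian components of
  \<open>U\<close> are precisely the sums of the second order terms occurring in them.\<close>

lemma mild_solution_pde:
  assumes l: "0 < l0" "0 < l1" and U: "U \<in> Adm (2 * B + 1) l0 (2 * B + 1) l1"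
    and fixp: "\<And>q t x. t \<in> {0..\<tau>} \<Longrightarrow> Phi U (q, t, x) = U (q, t, x)" and t: "t \<in> {0..\<tau>}"
  shows "((\<lambda>s. \<nu> * (\<Sum>j\<in>UNIV. U (I2 k j j, s, x)) + N0 U k s x) has_integral (U (I0 k, t, x) - h k x)) {0..t}"
proof -
  have b: "0 \<le> 2 * B + 1" using B_nonneg by simp
  let ?n = "real CARD('n)"
  let ?C0 = "((?n * (R + 1) + 1) * (B + 1) * (1 + (2 * B + 1)))"
  let ?C1 = "(B + ?n * B + ?n * ((B + 1) * (R + 1) + (B + (2 * B + 1) * exp (l0 * \<tau>)))) * (1 + (2 * B + 1))"
  have C: "0 \<le> ?C0" "0 \<le> ?C1" using B_nonneg R by (auto intro!: mult_nonneg_nonneg add_nonneg_nonneg)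
  have n0: "\<bar>N0 U k s y\<bar> \<le> ?C0 * exp (l0 * \<tau>)" if s: "s \<in> {0..\<tau>}" for s y
    by (rule order_trans[OF N0_le[OF U s b]]) (use l s C in \<open>auto intro!: mult_left_mono\<close>)
  have n1: "\<bar>N1 U k j s y\<bar> \<le> ?C1 * exp (l1 * \<tau>)" if s: "s \<in> {0..\<tau>}" for j s y
    by (rule order_trans[OF N1_le[OF U s b b]]) (use l s C in \<open>auto intro!: mult_left_mono\<close>)
  have H: "((\<lambda>s. \<nu> * (\<Sum>j\<in>UNIV. heat c (ddh k j j) s x)) has_integral (heat c (h k) t x - h k x)) {0..t}"
    by (rule heat_solves_heat_equation[OF h_c h_le dh_c dh_le h_pder ddh_c ddh_le dh_pder c nu]) (use t in auto)
  have A: "((\<lambda>s. \<nu> * (\<Sum>j\<in>UNIV. (2 * sqrt s / c) * avg c (kz j) (N1 U k j) s x) + N0 U k s x)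
     has_integral (t * avg c k0 (N0 U k) t x)) {0..t}"
    by (rule avg_solves_heat_equation[OF N0_cstrip[OF AdmD(1)[OF U]] n0 N1_cstrip[OF AdmD(1)[OF U]] n1 N0_pder[OF U] c nu t])
  have "U (I0 k, t, x) - h k x = (heat c (h k) t x - h k x) + t * avg c k0 (N0 U k) t x"
    using fixp[OF t, of "I0 k" x] by simp
  with has_integral_add[OF H A] show ?thesis
  proof (simp only:, elim has_integral_eq[rotated])
    fix s assume "s \<in> {0..t}"
    then have s: "s \<in> {0..\<tau>}" using t by auto
    have "U (I2 k j j, s, x) = heat c (ddh k j j) s x + (2 * sqrt s / c) * avg c (kz j) (N1 U k j) s x" for j
      using fixp[OF s, of "I2 k j j" x] by simp
    then show "\<nu> * (\<Sum>j\<in>UNIV. heat c (ddh k j j) s x) + (\<nu> * (\<Sum>j\<in>UNIV. (2 * sqrt s / c) * avg c (kz j) (N1 U k j) s x) + N0 U k s x)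
       = \<nu> * (\<Sum>j\<in>UNIV. U (I2 k j j, s, x)) + N0 U k s x"
      by (simp add: sum.distrib distrib_left)
  qed
qed

end

section \<open>Measurability of the Picard iterates\<close>

lemma borel_measurable_vec:
  fixes g :: "'w \<Rightarrow> real^'n::finite"
  assumes "\<And>l. (\<lambda>w. g w $ l) \<in> borel_measurable N"
  shows "g \<in> borel_measurable N"
  unfolding borel_measurable_euclidean_space[of g] using assms by (auto simp: Basis_vec_def inner_axis)

text \<open>Induction over all times and points at once, since one application of the map reads the
  previous iterate at all earlier times and all points of space. The \<sigma>-algebras
  \<open>N t\<close> are abstract because they will be traces of the filtration on a set outside of
  which the coefficients may be irregular.\<close>

lemma Phi_iterate_measurable:
  fixes N :: "real \<Rightarrow> 'w measure"
    and a :: "'w \<Rightarrow> 'n::finite \<Rightarrow> real \<Rightarrow> real^'n \<Rightarrow> real" and da :: "'w \<Rightarrow> 'n \<Rightarrow> 'n \<Rightarrow> real \<Rightarrow> real^'n \<Rightarrow> real"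
    and f :: "'w \<Rightarrow> 'n \<Rightarrow> real \<Rightarrow> (real^'n) \<times> (real^'n) \<Rightarrow> real"
    and fx fy :: "'w \<Rightarrow> 'n \<Rightarrow> 'n \<Rightarrow> real \<Rightarrow> (real^'n) \<times> (real^'n) \<Rightarrow> real"
    and h :: "'w \<Rightarrow> 'n \<Rightarrow> real^'n \<Rightarrow> real" and dh :: "'w \<Rightarrow> 'n \<Rightarrow> 'n \<Rightarrow> real^'n \<Rightarrow> real"
    and ddh :: "'w \<Rightarrow> 'n \<Rightarrow> 'n \<Rightarrow> 'n \<Rightarrow> real^'n \<Rightarrow> real"
  assumes sp: "\<And>t. t \<in> {0..\<tau>} \<Longrightarrow> space (N t) = \<Omega>"
    and mono: "\<And>s t (g::'w \<Rightarrow> real). s \<in> {0..t} \<Longrightarrow> t \<in> {0..\<tau>} \<Longrightarrow> g \<in> borel_measurable (N s) \<Longrightarrow> g \<in> borel_measurable (N t)"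
    and burg: "\<And>w. w \<in> \<Omega> \<Longrightarrow> burgers c tr tr' (a w) (da w) (f w) (fx w) (fy w) (h w) (dh w) (ddh w) \<tau> \<nu> B R"
    and am: "\<And>j t x. t \<in> {0..\<tau>} \<Longrightarrow> (\<lambda>w. a w j t x) \<in> borel_measurable (N t)"
    and dam: "\<And>j i t x. t \<in> {0..\<tau>} \<Longrightarrow> (\<lambda>w. da w j i t x) \<in> borel_measurable (N t)"
    and fm: "\<And>k t p. t \<in> {0..\<tau>} \<Longrightarrow> (\<lambda>w. f w k t p) \<in> borel_measurable (N t)"
    and fxm: "\<And>k i t p. t \<in> {0..\<tau>} \<Longrightarrow> (\<lambda>w. fx w k i t p) \<in> borel_measurable (N t)"
    and fym: "\<And>k i t p. t \<in> {0..\<tau>} \<Longrightarrow> (\<lambda>w. fy w k i t p) \<in> borel_measurable (N t)"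
    and hm: "\<And>k x. (\<lambda>w. h w k x) \<in> borel_measurable (N 0)"
    and dhm: "\<And>k i x. (\<lambda>w. dh w k i x) \<in> borel_measurable (N 0)"
    and ddhm: "\<And>k i j x. (\<lambda>w. ddh w k i j x) \<in> borel_measurable (N 0)"
    and t: "t \<in> {0..\<tau>}"
  shows "(\<lambda>w. (burgers_operator.Phi c tr tr' (a w) (da w) (f w) (fx w) (fy w) (h w) (dh w) (ddh w) ^^ m) (\<lambda>_. 0) (q, t, x))
     \<in> borel_measurable (N t)"
  using t
proof (induction m arbitrary: q t x)
  case 0
  then show ?case by simp
next
  case (Suc m)
  define P where "P w = burgers_operator.Phi c tr tr' (a w) (da w) (f w) (fx w) (fy w) (h w) (dh w) (ddh w)" for w
  define U where "U w = (P w ^^ m) (\<lambda>_. 0)" for w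
  note t = Suc.prems
  have Um: "(\<lambda>w. U w (q, s, y)) \<in> borel_measurable (N s)" if "s \<in> {0..\<tau>}" for q s y
    using Suc.IH[OF that, of q y] by (simp add: U_def P_def)
  have Uc: "cstrip \<tau> (\<lambda>t x. U w (q, t, x))" if "w \<in> \<Omega>" for w q
    unfolding U_def P_def by (rule burgers.iterates_cstrip[OF burg[OF that]])
  define n0 where "n0 w = burgers_operator.N0 tr (a w) (f w) (U w)" for w
  define n1 where "n1 w = burgers_operator.N1 tr tr' (a w) (da w) (fx w) (fy w) (U w)" for w
  have \<Omega>: "w \<in> space (N t) \<Longrightarrow> w \<in> \<Omega>" for w using sp[OF t] by simp
  have comp: "(\<lambda>w. g w s (y, burgers_operator.uvec (U w) s y)) \<in> borel_measurable (N s)"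
    if s: "s \<in> {0..\<tau>}" and gm: "\<And>p. (\<lambda>w. g w s p) \<in> borel_measurable (N s)" and gc: "\<And>w. w \<in> \<Omega> \<Longrightarrow> cstrip \<tau> (g w)"
    for g :: "'w \<Rightarrow> real \<Rightarrow> (real^'n) \<times> (real^'n) \<Rightarrow> real" and s y
  proof (rule measurable_caratheodory_compose[where f="\<lambda>p w. g w s p"])
    show "continuous_on UNIV (\<lambda>p. g w s p)" if "w \<in> space (N s)" for w
      using cstrip_slice[OF gc s] that sp[OF s] by auto
    have "(\<lambda>w. burgers_operator.uvec (U w) s y) \<in> borel_measurable (N s)"
      by (rule borel_measurable_vec) (simp add: burgers_operator.uvec_def Um[OF s])
    then show "(\<lambda>w. (y, burgers_operator.uvec (U w) s y)) \<in> borel_measurable (N s)" by simp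
  qed (rule gm)
  have gU: "(\<lambda>w. g (U w (q, s, y))) \<in> borel_measurable (N s)"
    if s: "s \<in> {0..\<tau>}" and g: "\<And>w. w \<in> \<Omega> \<Longrightarrow> continuous_on UNIV g" for g :: "real \<Rightarrow> real" and q s y
  \<comment> \<open>Continuity of \<open>tr\<close> and \<open>tr'\<close> is known through the
    locale at some point of \<Omega>, so the empty case has to be separated.\<close>
  proof (cases "\<Omega> = {}")
    case True
    then have "space (N s) = {}" using sp[OF s] by simp
    then show ?thesis by (simp add: measurable_def)
  next
    case False
    then have "g \<in> borel_measurable borel" using g by (auto intro: borel_measurable_continuous_onI)
    from measurable_compose[OF Um[OF s] this] show ?thesis .
  qed
  have trU: "(\<lambda>w. tr (U w (q, s, y))) \<in> borel_measurable (N s)" "(\<lambda>w. tr' (U w (q, s, y))) \<in> borel_measurable (N s)"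
    if s: "s \<in> {0..\<tau>}" for q s y
    using gU[OF s burgers.tr_cont[OF burg]] gU[OF s burgers.tr'_cont[OF burg]] by auto
  have cf: "(\<lambda>w. f w k s (y, burgers_operator.uvec (U w) s y)) \<in> borel_measurable (N s)"
    "(\<lambda>w. fx w k i s (y, burgers_operator.uvec (U w) s y)) \<in> borel_measurable (N s)"
    "(\<lambda>w. fy w k i s (y, burgers_operator.uvec (U w) s y)) \<in> borel_measurable (N s)" if s: "s \<in> {0..\<tau>}" for k i s y
    by (rule comp[where g="\<lambda>w. f w k", OF s fm[OF s] burgers.f_c[OF burg]], assumption)
      (rule comp[where g="\<lambda>w. fx w k i", OF s fxm[OF s] burgers.fx_c[OF burg]], assumption,
       rule comp[where g="\<lambda>w. fy w k i", OF s fym[OF s] burgers.fy_c[OF burg]], assumption)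
  have n0m: "(\<lambda>w. n0 w k s y) \<in> borel_measurable (N s)" if s: "s \<in> {0..\<tau>}" for k s y
    unfolding n0_def burgers_operator.N0_def
    by (intro borel_measurable_diff borel_measurable_sum borel_measurable_times borel_measurable_add
        cf[OF s] am[OF s] Um[OF s] trU[OF s])
  have n1m: "(\<lambda>w. n1 w k i s y) \<in> borel_measurable (N s)" if s: "s \<in> {0..\<tau>}" for k i s y
    unfolding n1_def burgers_operator.N1_def
    by (intro borel_measurable_diff borel_measurable_sum borel_measurable_times borel_measurable_add
        cf[OF s] am[OF s] dam[OF s] Um[OF s] trU[OF s])
  have av0: "(\<lambda>w. avg c kk (n0 w k) t x) \<in> borel_measurable (N t)" if "kk \<in> borel_measurable borel" for kk k
  proof (rule avg_measurable_param[OF t that])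
    show "cstrip \<tau> (n0 w k)" if "w \<in> space (N t)" for w
      unfolding n0_def by (rule burgers.N0_cstrip[OF burg Uc]) (use \<Omega> that in auto)
    show "(\<lambda>w. n0 w k s y) \<in> borel_measurable (N t)" if "s \<in> {0..t}" for s y
      by (rule mono[OF that t n0m]) (use that t in auto)
  qed
  have av1: "(\<lambda>w. avg c kk (n1 w k i) t x) \<in> borel_measurable (N t)" if "kk \<in> borel_measurable borel" for kk k i
  proof (rule avg_measurable_param[OF t that])
    show "cstrip \<tau> (n1 w k i)" if "w \<in> space (N t)" for w
      unfolding n1_def by (rule burgers.N1_cstrip[OF burg Uc]) (use \<Omega> that in auto)
    show "(\<lambda>w. n1 w k i s y) \<in> borel_measurable (N t)" if "s \<in> {0..t}" for s y
      by (rule mono[OF that t n1m]) (use that t in auto)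
  qed
  have ht: "(\<lambda>w. heat c (g w) t x) \<in> borel_measurable (N t)"
    if "\<And>w. w \<in> \<Omega> \<Longrightarrow> continuous_on UNIV (g w)" "\<And>y. (\<lambda>w. g w y) \<in> borel_measurable (N 0)" for g
  proof (rule heat_measurable_param)
    show "continuous_on UNIV (g w)" if "w \<in> space (N t)" for w by (rule \<open>\<And>w. w \<in> \<Omega> \<Longrightarrow> continuous_on UNIV (g w)\<close>[OF \<Omega>[OF that]])
    have "0 \<in> {0..t}" using t by simp
    then show "(\<lambda>w. g w y) \<in> borel_measurable (N t)" for y by (rule mono[OF _ t that(2)])
  qed
  have heats: "(\<lambda>w. heat c (h w k) t x) \<in> borel_measurable (N t)" "(\<lambda>w. heat c (dh w k i) t x) \<in> borel_measurable (N t)"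
    "(\<lambda>w. heat c (ddh w k i j) t x) \<in> borel_measurable (N t)" for k i j
    by (rule ht[where g="\<lambda>w. h w k", OF burgers.h_c[OF burg] hm], assumption)
      (rule ht[where g="\<lambda>w. dh w k i", OF burgers.dh_c[OF burg] dhm], assumption,
       rule ht[where g="\<lambda>w. ddh w k i j", OF burgers.ddh_c[OF burg] ddhm], assumption)
  have "(\<lambda>w. P w (U w) (q, t, x)) \<in> borel_measurable (N t)"
  proof (cases q)
    case (I0 k)
    show ?thesis unfolding P_def I0 burgers_operator.Phi.simps n0_def[symmetric]
      by (intro borel_measurable_add borel_measurable_times borel_measurable_const heats av0 k0_measurable)
  next
    case (I1 k i)
    show ?thesis unfolding P_def I1 burgers_operator.Phi.simps n1_def[symmetric]
      by (intro borel_measurable_add borel_measurable_times borel_measurable_const heats av1 k0_measurable)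
  next
    case (I2 k i j)
    show ?thesis unfolding P_def I2 burgers_operator.Phi.simps n1_def[symmetric]
      by (intro borel_measurable_add borel_measurable_times borel_measurable_const heats av1 kz_measurable)
  qed
  then show ?case by (simp add: U_def P_def)
qed

section \<open>The maximum principle\<close>

lemma second_derivative_nonpos_at_max:
  fixes G G' :: "real \<Rightarrow> real"
  assumes d: "\<And>s. (G has_real_derivative G' s) (at s)" and dd: "(G' has_real_derivative l) (at 0)"
    and mx: "\<And>s. G s \<le> G 0"
  shows "l \<le> 0"
proof (rule ccontr)
  assume "\<not> l \<le> 0"
  then obtain e where e: "e > 0" "\<And>s. 0 < s \<Longrightarrow> s < e \<Longrightarrow> G' 0 < G' s"
    using DERIV_pos_inc_right[OF dd] by auto
  have "G' 0 = 0" by (rule DERIV_local_max[OF d, of 1]) (use mx in auto)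
  moreover obtain z where "0 < z" "z < e / 2" "G (e/2) - G 0 = (e/2 - 0) * G' z"
    using MVT2[of 0 "e/2" G G'] d e(1) by auto
  moreover have "0 < G' z" using e(2)[of z] calculation e(1) by auto
  moreover have "0 < (e/2 - 0) * G' z" using \<open>0 < G' z\<close> e(1) by simp
  ultimately show False using mx[of "e/2"] by linarith
qed

text \<open>Only quotients from the left are used, so the maximum may sit at the final time
  \<tau>.\<close>

lemma derivative_nonneg_at_left_max:
  fixes G :: "real \<Rightarrow> real"
  assumes d: "(G has_real_derivative l) (at t within {0..\<tau>})" and t: "0 < t" "t \<le> \<tau>"
    and mx: "\<And>s. s \<in> {0..\<tau>} \<Longrightarrow> G s \<le> G t"
  shows "0 \<le> l"
proof (rule tendsto_lowerbound)
  show "((\<lambda>s. (G s - G t) / (s - t)) \<longlongrightarrow> l) (at t within {0..t})"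
    using has_field_derivative_subset[OF d, of "{0..t}"] t by (auto simp: has_field_derivative_iff)
  show "\<forall>\<^sub>F s in at t within {0..t}. 0 \<le> (G s - G t) / (s - t)"
    using mx t by (auto simp: eventually_at_filter intro!: always_eventually divide_nonpos_nonpos)
  show "at t within {0..t} \<noteq> bot"
    using t by (simp add: trivial_limit_within islimpt_Icc)
qed

lemma abs_derivative_le_lipschitz:
  fixes G :: "real \<Rightarrow> real"
  assumes d: "(G has_real_derivative l) (at 0)" and lip: "\<And>s. \<bar>G s - G 0\<bar> \<le> C * \<bar>s\<bar>"
  shows "\<bar>l\<bar> \<le> C"
proof (rule tendsto_upperbound)
  show "((\<lambda>s. \<bar>(G s - G 0) / (s - 0)\<bar>) \<longlongrightarrow> \<bar>l\<bar>) (at 0)"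
    using d by (intro tendsto_rabs) (simp add: has_field_derivative_iff)
  show "\<forall>\<^sub>F s in at 0. \<bar>(G s - G 0) / (s - 0)\<bar> \<le> C"
    using lip by (auto simp: eventually_at_filter abs_div field_simps intro!: always_eventually)
qed simp

text \<open>A smooth substitute for the absolute value with first derivative bounded by 1 in modulus
  and second derivative at most 1.\<close>

definition psi1 :: "real \<Rightarrow> real" where "psi1 r = sqrt (1 + r\<^sup>2)"

lemma psi1_ge: "1 \<le> psi1 r" "\<bar>r\<bar> \<le> psi1 r"
  unfolding psi1_def by (auto intro!: real_le_rsqrt)

lemma psi1_deriv: "(psi1 has_real_derivative r / psi1 r) (at r)"
proof -
  have "1 + r\<^sup>2 > 0" by (simp add: add_pos_nonneg)
  then show ?thesis unfolding psi1_def[abs_def] by (auto intro!: derivative_eq_intros simp: field_simps)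
qed

lemma psi1_deriv_abs: "\<bar>r / psi1 r\<bar> \<le> 1"
  using psi1_ge[of r] by (simp add: abs_div field_simps)

lemma psi1_deriv2: "((\<lambda>r. r / psi1 r) has_real_derivative (psi1 r - r * (r / psi1 r)) / (psi1 r * psi1 r)) (at r)"
  using psi1_ge(1)[of r] by (auto intro!: derivative_eq_intros psi1_deriv)

lemma psi1_deriv2_le: "(psi1 r - r * (r / psi1 r)) / (psi1 r * psi1 r) \<le> 1"
proof -
  have p: "1 \<le> psi1 r" by (rule psi1_ge)
  have "0 \<le> r * (r / psi1 r)" using p by simp
  then have "psi1 r - r * (r / psi1 r) \<le> psi1 r * 1" by simp
  also have "\<dots> \<le> psi1 r * psi1 r" using p by (intro mult_left_mono) auto
  finally show ?thesis using p by (simp add: divide_le_eq)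
qed

text \<open>The penalisation that forces maxima to be attained. A sum over coordinates is used so
  that a derivative along one axis sees a single summand.\<close>

definition psi :: "real^'n::finite \<Rightarrow> real" where "psi x = (\<Sum>j\<in>UNIV. psi1 (x $ j))"

lemma psi_shift_deriv:
  "((\<lambda>s. psi (x + s *\<^sub>R axis j 1)) has_real_derivative (x $ j + s) / psi1 (x $ j + s)) (at s)"
proof -
  have "psi (x + s *\<^sub>R axis j 1) = (\<Sum>i\<in>UNIV - {j}. psi1 (x $ i)) + psi1 (x $ j + s)" for s
  proof -
    have "(\<Sum>i\<in>UNIV - {j}. psi1 ((x + s *\<^sub>R axis j 1) $ i)) = (\<Sum>i\<in>UNIV - {j}. psi1 (x $ i))"
      by (intro sum.cong) (auto simp: axis_def)
    then show ?thesis unfolding psi_def by (subst sum.remove[of _ j]) auto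
  qed
  moreover have "((\<lambda>s. (\<Sum>i\<in>UNIV - {j}. psi1 (x $ i)) + psi1 (x $ j + s)) has_real_derivative (x $ j + s) / psi1 (x $ j + s)) (at s)"
    by (auto intro!: derivative_eq_intros DERIV_chain2[OF psi1_deriv])
  ultimately show ?thesis by simp
qed

lemma sum_abs_le_card_norm: "(\<Sum>j\<in>UNIV. \<bar>(x::real^'n::finite) $ j\<bar>) \<le> real CARD('n) * norm x"
  using sum_bounded_above[of UNIV "\<lambda>j. \<bar>x $ j\<bar>" "norm x"] component_le_norm_cart[of x] by simp

lemma psi_lipschitz: "\<bar>psi x - psi y\<bar> \<le> real CARD('n) * norm (x - y)" for x y :: "real^'n::finite"
proof -
  have 1: "\<bar>psi1 r - psi1 s\<bar> \<le> 1 * \<bar>r - s\<bar>" for r s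
    using field_differentiable_bound[where S=UNIV and f=psi1 and f'="\<lambda>r. r / psi1 r" and B=1, OF _ _ _ _, of s r]
      psi1_deriv psi1_deriv_abs by auto
  have "\<bar>psi x - psi y\<bar> \<le> (\<Sum>j\<in>UNIV. \<bar>psi1 (x $ j) - psi1 (y $ j)\<bar>)"
    unfolding psi_def sum_subtractf[symmetric] by (rule sum_abs)
  also have "\<dots> \<le> (\<Sum>j\<in>UNIV. \<bar>(x - y) $ j\<bar>)" using 1 by (intro sum_mono) auto
  also have "\<dots> \<le> real CARD('n) * norm (x - y)" by (rule sum_abs_le_card_norm)
  finally show ?thesis .
qed

lemma psi_ge_norm: "norm x \<le> psi x"
proof -
  have "norm x \<le> (\<Sum>j\<in>UNIV. \<bar>x $ j\<bar>)" by (rule norm_le_l1_cart)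
  also have "\<dots> \<le> psi x" unfolding psi_def by (intro sum_mono psi1_ge)
  finally show ?thesis .
qed

lemma psi_continuous: "continuous_on A psi"
  unfolding psi_def psi1_def by (intro continuous_intros)

lemma norm_shift_deriv:
  fixes v :: "real^'n::finite"
  assumes "v \<noteq> 0"
  shows "((\<lambda>s. norm (v + s *\<^sub>R axis j 1)) has_real_derivative v $ j / norm v) (at 0)"
proof -
  have "((\<lambda>s. norm (v + s *\<^sub>R axis j 1)) has_derivative (\<lambda>r. (r *\<^sub>R axis j 1) \<bullet> sgn (v + 0 *\<^sub>R axis j 1))) (at 0)"
    by (rule has_derivative_compose[where g=norm, OF _ has_derivative_norm]) (use assms in \<open>auto intro!: derivative_eq_intros\<close>)
  then show ?thesis unfolding has_field_derivative_def
    by (rule has_derivative_eq_rhs) (auto simp: sgn_div_norm inner_axis' inner_axis fun_eq_iff divide_inverse)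
qed

text \<open>Growth rate and lifespan of the Lipschitz bound produced by the maximum principle in dimension \<open>N\<close>.\<close>

definition lip_rate :: "real \<Rightarrow> real \<Rightarrow> real" where
  "lip_rate N K = N * K + N * K * (2 * (N * K + 1) + N) + 2 * N * (N * K + 1) * (N * K + 2 * (N * K + 1) + N)"

definition lifespan :: "real \<Rightarrow> real \<Rightarrow> real" where
  "lifespan N K = (N * K + 1) / lip_rate N K"

lemma lip_rate_pos: "1 \<le> N \<Longrightarrow> 0 \<le> K \<Longrightarrow> 0 < lip_rate N K"
  unfolding lip_rate_def by (intro add_nonneg_pos mult_pos_pos add_nonneg_nonneg mult_nonneg_nonneg) (auto intro!: add_nonneg_pos)

lemma lifespan_pos: "1 \<le> N \<Longrightarrow> 0 \<le> K \<Longrightarrow> 0 < lifespan N K"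
  unfolding lifespan_def using lip_rate_pos by (intro divide_pos_pos) (auto intro!: add_nonneg_pos)

text \<open>What the maximum principle uses about a solution. The constant \<open>K\<close> alone
  drives the growth of the Lipschitz bound; \<open>B\<close> and \<open>Mu\<close> enter only an
  error and the radii of a compact set. The level \<open>R\<close> is twice the initial Lipschitz
  bound, to let that bound double, plus one for the slope of the penalisation.\<close>

locale burgers_solution = burgers c tr tr' a da f fx fy h dh ddh \<tau> \<nu> B R
  for c :: real and tr tr' :: "real \<Rightarrow> real"
    and a :: "'n::finite \<Rightarrow> real \<Rightarrow> real^'n \<Rightarrow> real" and da :: "'n \<Rightarrow> 'n \<Rightarrow> real \<Rightarrow> real^'n \<Rightarrow> real"
    and f :: "'n \<Rightarrow> real \<Rightarrow> (real^'n) \<times> (real^'n) \<Rightarrow> real"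
    and fx fy :: "'n \<Rightarrow> 'n \<Rightarrow> real \<Rightarrow> (real^'n) \<times> (real^'n) \<Rightarrow> real"
    and h :: "'n \<Rightarrow> real^'n \<Rightarrow> real" and dh :: "'n \<Rightarrow> 'n \<Rightarrow> real^'n \<Rightarrow> real"
    and ddh :: "'n \<Rightarrow> 'n \<Rightarrow> 'n \<Rightarrow> real^'n \<Rightarrow> real" and \<tau> \<nu> B R :: real +
  fixes K Mu :: real and U :: "'n ix \<times> real \<times> (real^'n) \<Rightarrow> real"
  assumes K: "0 \<le> K" and dh_K: "\<And>k i x. \<bar>dh k i x\<bar> \<le> K"
    and da_K: "\<And>j i t x. t \<in> {0..\<tau>} \<Longrightarrow> \<bar>da j i t x\<bar> \<le> K"
    and fx_K: "\<And>k i t p. t \<in> {0..\<tau>} \<Longrightarrow> \<bar>fx k i t p\<bar> \<le> K"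
    and fy_K: "\<And>k i t p. t \<in> {0..\<tau>} \<Longrightarrow> \<bar>fy k i t p\<bar> \<le> K"
    and R_eq: "R = 2 * (real CARD('n) * K + 1) + 1" and tau_le: "\<tau> \<le> lifespan (real CARD('n)) K"
    and U_c: "\<And>q. cstrip \<tau> (\<lambda>t x. U (q, t, x))"
    and U_le: "\<And>k t x. t \<in> {0..\<tau>} \<Longrightarrow> \<bar>U (I0 k, t, x)\<bar> \<le> Mu"
    and U_pder: "\<And>k i t. t \<in> {0..\<tau>} \<Longrightarrow> pder i (\<lambda>x. U (I0 k, t, x)) (\<lambda>x. U (I1 k i, t, x))"
    and U_pder2: "\<And>k i j t. t \<in> {0..\<tau>} \<Longrightarrow> pder j (\<lambda>x. U (I1 k i, t, x)) (\<lambda>x. U (I2 k i j, t, x))"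
    and U_pde: "\<And>k t x. t \<in> {0..\<tau>} \<Longrightarrow> ((\<lambda>s. \<nu> * (\<Sum>j\<in>UNIV. U (I2 k j j, s, x)) + N0 U k s x)
        has_integral (U (I0 k, t, x) - h k x)) {0..t}"
begin

definition rhs :: "'n \<Rightarrow> real \<Rightarrow> real^'n \<Rightarrow> real" where
  "rhs k t x = \<nu> * (\<Sum>j\<in>UNIV. U (I2 k j j, t, x)) + N0 U k t x"

lemma rhs_cstrip: "cstrip \<tau> (rhs k)"
  using N0_cstrip[OF U_c, of k] U_c unfolding rhs_def cstrip_def by (intro continuous_intros) auto

lemma U_initial: "U (I0 k, 0, x) = h k x"
  using integral_unique[OF U_pde[of 0 k x]] tau by simp

text \<open>The integrated equation has a continuous integrand, so it can be differentiated,
  one-sidedly at the ends of the interval.\<close>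

lemma U_time_derivative:
  assumes t: "t \<in> {0..\<tau>}"
  shows "((\<lambda>s. U (I0 k, s, x)) has_real_derivative rhs k t x) (at t within {0..\<tau>})"
proof -
  have eq: "U (I0 k, s, x) = h k x + integral {0..s} (\<lambda>r. rhs k r x)" if "s \<in> {0..\<tau>}" for s
    using integral_unique[OF U_pde[OF that]] by (simp add: rhs_def)
  have "continuous_on {0..\<tau>} (\<lambda>r. rhs k r x)" by (rule cstrip_comp[OF rhs_cstrip]) auto
  from integral_has_real_derivative[OF this t]
  have "((\<lambda>s. h k x + integral {0..s} (\<lambda>r. rhs k r x)) has_real_derivative rhs k t x) (at t within {0..\<tau>})"
    by (auto intro!: derivative_eq_intros)
  then show ?thesis
    by (rule has_field_derivative_transform_within[where d=1]) (use t eq in auto)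
qed

text \<open>The dimension times \<open>K\<close> is a Lipschitz constant of the initial value. The
  extra 1 keeps \<open>L0\<close> away from 0, so that \<open>L0 * norm (x - y)\<close> bounds the
  distance of relevant points.\<close>

definition L0 :: real where "L0 = real CARD('n) * K + 1"

definition L :: "real \<Rightarrow> real" where "L t = L0 + lip_rate (real CARD('n)) K * t"

lemma card_ge_1: "1 \<le> real CARD('n)" by (simp add: Suc_leI)

lemma L0_ge: "1 \<le> L0" unfolding L0_def using K by simp

text \<open>The lifespan is the time in which the linear function \<open>L\<close> doubles its
  initial value.\<close>

lemma L_bounds: "t \<in> {0..\<tau>} \<Longrightarrow> L0 \<le> L t \<and> L t \<le> 2 * L0"
proof -
  assume t: "t \<in> {0..\<tau>}"
  have r: "0 < lip_rate (real CARD('n)) K" by (rule lip_rate_pos[OF card_ge_1 K])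
  have "lip_rate (real CARD('n)) K * t \<le> lip_rate (real CARD('n)) K * lifespan (real CARD('n)) K"
    using t tau_le r by (intro mult_left_mono) auto
  also have "\<dots> = L0" using r by (simp add: lifespan_def L0_def)
  finally show ?thesis using r t by (simp add: L_def)
qed

lemma h_lip: "\<bar>h k x - h k y\<bar> \<le> (real CARD('n) * K) * norm (x - y)"
proof -
  have "\<bar>h k x - h k y\<bar> \<le> K * (\<Sum>j\<in>UNIV. \<bar>x $ j - y $ j\<bar>)"
    by (rule pder_abs_diff_le[OF h_pder dh_c dh_K])
  also have "\<dots> \<le> K * (real CARD('n) * norm (x - y))"
    using sum_abs_le_card_norm[of "x - y"] K by (intro mult_left_mono) auto
  finally show ?thesis by (simp add: mult_ac)
qed

lemma a_lip: "t \<in> {0..\<tau>} \<Longrightarrow> \<bar>a j t x - a j t y\<bar> \<le> (real CARD('n) * K) * norm (x - y)"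
proof -
  assume t: "t \<in> {0..\<tau>}"
  have "\<bar>a j t x - a j t y\<bar> \<le> K * (\<Sum>j\<in>UNIV. \<bar>x $ j - y $ j\<bar>)"
    by (rule pder_abs_diff_le[OF a_pder[OF t] cstrip_slice[OF da_c t] da_K[OF t]])
  also have "\<dots> \<le> K * (real CARD('n) * norm (x - y))"
    using sum_abs_le_card_norm[of "x - y"] K by (intro mult_left_mono) auto
  finally show ?thesis by (simp add: mult_ac)
qed

lemma f_lip_K:
  assumes t: "t \<in> {0..\<tau>}"
  shows "\<bar>f k t (x, y) - f k t (x', y')\<bar> \<le> (real CARD('n) * K) * norm (x - x') + K * (\<Sum>l\<in>UNIV. \<bar>y $ l - y' $ l\<bar>)"
proof -
  let ?v = "(x - x', y - y')" and ?p = "(x', y')"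
  let ?C = "K * (\<Sum>l\<in>UNIV. \<bar>x $ l - x' $ l\<bar>) + K * (\<Sum>l\<in>UNIV. \<bar>y $ l - y' $ l\<bar>)"
  let ?D = "\<lambda>s. (\<Sum>i\<in>UNIV. (x - x') $ i * fx k i t (?p + s *\<^sub>R ?v)) + (\<Sum>l\<in>UNIV. (y - y') $ l * fy k l t (?p + s *\<^sub>R ?v))"
  have "norm (f k t (?p + 1 *\<^sub>R ?v) - f k t (?p + 0 *\<^sub>R ?v)) \<le> ?C * norm (1 - 0 :: real)"
  proof (rule field_differentiable_bound[where S=UNIV and f="\<lambda>s. f k t (?p + s *\<^sub>R ?v)" and f'="?D"])
    fix s
    have "((\<lambda>s. f k t (?p + s *\<^sub>R ?v)) has_derivative (\<lambda>r. (\<Sum>i\<in>UNIV. fst (r *\<^sub>R ?v) $ i * fx k i t (?p + s *\<^sub>R ?v)) + (\<Sum>l\<in>UNIV. snd (r *\<^sub>R ?v) $ l * fy k l t (?p + s *\<^sub>R ?v)))) (at s)"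
      by (rule has_derivative_compose[where f="\<lambda>s. ?p + s *\<^sub>R ?v", OF _ f_deriv[OF t]]) (auto intro!: derivative_eq_intros)
    then show "((\<lambda>s. f k t (?p + s *\<^sub>R ?v)) has_field_derivative ?D s) (at s within UNIV)"
      unfolding has_field_derivative_def
      by (simp, elim has_derivative_eq_rhs) (simp add: fun_eq_iff distrib_left sum_distrib_left mult_ac)
    have 1: "\<bar>\<Sum>i\<in>UNIV. v $ i * g i\<bar> \<le> K * (\<Sum>l\<in>UNIV. \<bar>v $ l\<bar>)" if "\<And>i. \<bar>g i\<bar> \<le> K" for v :: "real^'n" and g
      unfolding sum_distrib_left
      by (rule order_trans[OF sum_abs sum_mono]) (use that in \<open>auto simp: abs_mult mult.commute intro!: mult_right_mono\<close>)
    show "norm (?D s) \<le> ?C"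
      using 1[of "\<lambda>i. fx k i t (?p + s *\<^sub>R ?v)" "x - x'", OF fx_K[OF t]] 1[of "\<lambda>i. fy k i t (?p + s *\<^sub>R ?v)" "y - y'", OF fy_K[OF t]]
      by simp
  qed auto
  then have "\<bar>f k t (x, y) - f k t (x', y')\<bar> \<le> ?C" by simp
  moreover have "K * (\<Sum>l\<in>UNIV. \<bar>x $ l - x' $ l\<bar>) \<le> K * (real CARD('n) * norm (x - x'))"
    using sum_abs_le_card_norm[of "x - x'"] K by (intro mult_left_mono) auto
  ultimately show ?thesis by (simp add: mult_ac)
qed

text \<open>The terms before the 1 are the zero order coefficient produced by the coupling and the
  transport; the 1 is the surplus that leaves \<open>D\<close> alone on one side in
  \<open>Psi_at_max\<close>.\<close>

definition mrate :: real where "mrate = real CARD('n) * K + 2 * real CARD('n) * L0 + 1"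

definition err :: real where "err = real CARD('n) * (\<nu> + B + Mu)"

text \<open>Doubling of variables. The second order condition is only used along the diagonal directions
  \<open>(x + s e, y + s e)\<close>, where \<open>norm (x - y)\<close> is constant; hence the viscosity does not enter the bound.\<close>

definition Psi :: "real \<Rightarrow> 'n \<Rightarrow> real \<Rightarrow> real^'n \<Rightarrow> real^'n \<Rightarrow> real" where
  "Psi \<epsilon> k t x y = exp (- mrate * t) * (U (I0 k, t, x) - U (I0 k, t, y) - L t * norm (x - y)) - \<epsilon> * psi x"

text \<open>The maximum is taken over all components as well, since the equations are coupled:
  differences of the other components are estimated by comparing them with the maximal one. First
  and second order conditions in space and the sign of the time derivative then leave only terms
  proportional to \<epsilon>.\<close>

lemma Psi_at_max:
  assumes eps: "0 < \<epsilon>" "\<epsilon> * exp (mrate * \<tau>) \<le> 1" and t: "t \<in> {0..\<tau>}"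
    and mx: "\<And>l s x' y'. s \<in> {0..\<tau>} \<Longrightarrow> Psi \<epsilon> l s x' y' \<le> Psi \<epsilon> k t x y" and pos: "0 < Psi \<epsilon> k t x y"
  shows "Psi \<epsilon> k t x y \<le> \<epsilon> * err"
proof -
  let ?n = "real CARD('n)" and ?N = "norm (x - y)"
  define E where "E = exp (mrate * t)"
  define D where "D = U (I0 k, t, x) - U (I0 k, t, y) - L t * ?N"
  have E0: "0 < E" by (simp add: E_def)
  have mr: "0 \<le> mrate" unfolding mrate_def using K L0_ge by simp
  have nu0: "0 < \<nu>" using nu c by (smt (verit) zero_less_power)
  have epsE: "\<epsilon> * E \<le> 1"
  proof -
    have "E \<le> exp (mrate * \<tau>)" unfolding E_def using t mr by (auto intro!: mult_left_mono)
    then have "\<epsilon> * E \<le> \<epsilon> * exp (mrate * \<tau>)" using eps by (intro mult_left_mono) auto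
    then show ?thesis using eps by linarith
  qed
  have emE: "exp (- mrate * t) = 1 / E" by (simp add: E_def exp_minus inverse_eq_divide)
  have psi0: "0 \<le> psi z" for z :: "real^'n" using psi_ge_norm[of z] norm_ge_zero[of z] by linarith
  have PD: "Psi \<epsilon> k t x y = D / E - \<epsilon> * psi x" unfolding Psi_def D_def emE by simp
  have D_ge: "D = E * (Psi \<epsilon> k t x y + \<epsilon> * psi x)" using E0 by (simp add: PD field_simps)
  have Dpos: "0 < D" unfolding D_ge using E0 pos psi0[of x] eps by (intro mult_pos_pos add_pos_nonneg) auto
  have Lt: "L0 \<le> L t" "L t \<le> 2 * L0" using L_bounds[OF t] by auto
  have xy: "x \<noteq> y" using Dpos by (auto simp: D_def)
  then have N0: "0 < ?N" by simp
  \<comment> \<open>At time 0 the Lipschitz bound on the initial value makes \<open>D\<close>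
    nonpositive, so a positive maximum occurs later.\<close>
  have t0: "0 < t"
  proof (rule ccontr)
    assume "\<not> 0 < t"
    then have t': "t = 0" using t by auto
    have "D \<le> (?n * K) * ?N - L0 * ?N"
      using h_lip[of k x y] unfolding D_def t' U_initial L_def by simp
    also have "\<dots> \<le> 0" using N0 by (simp add: L0_def algebra_simps)
    finally show False using Dpos by simp
  qed
  define p where "p j = (x - y) $ j / ?N" for j
  have p1: "\<bar>p j\<bar> \<le> 1" for j using component_le_norm_cart[of "x - y" j] N0 by (simp add: p_def abs_div)
  have gy: "U (I1 k j, t, y) = L t * p j" for j
  proof -
    let ?G = "\<lambda>s. Psi \<epsilon> k t x (y + s *\<^sub>R axis j 1)"
    have nd: "((\<lambda>s. norm (x - (y + s *\<^sub>R axis j 1))) has_real_derivative - p j) (at 0)"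
    proof -
      have "((\<lambda>s. norm ((y - x) + s *\<^sub>R axis j 1)) has_real_derivative (y - x) $ j / norm (y - x)) (at 0)"
        by (rule norm_shift_deriv) (use xy in auto)
      moreover have "norm ((y - x) + s *\<^sub>R axis j 1) = norm (x - (y + s *\<^sub>R axis j 1))" for s
        using norm_minus_commute[of x "y + s *\<^sub>R axis j 1"] by (simp add: algebra_simps)
      moreover have "(y - x) $ j / norm (y - x) = - p j"
        by (simp add: p_def norm_minus_commute diff_divide_distrib)
      ultimately show ?thesis by simp
    qed
    have ud: "((\<lambda>s. U (I0 k, t, y + s *\<^sub>R axis j 1)) has_real_derivative U (I1 k j, t, y)) (at 0)"
      using U_pder[OF t, of j k] by (simp add: pder_def)
    have "(?G has_real_derivative exp (- mrate * t) * (0 - U (I1 k j, t, y) - L t * (- p j)) - 0) (at 0)"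
      unfolding Psi_def by (intro DERIV_diff DERIV_cmult DERIV_const nd ud)
    from DERIV_local_max[OF this, of 1] mx[OF t, of k x] have "exp (- mrate * t) * (0 - U (I1 k j, t, y) - L t * (- p j)) - 0 = 0"
      by simp
    then show ?thesis by simp
  qed
  define r where "r j = x $ j / psi1 (x $ j)" for j
  have r1: "\<bar>r j\<bar> \<le> 1" for j unfolding r_def by (rule psi1_deriv_abs)
  \<comment> \<open>Compared with the gradient at \<open>y\<close> there is one more term, because
    the penalisation acts on \<open>x\<close> only.\<close>
  have gx: "U (I1 k j, t, x) = L t * p j + \<epsilon> * E * r j" for j
  proof -
    let ?G = "\<lambda>s. Psi \<epsilon> k t (x + s *\<^sub>R axis j 1) y"
    have nd: "((\<lambda>s. norm (x + s *\<^sub>R axis j 1 - y)) has_real_derivative p j) (at 0)"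
    proof -
      have "((\<lambda>s. norm ((x - y) + s *\<^sub>R axis j 1)) has_real_derivative p j) (at 0)"
        unfolding p_def by (rule norm_shift_deriv) (use xy in auto)
      then show ?thesis by (simp add: algebra_simps)
    qed
    have ud: "((\<lambda>s. U (I0 k, t, x + s *\<^sub>R axis j 1)) has_real_derivative U (I1 k j, t, x)) (at 0)"
      using U_pder[OF t, of j k] by (simp add: pder_def)
    have pd: "((\<lambda>s. psi (x + s *\<^sub>R axis j 1)) has_real_derivative r j) (at 0)"
      using psi_shift_deriv[of x j 0] by (simp add: r_def)
    have "(?G has_real_derivative exp (- mrate * t) * (U (I1 k j, t, x) - 0 - L t * p j) - \<epsilon> * r j) (at 0)"
      unfolding Psi_def by (intro DERIV_diff DERIV_cmult DERIV_const nd ud pd)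
    from DERIV_local_max[OF this, of 1] mx[OF t, of k _ y] have "exp (- mrate * t) * (U (I1 k j, t, x) - 0 - L t * p j) - \<epsilon> * r j = 0"
      by simp
    then show ?thesis using E0 unfolding emE by (simp add: field_simps)
  qed
  \<comment> \<open>Along the diagonal direction the only contribution apart from \<open>U\<close>
    is the second derivative of the penalisation.\<close>
  have gxx: "U (I2 k j j, t, x) - U (I2 k j j, t, y) \<le> \<epsilon> * E" for j
  proof -
    let ?e = "axis j 1 :: real^'n"
    let ?q = "(psi1 (x $ j) - x $ j * (x $ j / psi1 (x $ j))) / (psi1 (x $ j) * psi1 (x $ j))"
    have "exp (- mrate * t) * (U (I2 k j j, t, x) - U (I2 k j j, t, y) - 0) - \<epsilon> * ?q \<le> 0"
    proof (rule second_derivative_nonpos_at_max[where G="\<lambda>s. Psi \<epsilon> k t (x + s *\<^sub>R ?e) (y + s *\<^sub>R ?e)"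
          and G'="\<lambda>s. exp (- mrate * t) * (U (I1 k j, t, x + s *\<^sub>R ?e) - U (I1 k j, t, y + s *\<^sub>R ?e) - 0) - \<epsilon> * ((x $ j + s) / psi1 (x $ j + s))"])
      show "((\<lambda>s. Psi \<epsilon> k t (x + s *\<^sub>R ?e) (y + s *\<^sub>R ?e)) has_real_derivative
         exp (- mrate * t) * (U (I1 k j, t, x + s *\<^sub>R ?e) - U (I1 k j, t, y + s *\<^sub>R ?e) - 0) - \<epsilon> * ((x $ j + s) / psi1 (x $ j + s))) (at s)" for s
        unfolding Psi_def add_diff_add diff_self add_0_right
        by (intro DERIV_diff DERIV_cmult DERIV_const psi_shift_deriv pder_line[OF U_pder[OF t]])
      have "((\<lambda>s. (x $ j + s) / psi1 (x $ j + s)) has_real_derivative ?q * 1) (at 0)"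
        by (rule DERIV_chain2[where f="\<lambda>r. r / psi1 r"]) (use psi1_deriv2[of "x $ j"] in \<open>auto intro!: derivative_eq_intros\<close>)
      then have q: "((\<lambda>s. (x $ j + s) / psi1 (x $ j + s)) has_real_derivative ?q) (at 0)" by simp
      have u2: "((\<lambda>s. U (I1 k j, t, z + s *\<^sub>R ?e)) has_real_derivative U (I2 k j j, t, z)) (at 0)" for z
        using U_pder2[OF t, of j k j] by (simp add: pder_def)
      show "((\<lambda>s. exp (- mrate * t) * (U (I1 k j, t, x + s *\<^sub>R ?e) - U (I1 k j, t, y + s *\<^sub>R ?e) - 0) - \<epsilon> * ((x $ j + s) / psi1 (x $ j + s)))
         has_real_derivative exp (- mrate * t) * (U (I2 k j j, t, x) - U (I2 k j j, t, y) - 0) - \<epsilon> * ?q) (at 0)"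
        by (intro DERIV_diff DERIV_cmult DERIV_const q u2)
      show "Psi \<epsilon> k t (x + s *\<^sub>R ?e) (y + s *\<^sub>R ?e) \<le> Psi \<epsilon> k t (x + 0 *\<^sub>R ?e) (y + 0 *\<^sub>R ?e)" for s
        using mx[OF t] by simp
    qed
    then have "U (I2 k j j, t, x) - U (I2 k j j, t, y) \<le> \<epsilon> * E * ?q"
      using E0 unfolding emE by (simp add: pos_divide_le_eq mult_ac)
    also have "\<dots> \<le> \<epsilon> * E * 1" using eps E0 by (intro mult_left_mono psi1_deriv2_le) auto
    finally show ?thesis by simp
  qed
  \<comment> \<open>The damping factor contributes \<open>mrate * D\<close> and the growth of
    \<open>L\<close> contributes the term in \<open>norm (x - y)\<close>; both are chosen to
    dominate the right hand side.\<close>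
  have time: "mrate * D + lip_rate ?n K * ?N \<le> rhs k t x - rhs k t y"
  proof -
    have dE: "((\<lambda>s. exp (- mrate * s)) has_real_derivative exp (- mrate * t) * - mrate) (at t within {0..\<tau>})"
      by (auto intro!: derivative_eq_intros)
    have dL: "((\<lambda>s. L s * ?N) has_real_derivative lip_rate ?n K * ?N) (at t within {0..\<tau>})"
      unfolding L_def by (auto intro!: derivative_eq_intros)
    let ?l = "exp (- mrate * t) * - mrate * D + (rhs k t x - rhs k t y - lip_rate ?n K * ?N) * exp (- mrate * t) - 0"
    have "((\<lambda>s. Psi \<epsilon> k s x y) has_real_derivative ?l) (at t within {0..\<tau>})"
      unfolding Psi_def D_def by (intro DERIV_diff DERIV_mult DERIV_const dE dL U_time_derivative[OF t])
    then have "0 \<le> ?l"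
      by (rule derivative_nonneg_at_left_max) (use t t0 mx in auto)
    then have "0 \<le> exp (- mrate * t) * (rhs k t x - rhs k t y - lip_rate ?n K * ?N - mrate * D)" by (simp add: algebra_simps)
    then show ?thesis by (simp add: zero_le_mult_iff)
  qed
  \<comment> \<open>\<open>Z\<close> bounds the difference of every component between
    \<open>x\<close> and \<open>y\<close>, in both directions. The reverse direction compares with
    the swapped pair \<open>(y, x)\<close>, and the resulting difference of penalisations is at most
    the dimension times \<open>norm (x - y)\<close>.\<close>
  define Z where "Z = (2 * L0 + ?n) * ?N + D"
  have ud: "\<bar>U (I0 l, t, x) - U (I0 l, t, y)\<bar> \<le> Z" for l
  proof -
    have aux: "A \<le> D + \<epsilon> * E * (q' - q)" if "A / E - \<epsilon> * q' \<le> D / E - \<epsilon> * q" for A q q'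
      using mult_left_mono[OF that, of E] E0 by (simp add: right_diff_distrib mult_ac)
    have P: "U (I0 l, t, x') - U (I0 l, t, y') - L t * norm (x' - y') \<le> D + \<epsilon> * E * (psi x' - psi x)" for x' y'
    proof -
      have "(U (I0 l, t, x') - U (I0 l, t, y') - L t * norm (x' - y')) / E - \<epsilon> * psi x' \<le> D / E - \<epsilon> * psi x"
        using mx[OF t, of l x' y'] unfolding PD unfolding Psi_def emE by simp
      then show ?thesis by (rule aux)
    qed
    have "\<epsilon> * E * (psi y - psi x) \<le> 1 * (?n * ?N)"
    proof -
      have "psi y - psi x \<le> ?n * ?N" using psi_lipschitz[of y x] by (simp add: norm_minus_commute)
      then have "\<epsilon> * E * (psi y - psi x) \<le> \<epsilon> * E * (?n * ?N)" using eps E0 by (intro mult_left_mono) auto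
      also have "\<dots> \<le> 1 * (?n * ?N)" using epsE by (intro mult_right_mono) auto
      finally show ?thesis .
    qed
    moreover have "L t * ?N \<le> 2 * L0 * ?N" using Lt by (intro mult_right_mono) auto
    moreover have "0 \<le> ?n * ?N" by simp
    moreover have "U (I0 l, t, x) - U (I0 l, t, y) - L t * ?N \<le> D" using P[of x y] by simp
    moreover have "U (I0 l, t, y) - U (I0 l, t, x) - L t * ?N \<le> D + \<epsilon> * E * (psi y - psi x)"
      using P[of y x] by (simp add: norm_minus_commute)
    ultimately show ?thesis unfolding Z_def distrib_right by linarith
  qed
  have Z0: "0 \<le> Z" using ud[of k] by linarith
  \<comment> \<open>At the maximum the gradients are known explicitly: at most \<open>2 * L0\<close>
    from the distance term and at most 1 from the penalisation, so the truncation level is not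
    exceeded.\<close>
  have tri: "tr (U (I1 k j, t, y)) = L t * p j" "tr (U (I1 k j, t, x)) = L t * p j + \<epsilon> * E * r j" for j
  proof -
    have Lp: "\<bar>L t * p j\<bar> \<le> 2 * L0" unfolding abs_mult using Lt L0_ge p1[of j] mult_mono[of "\<bar>L t\<bar>" "2 * L0" "\<bar>p j\<bar>" 1] by auto
    have er: "\<bar>\<epsilon> * E * r j\<bar> \<le> 1" unfolding abs_mult[of "\<epsilon> * E"] using epsE eps E0 r1[of j] mult_mono[of "\<bar>\<epsilon> * E\<bar>" 1 "\<bar>r j\<bar>" 1] by auto
    have RR: "R = 2 * L0 + 1" using R_eq by (simp add: L0_def)
    show "tr (U (I1 k j, t, y)) = L t * p j" unfolding gy by (rule tr_id) (use Lp RR in linarith)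
    show "tr (U (I1 k j, t, x)) = L t * p j + \<epsilon> * E * r j" unfolding gx by (rule tr_id) (use Lp er RR in linarith)
  qed
  let ?b = "\<lambda>j z. a j t z + U (I0 j, t, z)"
  have F: "f k t (x, uvec U t x) - f k t (y, uvec U t y) \<le> ?n * K * ?N + K * (?n * Z)"
  proof -
    have "(\<Sum>l\<in>UNIV. \<bar>uvec U t x $ l - uvec U t y $ l\<bar>) \<le> ?n * Z"
      using sum_bounded_above[of UNIV "\<lambda>l. \<bar>uvec U t x $ l - uvec U t y $ l\<bar>" Z] ud by (simp add: uvec_def)
    then have "K * (\<Sum>l\<in>UNIV. \<bar>uvec U t x $ l - uvec U t y $ l\<bar>) \<le> K * (?n * Z)" using K by (intro mult_left_mono) auto
    then show ?thesis using f_lip_K[OF t, of k x "uvec U t x" y "uvec U t y"] by linarith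
  qed
  have T: "- (?b j x * (L t * p j + \<epsilon> * E * r j) - ?b j y * (L t * p j)) \<le> (?n * K * ?N + Z) * (2 * L0) + (B + Mu) * (\<epsilon> * E)" for j
  proof -
    have "- (?b j x * (L t * p j + \<epsilon> * E * r j) - ?b j y * (L t * p j)) = - ((?b j x - ?b j y) * (L t * p j)) - ?b j x * (\<epsilon> * E * r j)"
      by (simp add: algebra_simps)
    also have "\<dots> \<le> \<bar>?b j x - ?b j y\<bar> * \<bar>L t * p j\<bar> + \<bar>?b j x\<bar> * \<bar>\<epsilon> * E * r j\<bar>"
      unfolding abs_mult[symmetric] by linarith
    also have "\<dots> \<le> (?n * K * ?N + Z) * (2 * L0) + (B + Mu) * (\<epsilon> * E)"
    proof (intro add_mono mult_mono)
      show "\<bar>?b j x - ?b j y\<bar> \<le> ?n * K * ?N + Z" using a_lip[OF t, of j x y] ud[of j] by linarith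
      show "\<bar>L t * p j\<bar> \<le> 2 * L0" unfolding abs_mult using Lt L0_ge p1[of j] mult_mono[of "\<bar>L t\<bar>" "2 * L0" "\<bar>p j\<bar>" 1] by auto
      show "\<bar>?b j x\<bar> \<le> B + Mu" using a_le[OF t, of j x] U_le[OF t, of j x] by linarith
      then show "0 \<le> B + Mu" by linarith
      have "\<bar>\<epsilon> * E * r j\<bar> = \<epsilon> * E * \<bar>r j\<bar>" using eps E0 by (simp add: abs_mult)
      also have "\<dots> \<le> \<epsilon> * E * 1" using eps E0 r1[of j] by (intro mult_left_mono) auto
      finally show "\<bar>\<epsilon> * E * r j\<bar> \<le> \<epsilon> * E" by simp
    qed (use Z0 K in auto)
    finally show ?thesis .
  qed
  have "rhs k t x - rhs k t y = \<nu> * (\<Sum>j\<in>UNIV. U (I2 k j j, t, x) - U (I2 k j j, t, y)) + (f k t (x, uvec U t x) - f k t (y, uvec U t y))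
     + (\<Sum>j\<in>UNIV. - (?b j x * (L t * p j + \<epsilon> * E * r j) - ?b j y * (L t * p j)))"
    unfolding rhs_def N0_def tri by (simp add: sum_subtractf sum_negf algebra_simps)
  also have "\<dots> \<le> \<nu> * (?n * (\<epsilon> * E)) + (?n * K * ?N + K * (?n * Z)) + ?n * ((?n * K * ?N + Z) * (2 * L0) + (B + Mu) * (\<epsilon> * E))"
  proof (intro add_mono mult_left_mono F)
    show "(\<Sum>j\<in>UNIV. U (I2 k j j, t, x) - U (I2 k j j, t, y)) \<le> ?n * (\<epsilon> * E)"
      using sum_bounded_above[of UNIV "\<lambda>j. U (I2 k j j, t, x) - U (I2 k j j, t, y)" "\<epsilon> * E"] gxx by simp
    show "(\<Sum>j\<in>UNIV. - (?b j x * (L t * p j + \<epsilon> * E * r j) - ?b j y * (L t * p j))) \<le> ?n * ((?n * K * ?N + Z) * (2 * L0) + (B + Mu) * (\<epsilon> * E))"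
      using sum_bounded_above[of UNIV "\<lambda>j. - (?b j x * (L t * p j + \<epsilon> * E * r j) - ?b j y * (L t * p j))"] T by auto
  qed (use nu0 in auto)
  \<comment> \<open>Expanding \<open>Z\<close>, the coefficient of \<open>norm (x - y)\<close> is
    exactly \<open>lip_rate\<close>, that of \<open>D\<close> is \<open>mrate - 1\<close>, and the
    rest is the \<epsilon>-error.\<close>
  also have "\<dots> = lip_rate ?n K * ?N + (mrate - 1) * D + err * (\<epsilon> * E)"
    unfolding lip_rate_def mrate_def err_def Z_def L0_def by (simp add: algebra_simps)
  finally have "D \<le> err * (\<epsilon> * E)" using time by (simp add: algebra_simps)
  then have "D / E \<le> err * \<epsilon>" using E0 by (simp add: field_simps)
  then show ?thesis unfolding PD using psi0[of x] eps by (simp add: mult.commute add_increasing2 diff_le_eq)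
qed

text \<open>Outside a compact set the functional is nonpositive, so either it is nonpositive
  everywhere or a positive maximum is attained and the previous estimate applies.\<close>

lemma Psi_le:
  assumes eps: "0 < \<epsilon>" "\<epsilon> * exp (mrate * \<tau>) \<le> 1" and t: "t \<in> {0..\<tau>}"
  shows "Psi \<epsilon> k t x y \<le> \<epsilon> * err"
proof -
  have mr: "0 \<le> mrate" unfolding mrate_def using K L0_ge by simp
  have nu0: "0 < \<nu>" using nu c by (smt (verit) zero_less_power)
  have Mu0: "0 \<le> Mu" using U_le[OF t, of undefined 0] by linarith
  have err0: "0 \<le> \<epsilon> * err" unfolding err_def using eps nu0 Mu0 B_nonneg by simp
  have psi0: "0 \<le> psi z" for z :: "real^'n" using psi_ge_norm[of z] norm_ge_zero[of z] by linarith
  \<comment> \<open>Differences of \<open>U\<close> never exceed \<open>2 * Mu\<close>. Beyond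
    \<open>r1\<close> the penalisation outweighs this, and when \<open>norm (x - y)\<close> exceeds
    \<open>r2\<close> the term \<open>L0 * norm (x - y)\<close> does.\<close>
  define r1 where "r1 = 2 * Mu / \<epsilon>"
  define r2 where "r2 = 2 * Mu / L0"
  have r: "0 \<le> r1" "0 \<le> r2" using Mu0 eps L0_ge by (auto simp: r1_def r2_def)
  define C where "C = {0..\<tau>} \<times> (cball (0::real^'n) r1 \<times> cball (0::real^'n) (r1 + r2))"
  define P where "P l w = Psi \<epsilon> l (fst w) (fst (snd w)) (snd (snd w))" for l w
  have out: "Psi \<epsilon> l s x' y' \<le> 0" if s: "s \<in> {0..\<tau>}" and nC: "(s, x', y') \<notin> C" for l s x' y'
  proof -
    let ?D = "U (I0 l, s, x') - U (I0 l, s, y') - L s * norm (x' - y')"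
    have ex: "0 < exp (- mrate * s)" "exp (- mrate * s) \<le> 1" using mr s by auto
    have Ls: "L0 \<le> L s" using L_bounds[OF s] by auto
    have Dle: "?D \<le> 2 * Mu - L0 * norm (x' - y')"
      using U_le[OF s, of l x'] U_le[OF s, of l y'] mult_right_mono[OF Ls, of "norm (x' - y')"] by auto
    show ?thesis
    proof (cases "norm x' \<le> r1")
      case True
      then have "r1 + r2 < norm y'" using nC s by (auto simp: C_def)
      then have "r2 \<le> norm (x' - y')" using True norm_triangle_ineq2[of y' x'] by (simp add: norm_minus_commute)
      then have "2 * Mu \<le> L0 * norm (x' - y')" using L0_ge by (simp add: r2_def pos_divide_le_eq mult.commute)
      then have "?D \<le> 0" using Dle by linarith
      then have "exp (- mrate * s) * ?D \<le> 0" using ex by (intro mult_nonneg_nonpos) auto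
      then show ?thesis unfolding Psi_def using mult_nonneg_nonneg[of \<epsilon> "psi x'"] eps psi0[of x'] by linarith
    next
      case False
      have "0 \<le> L0 * norm (x' - y')" using L0_ge by simp
      then have "?D \<le> 2 * Mu" using Dle by linarith
      then have "exp (- mrate * s) * ?D \<le> exp (- mrate * s) * (2 * Mu)" using ex by (intro mult_left_mono) auto
      also have "\<dots> \<le> 1 * (2 * Mu)" using ex Mu0 by (intro mult_right_mono) auto
      finally have 1: "exp (- mrate * s) * ?D \<le> 2 * Mu" by simp
      have "2 * Mu \<le> \<epsilon> * norm x'" using False eps by (simp add: r1_def pos_less_divide_eq not_le pos_divide_less_eq mult.commute)
      also have "\<dots> \<le> \<epsilon> * psi x'" using eps psi_ge_norm by (intro mult_left_mono) auto
      finally show ?thesis unfolding Psi_def using 1 by linarith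
    qed
  qed
  have cC: "compact C" unfolding C_def by (intro compact_Times compact_Icc compact_cball)
  have neC: "C \<noteq> {}" using tau r by (auto simp: C_def)
  have cP: "continuous_on C (P l)" for l
  proof -
    have m: "fst w \<in> {0..\<tau>}" if "w \<in> C" for w using that by (auto simp: C_def)
    show ?thesis unfolding P_def Psi_def L_def
      by (intro continuous_intros cstrip_comp[OF U_c] continuous_on_compose2[OF psi_continuous, of C _ UNIV] subset_UNIV m)
  qed
  have "\<exists>w\<in>C. \<forall>v\<in>C. P l v \<le> P l w" for l
    by (rule continuous_attains_sup[OF cC neC cP])
  then obtain w where w: "\<And>l. w l \<in> C" "\<And>l v. v \<in> C \<Longrightarrow> P l v \<le> P l (w l)" by metis
  \<comment> \<open>Each component attains its maximum on the compact set; among the finitely many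
    components the largest maximum is selected.\<close>
  have "Max (range (\<lambda>l. P l (w l))) \<in> range (\<lambda>l. P l (w l))" by (rule Max_in) auto
  then obtain l0 where "Max (range (\<lambda>l. P l (w l))) = P l0 (w l0)" by (rule imageE)
  then have l0: "P l0 (w l0) = Max (range (\<lambda>l. P l (w l)))" by (rule sym)
  have l0_max: "P l (w l) \<le> P l0 (w l0)" for l unfolding l0 by (rule Max_ge) auto
  have inC: "Psi \<epsilon> l s x' y' \<le> P l0 (w l0)" if "(s, x', y') \<in> C" for l s x' y'
    using w(2)[OF that, of l] l0_max[of l] by (simp add: P_def)
  show ?thesis
  proof (cases "0 < P l0 (w l0)")
    case False
    then have "Psi \<epsilon> k t x y \<le> 0" using inC[of t x y k] out[OF t, of x y k] by (cases "(t, x, y) \<in> C") auto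
    then show ?thesis using err0 by linarith
  next
    case True
    obtain t' x' y' where wl: "w l0 = (t', x', y')" by (cases "w l0") auto
    have t': "t' \<in> {0..\<tau>}" using w(1)[of l0] by (auto simp: wl C_def)
    have mx: "Psi \<epsilon> l s z z' \<le> Psi \<epsilon> l0 t' x' y'" if "s \<in> {0..\<tau>}" for l s z z'
    proof (cases "(s, z, z') \<in> C")
      case True
      from inC[OF this, of l] show ?thesis unfolding wl P_def by simp
    next
      case False
      from out[OF that this, of l] \<open>0 < P l0 (w l0)\<close> show ?thesis unfolding wl P_def by simp
    qed
    have "Psi \<epsilon> l0 t' x' y' \<le> \<epsilon> * err"
      by (rule Psi_at_max[OF eps t' mx]) (use True in \<open>auto simp: wl P_def\<close>)
    then show ?thesis using mx[OF t, of k x y] by linarith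
  qed
qed

text \<open>The points and the time are fixed while \<epsilon> is sent to 0, which removes
  \<open>err\<close> and with it the viscosity and the sup norms.\<close>

lemma solution_lipschitz:
  assumes t: "t \<in> {0..\<tau>}"
  shows "U (I0 k, t, x) - U (I0 k, t, y) \<le> L t * norm (x - y)"
proof (rule ccontr)
  assume "\<not> ?thesis"
  then have d: "0 < exp (- mrate * t) * (U (I0 k, t, x) - U (I0 k, t, y) - L t * norm (x - y))" (is "0 < ?d") by simp
  have nu0: "0 < \<nu>" using nu c by (smt (verit) zero_less_power)
  have Mu0: "0 \<le> Mu" using U_le[OF t, of undefined 0] by linarith
  have e0: "0 \<le> err" unfolding err_def using nu0 Mu0 B_nonneg by simp
  have p0: "0 \<le> psi x" using psi_ge_norm[of x] norm_ge_zero[of x] by linarith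
  define q where "q = err + psi x + 1"
  have q: "0 < q" using e0 p0 by (simp add: q_def)
  \<comment> \<open>The first bound meets the requirement of \<open>Psi_le\<close>; the second makes
    the whole error smaller than the assumed excess \<open>?d\<close>, the 1 in \<open>q\<close>
    giving strictness.\<close>
  define \<epsilon> where "\<epsilon> = min (exp (- (mrate * \<tau>))) (?d / q)"
  have eps: "0 < \<epsilon>" using d q by (simp add: \<epsilon>_def)
  have "\<epsilon> * exp (mrate * \<tau>) \<le> exp (- (mrate * \<tau>)) * exp (mrate * \<tau>)" by (intro mult_right_mono) (auto simp: \<epsilon>_def)
  then have eps1: "\<epsilon> * exp (mrate * \<tau>) \<le> 1" by (simp add: exp_add[symmetric])
  have "?d \<le> \<epsilon> * err + \<epsilon> * psi x" using Psi_le[OF eps eps1 t, of k x y] by (simp only: Psi_def)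
  also have "\<dots> < \<epsilon> * q" using eps by (simp add: q_def distrib_left)
  also have "\<dots> \<le> (?d / q) * q" using q by (intro mult_right_mono) (auto simp: \<epsilon>_def)
  also have "\<dots> = ?d" using q by simp
  finally show False by simp
qed

lemma gradient_bound:
  assumes t: "t \<in> {0..\<tau>}"
  shows "\<bar>U (I1 k i, t, x)\<bar> \<le> R"
proof -
  have "\<bar>U (I1 k i, t, x)\<bar> \<le> L t"
  proof (rule abs_derivative_le_lipschitz)
    show "((\<lambda>s. U (I0 k, t, x + s *\<^sub>R axis i 1)) has_real_derivative U (I1 k i, t, x)) (at 0)"
      using U_pder[OF t, of i k] by (simp add: pder_def)
    fix s :: real
    show "\<bar>U (I0 k, t, x + s *\<^sub>R axis i 1) - U (I0 k, t, x + 0 *\<^sub>R axis i 1)\<bar> \<le> L t * \<bar>s\<bar>"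
      using solution_lipschitz[OF t, of k "x + s *\<^sub>R axis i 1" x] solution_lipschitz[OF t, of k x "x + s *\<^sub>R axis i 1"]
      by (simp add: abs_le_iff)
  qed
  then show ?thesis using L_bounds[OF t] L0_ge R_eq by (simp add: L0_def)
qed

lemma truncation_inactive:
  assumes "t \<in> {0..\<tau>}"
  shows "N0 U k t x = f k t (x, uvec U t x) - (\<Sum>j\<in>UNIV. (a j t x + U (I0 j, t, x)) * U (I1 k j, t, x))"
  unfolding N0_def using tr_id[OF gradient_bound[OF assms]] by simp

end

section \<open>Random data\<close>

lemma pd_has_vector_derivative:
  assumes "pd_exists S g d z" "{s. z + s *\<^sub>R d \<in> S} = UNIV"
  shows "((\<lambda>s. g (z + s *\<^sub>R d)) has_vector_derivative pd S g d z) (at 0)"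
  using assms unfolding pd_exists_def pd_def by (simp add: vector_derivative_works)

lemma pd_component:
  fixes g :: "'v::real_normed_vector \<Rightarrow> real^'n::finite"
  assumes "pd_exists S g d z" "{s. z + s *\<^sub>R d \<in> S} = UNIV"
  shows "((\<lambda>s. g (z + s *\<^sub>R d) $ k) has_real_derivative pd S g d z $ k) (at 0)"
  using bounded_linear.has_vector_derivative[OF bounded_linear_vec_nth pd_has_vector_derivative[OF assms], of k]
  by (simp add: has_real_derivative_iff_has_vector_derivative)

lemma has_vector_derivative_vec_lambda:
  fixes g :: "'n::finite \<Rightarrow> real \<Rightarrow> real"
  assumes "\<And>k. (g k has_real_derivative d k) (at x within S)"
  shows "((\<lambda>s. \<chi> k. g k s) has_vector_derivative (\<chi> k. d k)) (at x within S)"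
proof -
  have "((\<lambda>s. \<chi> k. g k s) has_derivative (\<lambda>r. \<chi> k. d k * r)) (at x within S)"
    by (rule has_derivative_vec_lambda) (use assms in \<open>simp add: has_field_derivative_def\<close>)
  then show ?thesis unfolding has_vector_derivative_def
    by (rule has_derivative_eq_rhs) (simp add: fun_eq_iff vec_eq_iff mult.commute)
qed

lemma pd_eqI:
  fixes g :: "'v::real_normed_vector \<Rightarrow> real^'n::finite"
  assumes "\<And>k. ((\<lambda>s. g (z + s *\<^sub>R d) $ k) has_real_derivative D k) (at 0)" "{s. z + s *\<^sub>R d \<in> S} = UNIV"
  shows "pd_exists S g d z" "pd S g d z = (\<chi> k. D k)"
proof -
  have "((\<lambda>s. \<chi> k. g (z + s *\<^sub>R d) $ k) has_vector_derivative (\<chi> k. D k)) (at 0)"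
    by (rule has_vector_derivative_vec_lambda) (rule assms(1))
  then have v: "((\<lambda>s. g (z + s *\<^sub>R d)) has_vector_derivative (\<chi> k. D k)) (at 0)" by simp
  show "pd_exists S g d z" unfolding pd_exists_def assms(2) using v by (auto intro: differentiableI_vector)
  show "pd S g d z = (\<chi> k. D k)" unfolding pd_def assms(2) using v by (rule vector_derivative_at)
qed

lemma Cb2D:
  assumes "Cb S D 2 g" "d \<in> D" "d' \<in> D"
  shows "continuous_on S g" "continuous_on S (pd S g d)" "continuous_on S (pd S (pd S g d) d')"
    "z \<in> S \<Longrightarrow> pd_exists S g d z" "z \<in> S \<Longrightarrow> pd_exists S (pd S g d) d' z"
  using assms by (auto simp: numeral_2_eq_2)

lemma Cb_bound2D:
  assumes "Cb_bound S D 2 g B" "d \<in> D" "d' \<in> D" "z \<in> S"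
  shows "norm (g z) \<le> B" "norm (pd S g d z) \<le> B" "norm (pd S (pd S g d) d' z) \<le> B"
  using assms by (auto simp: numeral_2_eq_2)

text \<open>A derivative is a pointwise limit of difference quotients along a fixed null sequence,
  so spatial derivatives of the data inherit adaptedness.\<close>

lemma measurable_derivative_param:
  fixes G :: "'w \<Rightarrow> real \<Rightarrow> real"
  assumes "\<And>s. (\<lambda>w. G w s) \<in> borel_measurable N"
    and d: "\<And>w. w \<in> space N \<Longrightarrow> (G w has_real_derivative D w) (at 0)"
  shows "D \<in> borel_measurable N"
proof (rule borel_measurable_LIMSEQ_real)
  show "(\<lambda>m. (G w (1 / Suc m) - G w 0) / (1 / Suc m)) \<longlonglongrightarrow> D w" if "w \<in> space N" for w
  proof -
    have "(\<lambda>m. 1 / real (Suc m)) \<longlonglongrightarrow> 0" by (rule LIMSEQ_Suc, rule lim_1_over_n)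
    then show ?thesis using d[OF that] unfolding has_field_derivative_iff tendsto_at_iff_sequentially comp_def
      by (auto dest!: spec[where x="\<lambda>m. 1 / real (Suc m)"])
  qed
  show "(\<lambda>w. (G w (1 / Suc m) - G w 0) / (1 / Suc m)) \<in> borel_measurable N" for m
    using assms(1) by (intro borel_measurable_divide borel_measurable_diff) auto
qed

lemma component_le_gnorm:
  fixes g :: "'v::real_normed_vector \<Rightarrow> real^'m::finite" and e :: "'n::finite \<Rightarrow> 'v"
  shows "\<bar>pd S g (e i) z $ k\<bar> \<le> gnorm S g e z"
proof -
  have "\<bar>pd S g (e i) z $ k\<bar> \<le> norm (pd S g (e i) z)" by (rule component_le_norm_cart)
  also have "\<dots> = sqrt ((norm (pd S g (e i) z))\<^sup>2)" by simp
  also have "\<dots> \<le> gnorm S g e z" unfolding gnorm_def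
    by (intro real_sqrt_le_mono member_le_sum) auto
  finally show ?thesis .
qed

lemma gnorm_nonneg: "0 \<le> gnorm S g e z"
  unfolding gnorm_def by (intro real_sqrt_ge_zero sum_nonneg) auto

text \<open>Gives the boundedness without which the real suprema in \<open>Kconst\<close> would
  carry no information.\<close>

lemma gnorm_le:
  fixes e :: "'n::finite \<Rightarrow> 'v::real_normed_vector"
  assumes "\<And>i. norm (pd S g (e i) z) \<le> B"
  shows "gnorm S g e z \<le> sqrt (real CARD('n) * B\<^sup>2)"
proof -
  have "(\<Sum>i\<in>UNIV. (norm (pd S g (e i) z))\<^sup>2) \<le> real CARD('n) * B\<^sup>2"
    using sum_bounded_above[of UNIV "\<lambda>i. (norm (pd S g (e i) z))\<^sup>2" "B\<^sup>2"] power_mono[OF assms norm_ge_zero] by simp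
  then show ?thesis unfolding gnorm_def by (rule real_sqrt_le_mono)
qed

lemma sum_Basis_prod_vec:
  "(\<Sum>b\<in>Basis. F b) = (\<Sum>i\<in>UNIV. F (axis i 1 :: real^'n::finite, 0 :: real^'n)) + (\<Sum>l\<in>UNIV. F (0, axis l 1))"
proof -
  let ?A = "(\<lambda>u. (u, 0)) ` (Basis :: (real^'n) set)" and ?B = "(\<lambda>u. (0, u)) ` (Basis :: (real^'n) set)"
  have "(\<Sum>b\<in>Basis. F b) = (\<Sum>b\<in>?A. F b) + (\<Sum>b\<in>?B. F b)"
    unfolding Basis_prod_def by (rule sum.union_disjoint) (auto simp: nonzero_Basis)
  also have "(\<Sum>b\<in>?A. F b) = (\<Sum>b\<in>(Basis :: (real^'n) set). F (b, 0))"
    by (subst sum.reindex) (auto simp: inj_on_def)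
  also have "(\<Sum>b\<in>?B. F b) = (\<Sum>b\<in>(Basis :: (real^'n) set). F (0, b))"
    by (subst sum.reindex) (auto simp: inj_on_def)
  finally show ?thesis by (simp add: sum_Basis_vec)
qed

text \<open>Turns the vector valued random data into the scalar component functions of the
  deterministic theory, one \<omega> at a time.\<close>

locale stochastic_setting =
  fixes M :: "'w measure" and Fl :: "real \<Rightarrow> 'w measure" and T \<nu> :: real
    and \<eta> :: "real \<Rightarrow> real^'n::finite \<Rightarrow> 'w \<Rightarrow> real^'n"
    and F :: "real \<Rightarrow> real^'n \<Rightarrow> real^'n \<Rightarrow> 'w \<Rightarrow> real^'n"
    and h :: "real^'n \<Rightarrow> 'w \<Rightarrow> real^'n" and \<Omega>0 :: "'w set"
  assumes set: "setting M Fl T \<nu> \<eta> F h \<Omega>0"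
begin

abbreviation "SX \<equiv> {0..T} \<times> (UNIV :: (real^'n) set)"
abbreviation "SF \<equiv> {0..T} \<times> (UNIV :: ((real^'n) \<times> (real^'n)) set)"

definition "etac w j t x = \<eta> t x w $ j"
definition "detac w j i t x = pd SX (eta_u \<eta> w) (eeta i) (t, x) $ j"
definition "Fc w k t p = F t (fst p) (snd p) w $ k"
definition "Fxc w k i t p = pd SF (F_u F w) (eFx i) (t, p) $ k"
definition "Fyc w k l t p = pd SF (F_u F w) (eFy l) (t, p) $ k"
definition "hc w k x = h x w $ k"
definition "dhc w k i x = pd UNIV (\<lambda>x. h x w) (eh i) x $ k"
definition "ddhc w k i j x = pd UNIV (pd UNIV (\<lambda>x. h x w) (eh i)) (eh j) x $ k"

lemma T_pos: "0 < T" and nu_pos: "0 < \<nu>" and prob: "prob_space M" and filt: "filtration_on M T Fl"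
  and \<Omega>_sets: "\<Omega>0 \<in> sets M" and \<Omega>_sub: "\<Omega>0 \<subseteq> space M" and \<Omega>_full: "emeasure M \<Omega>0 = emeasure M (space M)"
  and eta_m: "t \<in> {0..T} \<Longrightarrow> (\<lambda>w. \<eta> t x w) \<in> borel_measurable (Fl t)"
  and F_m: "t \<in> {0..T} \<Longrightarrow> (\<lambda>w. F t x y w) \<in> borel_measurable (Fl t)"
  and h_m: "(\<lambda>w. h x w) \<in> borel_measurable (Fl 0)"
  using set unfolding setting_def by blast+

lemma Cb_data:
  assumes "w \<in> \<Omega>0"
  shows "Cb SX (range eeta) 2 (eta_u \<eta> w)" "Cb SF (range eFx \<union> range eFy) 2 (F_u F w)" "Cb UNIV (range eh) 2 (\<lambda>x. h x w)"
  using set assms unfolding setting_def by blast+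

lemma bound_data:
  obtains B where "0 \<le> B" "\<And>w. w \<in> \<Omega>0 \<Longrightarrow> Cb_bound SX (range eeta) 2 (eta_u \<eta> w) B"
    "\<And>w. w \<in> \<Omega>0 \<Longrightarrow> Cb_bound SF (range eFx \<union> range eFy) 2 (F_u F w) B"
    "\<And>w. w \<in> \<Omega>0 \<Longrightarrow> Cb_bound UNIV (range eh) 2 (\<lambda>x. h x w) B"
proof -
  obtain B where B: "\<forall>w\<in>\<Omega>0. Cb_bound SX (range eeta) 2 (eta_u \<eta> w) B \<and> Cb_bound SF (range eFx \<union> range eFy) 2 (F_u F w) B \<and>
      Cb_bound UNIV (range eh) 2 (\<lambda>x. h x w) B"
    using set unfolding setting_def by blast
  interpret prob_space M by (rule prob)
  \<comment> \<open>A set of full measure in a probability space is nonempty; a sample point is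
    needed to see that \<open>B\<close> is nonnegative.\<close>
  have "\<Omega>0 \<noteq> {}" using \<Omega>_full emeasure_space_1 by auto
  then obtain w where w: "w \<in> \<Omega>0" by blast
  have "norm (h 0 w) \<le> B" using Cb_bound2D(1)[of UNIV "range eh" "\<lambda>x. h x w" B "eh undefined" "eh undefined" 0] B w by auto
  then have "0 \<le> B" using norm_ge_zero order_trans by blast
  then show thesis using B by (intro that) blast+
qed

lemma line_SX: "t \<in> {0..T} \<Longrightarrow> {s. (t, x) + s *\<^sub>R eeta i \<in> SX} = UNIV"
  and line_SFx: "t \<in> {0..T} \<Longrightarrow> {s. (t, p) + s *\<^sub>R eFx i \<in> SF} = UNIV"
  and line_SFy: "t \<in> {0..T} \<Longrightarrow> {s. (t, p) + s *\<^sub>R eFy i \<in> SF} = UNIV"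
  by (auto simp: eeta_def eFx_def eFy_def)

context
  fixes w assumes w: "w \<in> \<Omega>0"
begin

lemma etac_pder: "t \<in> {0..T} \<Longrightarrow> pder i (etac w j t) (detac w j i t)"
  unfolding pder_def
proof
  fix x assume t: "t \<in> {0..T}"
  have "((\<lambda>s. eta_u \<eta> w ((t, x) + s *\<^sub>R eeta i) $ j) has_real_derivative detac w j i t x) (at 0)"
    unfolding detac_def by (rule pd_component[OF Cb2D(4)[OF Cb_data(1)[OF w]] line_SX]) (use t in auto)
  then show "((\<lambda>s. etac w j t (x + s *\<^sub>R axis i 1)) has_real_derivative detac w j i t x) (at 0)"
    by (simp add: etac_def eta_u_def eeta_def)
qed

lemma Fc_partials:
  assumes t: "t \<in> {0..T}"
  shows "((\<lambda>s. Fc w k t (p + s *\<^sub>R (axis i 1, 0))) has_real_derivative Fxc w k i t p) (at 0)"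
    and "((\<lambda>s. Fc w k t (p + s *\<^sub>R (0, axis i 1))) has_real_derivative Fyc w k i t p) (at 0)"
proof -
  have "((\<lambda>s. F_u F w ((t, p) + s *\<^sub>R eFx i) $ k) has_real_derivative Fxc w k i t p) (at 0)"
    unfolding Fxc_def by (rule pd_component[OF Cb2D(4)[OF Cb_data(2)[OF w]] line_SFx]) (use t in auto)
  then show "((\<lambda>s. Fc w k t (p + s *\<^sub>R (axis i 1, 0))) has_real_derivative Fxc w k i t p) (at 0)"
    by (simp add: Fc_def F_u_def eFx_def)
  have "((\<lambda>s. F_u F w ((t, p) + s *\<^sub>R eFy i) $ k) has_real_derivative Fyc w k i t p) (at 0)"
    unfolding Fyc_def by (rule pd_component[OF Cb2D(4)[OF Cb_data(2)[OF w]] line_SFy]) (use t in auto)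
  then show "((\<lambda>s. Fc w k t (p + s *\<^sub>R (0, axis i 1))) has_real_derivative Fyc w k i t p) (at 0)"
    by (simp add: Fc_def F_u_def eFy_def)
qed

lemma cstrip_data:
  assumes \<tau>: "\<tau> \<le> T"
  shows "cstrip \<tau> (etac w j)" "cstrip \<tau> (detac w j i)" "cstrip \<tau> (Fc w k)" "cstrip \<tau> (Fxc w k i)" "cstrip \<tau> (Fyc w k i)"
proof -
  have sub: "{0..\<tau>} \<times> UNIV \<subseteq> {0..T} \<times> UNIV" using \<tau> by auto
  have c: "continuous_on ({0..\<tau>} \<times> UNIV) (\<lambda>q. G q $ k)" if "continuous_on ({0..T} \<times> UNIV) G"
    for G :: "real \<times> 'c::topological_space \<Rightarrow> real^'n" and k
    by (intro continuous_intros continuous_on_subset[OF that sub])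
  show "cstrip \<tau> (etac w j)" using c[OF Cb2D(1)[OF Cb_data(1)[OF w] rangeI rangeI], of j]
    by (simp add: cstrip_def etac_def eta_u_def)
  show "cstrip \<tau> (detac w j i)" using c[OF Cb2D(2)[OF Cb_data(1)[OF w] rangeI rangeI], of i j]
    by (simp add: cstrip_def detac_def)
  show "cstrip \<tau> (Fc w k)" using c[OF Cb2D(1)[OF Cb_data(2)[OF w] UnI1[OF rangeI] UnI1[OF rangeI]], of k]
    by (simp add: cstrip_def Fc_def F_u_def)
  show "cstrip \<tau> (Fxc w k i)" using c[OF Cb2D(2)[OF Cb_data(2)[OF w] UnI1[OF rangeI] UnI1[OF rangeI]], of i k]
    by (simp add: cstrip_def Fxc_def)
  show "cstrip \<tau> (Fyc w k i)" using c[OF Cb2D(2)[OF Cb_data(2)[OF w] UnI2[OF rangeI] UnI1[OF rangeI]], of i k]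
    by (simp add: cstrip_def Fyc_def)
qed

lemma Fc_total_derivative:
  assumes t: "t \<in> {0..T}"
  shows "(Fc w k t has_derivative (\<lambda>v. (\<Sum>i\<in>UNIV. fst v $ i * Fxc w k i t p) + (\<Sum>l\<in>UNIV. snd v $ l * Fyc w k l t p))) (at p)"
proof -
  define D where "D b z = pd SF (F_u F w) (0, b) (t, z) $ k" for b z
  have Dx: "D (axis i 1, 0) z = Fxc w k i t z" and Dy: "D (0, axis i 1) z = Fyc w k i t z" for i z
    by (simp_all add: D_def Fxc_def Fyc_def eFx_def eFy_def)
  have cases: "(\<exists>i. b = (axis i 1, 0)) \<or> (\<exists>i. b = (0, axis i 1))" if "b \<in> Basis" for b :: "(real^'n) \<times> (real^'n)"
    using that by (auto simp: Basis_prod_def Basis_vec_def)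
  have "(Fc w k t has_derivative (\<lambda>v. \<Sum>b\<in>Basis. (v \<bullet> b) * D b p)) (at p)"
  proof (rule has_derivative_from_partials)
    fix b z :: "(real^'n) \<times> (real^'n)" assume "b \<in> Basis"
    from cases[OF this] show "((\<lambda>s. Fc w k t (z + s *\<^sub>R b)) has_real_derivative D b z) (at 0)"
      by (elim disjE exE) (simp_all only: Dx Dy Fc_partials[OF t])
  next
    fix b :: "(real^'n) \<times> (real^'n)" assume "b \<in> Basis"
    then show "continuous_on UNIV (D b)"
      using cases[of b] cstrip_slice[OF cstrip_data(4)[OF order_refl] t] cstrip_slice[OF cstrip_data(5)[OF order_refl] t]
      by (auto simp: Dx[abs_def] Dy[abs_def])
  qed
  then show ?thesis
    by (rule has_derivative_eq_rhs) (auto simp: sum_Basis_prod_vec Dx Dy inner_prod_def inner_axis fun_eq_iff)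
qed

text \<open>The second derivatives of \<open>F\<close> act as Lipschitz constants of its first
  derivatives in the variable receiving the unknown; leaving the direction \<open>d\<close> open
  covers both \<open>Fxc\<close> and \<open>Fyc\<close>.\<close>

lemma dF_lip:
  assumes t: "t \<in> {0..T}" and B: "Cb_bound SF (range eFx \<union> range eFy) 2 (F_u F w) B" and d: "d \<in> range eFx \<union> range eFy"
  shows "\<bar>pd SF (F_u F w) d (t, (x, y)) $ k - pd SF (F_u F w) d (t, (x, y')) $ k\<bar> \<le> B * (\<Sum>l\<in>UNIV. \<bar>y $ l - y' $ l\<bar>)"
proof (rule pder_abs_diff_le[where g="\<lambda>y. pd SF (F_u F w) d (t, (x, y)) $ k"
      and D="\<lambda>l y. pd SF (pd SF (F_u F w) d) (eFy l) (t, (x, y)) $ k"])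
  fix l
  show "pder l (\<lambda>y. pd SF (F_u F w) d (t, (x, y)) $ k) (\<lambda>y. pd SF (pd SF (F_u F w) d) (eFy l) (t, (x, y)) $ k)"
    unfolding pder_def
  proof
    fix y
    have "((\<lambda>s. pd SF (F_u F w) d ((t, (x, y)) + s *\<^sub>R eFy l) $ k) has_real_derivative pd SF (pd SF (F_u F w) d) (eFy l) (t, (x, y)) $ k) (at 0)"
      by (rule pd_component[OF Cb2D(5)[OF Cb_data(2)[OF w] d] line_SFy]) (use t in auto)
    then show "((\<lambda>s. pd SF (F_u F w) d (t, (x, y + s *\<^sub>R axis l 1)) $ k) has_real_derivative pd SF (pd SF (F_u F w) d) (eFy l) (t, (x, y)) $ k) (at 0)"
      by (simp add: eFy_def)
  qed
  show "continuous_on UNIV (\<lambda>y. pd SF (pd SF (F_u F w) d) (eFy l) (t, (x, y)) $ k)"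
    by (intro continuous_intros continuous_on_compose2[OF Cb2D(3)[OF Cb_data(2)[OF w] d UnI2[OF rangeI]], of UNIV "\<lambda>y. (t, (x, y))"])
      (use t in auto)
  show "\<bar>pd SF (pd SF (F_u F w) d) (eFy l) (t, (x, z)) $ k\<bar> \<le> B" for z
    by (rule order_trans[OF component_le_norm_cart Cb_bound2D(3)[OF B d]]) (use t in auto)
qed

lemma Fc_lip:
  assumes t: "t \<in> {0..T}" and B: "Cb_bound SF (range eFx \<union> range eFy) 2 (F_u F w) B"
  shows "\<bar>Fc w k t (x, y) - Fc w k t (x, y')\<bar> \<le> B * (\<Sum>l\<in>UNIV. \<bar>y $ l - y' $ l\<bar>)"
proof (rule pder_abs_diff_le[where g="\<lambda>y. Fc w k t (x, y)" and D="\<lambda>l y. Fyc w k l t (x, y)"])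
  fix l
  show "pder l (\<lambda>y. Fc w k t (x, y)) (\<lambda>y. Fyc w k l t (x, y))"
    unfolding pder_def using Fc_partials(2)[OF t, of k "(x, _)" l] by simp
  show "continuous_on UNIV (\<lambda>y. Fyc w k l t (x, y))"
    by (rule continuous_on_compose2[OF cstrip_slice[OF cstrip_data(5)[OF order_refl] t]]) (auto intro!: continuous_intros)
  show "\<bar>Fyc w k l t (x, z)\<bar> \<le> B" for z
    unfolding Fyc_def by (rule order_trans[OF component_le_norm_cart Cb_bound2D(2)[OF B UnI2[OF rangeI] UnI2[OF rangeI]]]) (use t in auto)
qed

lemma hc_pder: "pder i (hc w k) (dhc w k i)" "pder j (dhc w k i) (ddhc w k i j)"
proof -
  have "((\<lambda>s. h (x + s *\<^sub>R eh i) w $ k) has_real_derivative dhc w k i x) (at 0)" for x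
    unfolding dhc_def by (rule pd_component[OF Cb2D(4)[OF Cb_data(3)[OF w]]]) auto
  then show "pder i (hc w k) (dhc w k i)" by (simp add: pder_def hc_def eh_def)
  have "((\<lambda>s. pd UNIV (\<lambda>x. h x w) (eh i) (x + s *\<^sub>R eh j) $ k) has_real_derivative ddhc w k i j x) (at 0)" for x
    unfolding ddhc_def by (rule pd_component[OF Cb2D(5)[OF Cb_data(3)[OF w]]]) auto
  then show "pder j (dhc w k i) (ddhc w k i j)" by (simp add: pder_def dhc_def eh_def)
qed

lemma hc_cont: "continuous_on UNIV (hc w k)" "continuous_on UNIV (dhc w k i)" "continuous_on UNIV (ddhc w k i j)"
  unfolding hc_def dhc_def ddhc_def
  by (intro continuous_intros Cb2D[OF Cb_data(3)[OF w] rangeI rangeI])+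

lemma burgers_data:
  assumes tau: "0 < \<tau>" "\<tau> \<le> T" and R: "0 \<le> R"
    and tr: "\<And>r. (tr has_real_derivative tr' r) (at r)" "\<And>r. \<bar>tr' r\<bar> \<le> 1" "\<And>r s. \<bar>tr' r - tr' s\<bar> \<le> \<bar>r - s\<bar>"
      "\<And>r. \<bar>tr r\<bar> \<le> R + 1" "\<And>r. \<bar>r\<bar> \<le> R \<Longrightarrow> tr r = r"
    and B: "Cb_bound SX (range eeta) 2 (eta_u \<eta> w) B"
      "Cb_bound SF (range eFx \<union> range eFy) 2 (F_u F w) B" "Cb_bound UNIV (range eh) 2 (\<lambda>x. h x w) B"
  shows "burgers (sqrt (2 * \<nu>)) tr tr' (etac w) (detac w) (Fc w) (Fxc w) (Fyc w) (hc w) (dhc w) (ddhc w) \<tau> \<nu> B R"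
proof (unfold_locales)
  have T: "t \<in> {0..T}" if "t \<in> {0..\<tau>}" for t using that tau by auto
  fix i j k l :: 'n and t and x y y' :: "real^'n" and p :: "(real^'n) \<times> (real^'n)"
  show "\<bar>hc w k x\<bar> \<le> B" "\<bar>dhc w k i x\<bar> \<le> B" "\<bar>ddhc w k i j x\<bar> \<le> B"
    unfolding hc_def dhc_def ddhc_def
    by (rule order_trans[OF component_le_norm_cart Cb_bound2D(1)[OF B(3) rangeI rangeI]], simp)
      (rule order_trans[OF component_le_norm_cart Cb_bound2D(2)[OF B(3) rangeI rangeI]], simp,
       rule order_trans[OF component_le_norm_cart Cb_bound2D(3)[OF B(3) rangeI rangeI]], simp)
  assume t: "t \<in> {0..\<tau>}"
  note t' = T[OF t]
  show "\<bar>etac w j t x\<bar> \<le> B"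
    using order_trans[OF component_le_norm_cart Cb_bound2D(1)[OF B(1) rangeI rangeI, of "(t, x)"], of j] t'
    by (simp add: etac_def eta_u_def)
  show "\<bar>detac w j i t x\<bar> \<le> B"
    unfolding detac_def by (rule order_trans[OF component_le_norm_cart Cb_bound2D(2)[OF B(1) rangeI rangeI]]) (use t' in auto)
  show "\<bar>Fc w k t p\<bar> \<le> B"
    using order_trans[OF component_le_norm_cart Cb_bound2D(1)[OF B(2) UnI1[OF rangeI] UnI1[OF rangeI], of "(t, p)"], of k] t'
    by (simp add: Fc_def F_u_def)
  show "\<bar>Fxc w k i t p\<bar> \<le> B"
    unfolding Fxc_def by (rule order_trans[OF component_le_norm_cart Cb_bound2D(2)[OF B(2) UnI1[OF rangeI] UnI1[OF rangeI]]]) (use t' in auto)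
  show "\<bar>Fyc w k i t p\<bar> \<le> B"
    unfolding Fyc_def by (rule order_trans[OF component_le_norm_cart Cb_bound2D(2)[OF B(2) UnI2[OF rangeI] UnI1[OF rangeI]]]) (use t' in auto)
  show "pder i (etac w j t) (detac w j i t)" by (rule etac_pder[OF t'])
  show "(Fc w k t has_derivative (\<lambda>v. (\<Sum>i\<in>UNIV. fst v $ i * Fxc w k i t p) + (\<Sum>l\<in>UNIV. snd v $ l * Fyc w k l t p))) (at p)"
    by (rule Fc_total_derivative[OF t'])
  show "\<bar>Fxc w k i t (x, y) - Fxc w k i t (x, y')\<bar> \<le> B * (\<Sum>l\<in>UNIV. \<bar>y $ l - y' $ l\<bar>)"
    unfolding Fxc_def by (rule dF_lip[OF t' B(2) UnI1[OF rangeI]])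
  show "\<bar>Fyc w k i t (x, y) - Fyc w k i t (x, y')\<bar> \<le> B * (\<Sum>l\<in>UNIV. \<bar>y $ l - y' $ l\<bar>)"
    unfolding Fyc_def by (rule dF_lip[OF t' B(2) UnI2[OF rangeI]])
  show "\<bar>Fc w k t (x, y) - Fc w k t (x, y')\<bar> \<le> B * (\<Sum>l\<in>UNIV. \<bar>y $ l - y' $ l\<bar>)"
    by (rule Fc_lip[OF t' B(2)])
qed (use tau R tr nu_pos cstrip_data[OF tau(2)] hc_pder hc_cont in auto)

end

text \<open>Each supremum is over a nonempty bounded set of nonnegative numbers, so every summand of
  \<open>Kconst\<close> is nonnegative and lies below the total.\<close>

lemma K_bounds:
  defines "K \<equiv> Kconst T \<eta> F h \<Omega>0"
  shows "0 \<le> K"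
    and "w \<in> \<Omega>0 \<Longrightarrow> \<bar>dhc w k i x\<bar> \<le> K"
    and "w \<in> \<Omega>0 \<Longrightarrow> t \<in> {0..T} \<Longrightarrow> \<bar>detac w j i t x\<bar> \<le> K"
    and "w \<in> \<Omega>0 \<Longrightarrow> t \<in> {0..T} \<Longrightarrow> \<bar>Fxc w k i t p\<bar> \<le> K"
    and "w \<in> \<Omega>0 \<Longrightarrow> t \<in> {0..T} \<Longrightarrow> \<bar>Fyc w k i t p\<bar> \<le> K"
proof -
  obtain B where B: "0 \<le> B" "\<And>w. w \<in> \<Omega>0 \<Longrightarrow> Cb_bound SX (range eeta) 2 (eta_u \<eta> w) B"
    "\<And>w. w \<in> \<Omega>0 \<Longrightarrow> Cb_bound SF (range eFx \<union> range eFy) 2 (F_u F w) B"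
    "\<And>w. w \<in> \<Omega>0 \<Longrightarrow> Cb_bound UNIV (range eh) 2 (\<lambda>x. h x w) B" by (rule bound_data) blast
  let ?C = "sqrt (real CARD('n) * B\<^sup>2)"
  let ?g1 = "\<lambda>p. gnorm UNIV (\<lambda>x. h x (fst p)) eh (snd p)" and ?S1 = "\<Omega>0 \<times> UNIV"
  let ?g2 = "\<lambda>p. gnorm SX (eta_u \<eta> (fst p)) eeta (snd p)" and ?S2 = "\<Omega>0 \<times> SX"
  let ?g3x = "\<lambda>p. gnorm SF (F_u F (fst p)) eFx (snd p)" and ?g3y = "\<lambda>p. gnorm SF (F_u F (fst p)) eFy (snd p)" and ?S3 = "\<Omega>0 \<times> SF"
  have b1: "bdd_above (?g1 ` ?S1)"
    by (rule bdd_aboveI2[of _ _ ?C], rule gnorm_le) (auto intro!: Cb_bound2D(2)[OF B(4) rangeI rangeI])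
  have b2: "bdd_above (?g2 ` ?S2)"
    by (rule bdd_aboveI2[of _ _ ?C], rule gnorm_le) (auto intro!: Cb_bound2D(2)[OF B(2) rangeI rangeI])
  have b3: "bdd_above ((\<lambda>p. ?g3x p + ?g3y p) ` ?S3)"
  proof (rule bdd_aboveI2[of _ _ "?C + ?C"], rule add_mono)
    fix p assume p: "p \<in> ?S3"
    show "?g3x p \<le> ?C" by (rule gnorm_le) (use p in \<open>auto intro!: Cb_bound2D(2)[OF B(3) UnI1[OF rangeI] UnI1[OF rangeI]]\<close>)
    show "?g3y p \<le> ?C" by (rule gnorm_le) (use p in \<open>auto intro!: Cb_bound2D(2)[OF B(3) UnI2[OF rangeI] UnI1[OF rangeI]]\<close>)
  qed
  interpret prob_space M by (rule prob)
  have "\<Omega>0 \<noteq> {}" using \<Omega>_full emeasure_space_1 by auto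
  then obtain w0 where w0: "w0 \<in> \<Omega>0" by blast
  have 1: "?g1 p \<le> (SUP p\<in>?S1. ?g1 p)" if "p \<in> ?S1" for p using cSUP_upper[OF that b1] .
  have 2: "?g2 p \<le> (SUP p\<in>?S2. ?g2 p)" if "p \<in> ?S2" for p using cSUP_upper[OF that b2] .
  have 3: "?g3x p + ?g3y p \<le> (SUP p\<in>?S3. ?g3x p + ?g3y p)" if "p \<in> ?S3" for p using cSUP_upper[OF that b3] .
  have p1: "0 \<le> (SUP p\<in>?S1. ?g1 p)" using order_trans[OF gnorm_nonneg 1[of "(w0, 0)"]] w0 by auto
  have p2: "0 \<le> (SUP p\<in>?S2. ?g2 p)" using order_trans[OF gnorm_nonneg 2[of "(w0, (0, 0))"]] w0 T_pos by auto
  have p3: "0 \<le> (SUP p\<in>?S3. ?g3x p + ?g3y p)"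
    using order_trans[OF add_nonneg_nonneg[OF gnorm_nonneg gnorm_nonneg] 3[of "(w0, (0, 0))"]] w0 T_pos by auto
  have K: "K = (SUP p\<in>?S1. ?g1 p) + (SUP p\<in>?S2. ?g2 p) + (SUP p\<in>?S3. ?g3x p + ?g3y p)"
    unfolding K_def Kconst_def ..
  show "0 \<le> K" using p1 p2 p3 unfolding K by linarith
  show "\<bar>dhc w k i x\<bar> \<le> K" if "w \<in> \<Omega>0"
    using order_trans[OF component_le_gnorm 1[of "(w, x)"], of i k] that p2 p3 unfolding K dhc_def by simp
  show "\<bar>detac w j i t x\<bar> \<le> K" if "w \<in> \<Omega>0" "t \<in> {0..T}"
    using order_trans[OF component_le_gnorm 2[of "(w, (t, x))"], of i j] that p1 p3 unfolding K detac_def by simp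
  show "\<bar>Fxc w k i t p\<bar> \<le> K" if "w \<in> \<Omega>0" "t \<in> {0..T}"
    using component_le_gnorm[of SF "F_u F w" eFx i "(t, p)" k] 3[of "(w, (t, p))"] gnorm_nonneg[of SF "F_u F w" eFy "(t, p)"]
      that p1 p2 unfolding K Fxc_def by simp
  show "\<bar>Fyc w k i t p\<bar> \<le> K" if "w \<in> \<Omega>0" "t \<in> {0..T}"
    using component_le_gnorm[of SF "F_u F w" eFy i "(t, p)" k] 3[of "(w, (t, p))"] gnorm_nonneg[of SF "F_u F w" eFx "(t, p)"]
      that p1 p2 unfolding K Fyc_def by simp
qed

section \<open>Measurability for the trace of the filtration\<close>

lemma space_N: "t \<in> {0..T} \<Longrightarrow> space (restrict_space (Fl t) \<Omega>0) = \<Omega>0"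
  using filt \<Omega>_sub unfolding filtration_on_def subalgebra_def by (auto simp: space_restrict_space)

lemma measurable_N_mono:
  assumes "s \<in> {0..t}" "t \<in> {0..T}" "g \<in> borel_measurable (restrict_space (Fl s) \<Omega>0)"
  shows "g \<in> borel_measurable (restrict_space (Fl t) \<Omega>0)"
proof (rule borel_measurable_subalgebra[OF _ _ assms(3)])
  have "sets (Fl s) \<subseteq> sets (Fl t)" using filt assms(1,2) unfolding filtration_on_def by auto
  then show "sets (restrict_space (Fl s) \<Omega>0) \<subseteq> sets (restrict_space (Fl t) \<Omega>0)" by (auto simp: sets_restrict_space)
  show "space (restrict_space (Fl s) \<Omega>0) = space (restrict_space (Fl t) \<Omega>0)" using space_N[of s] space_N[of t] assms by auto
qed

lemma component_measurable:
  fixes g :: "'w \<Rightarrow> real^'n"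
  assumes "g \<in> borel_measurable N"
  shows "(\<lambda>w. g w $ k) \<in> borel_measurable (restrict_space N \<Omega>0)"
  by (rule measurable_compose[OF measurable_restrict_space1[OF assms] borel_measurable_continuous_onI])
    (intro continuous_intros)

text \<open>Differentiability is guaranteed on \<open>\<Omega>0\<close> only, so derivatives are
  measurable for the traces of the \<sigma>-algebras on this set.\<close>

lemma data_measurable:
  shows "t \<in> {0..T} \<Longrightarrow> (\<lambda>w. etac w j t x) \<in> borel_measurable (restrict_space (Fl t) \<Omega>0)"
    and "t \<in> {0..T} \<Longrightarrow> (\<lambda>w. detac w j i t x) \<in> borel_measurable (restrict_space (Fl t) \<Omega>0)"
    and "t \<in> {0..T} \<Longrightarrow> (\<lambda>w. Fc w k t p) \<in> borel_measurable (restrict_space (Fl t) \<Omega>0)"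
    and "t \<in> {0..T} \<Longrightarrow> (\<lambda>w. Fxc w k i t p) \<in> borel_measurable (restrict_space (Fl t) \<Omega>0)"
    and "t \<in> {0..T} \<Longrightarrow> (\<lambda>w. Fyc w k i t p) \<in> borel_measurable (restrict_space (Fl t) \<Omega>0)"
    and "(\<lambda>w. hc w k x) \<in> borel_measurable (restrict_space (Fl 0) \<Omega>0)"
    and "(\<lambda>w. dhc w k i x) \<in> borel_measurable (restrict_space (Fl 0) \<Omega>0)"
    and "(\<lambda>w. ddhc w k i j x) \<in> borel_measurable (restrict_space (Fl 0) \<Omega>0)"
proof -
  show e: "(\<lambda>w. etac w j t x) \<in> borel_measurable (restrict_space (Fl t) \<Omega>0)" if "t \<in> {0..T}" for t j x
    unfolding etac_def by (rule component_measurable[OF eta_m[OF that]])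
  show "(\<lambda>w. detac w j i t x) \<in> borel_measurable (restrict_space (Fl t) \<Omega>0)" if t: "t \<in> {0..T}"
    by (rule measurable_derivative_param[where G="\<lambda>w s. etac w j t (x + s *\<^sub>R axis i 1)", OF e[OF t]])
      (use etac_pder[OF _ t] space_N[OF t] in \<open>auto simp: pder_def\<close>)
  show F: "(\<lambda>w. Fc w k t p) \<in> borel_measurable (restrict_space (Fl t) \<Omega>0)" if "t \<in> {0..T}" for t k p
    unfolding Fc_def by (rule component_measurable[OF F_m[OF that]])
  show "(\<lambda>w. Fxc w k i t p) \<in> borel_measurable (restrict_space (Fl t) \<Omega>0)" if t: "t \<in> {0..T}"
  proof (rule measurable_derivative_param[where G="\<lambda>w s. Fc w k t (p + s *\<^sub>R (axis i 1, 0))", OF F[OF t]])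
    show "((\<lambda>s. Fc w k t (p + s *\<^sub>R (axis i 1, 0))) has_real_derivative Fxc w k i t p) (at 0)"
      if "w \<in> space (restrict_space (Fl t) \<Omega>0)" for w
      by (rule Fc_partials(1)[OF _ t]) (use that space_N[OF t] in simp)
  qed
  show "(\<lambda>w. Fyc w k i t p) \<in> borel_measurable (restrict_space (Fl t) \<Omega>0)" if t: "t \<in> {0..T}"
  proof (rule measurable_derivative_param[where G="\<lambda>w s. Fc w k t (p + s *\<^sub>R (0, axis i 1))", OF F[OF t]])
    show "((\<lambda>s. Fc w k t (p + s *\<^sub>R (0, axis i 1))) has_real_derivative Fyc w k i t p) (at 0)"
      if "w \<in> space (restrict_space (Fl t) \<Omega>0)" for w
      by (rule Fc_partials(2)[OF _ t]) (use that space_N[OF t] in simp)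
  qed
  have 0: "0 \<in> {0..T}" using T_pos by simp
  show H: "(\<lambda>w. hc w k x) \<in> borel_measurable (restrict_space (Fl 0) \<Omega>0)" for k x
    unfolding hc_def by (rule component_measurable[OF h_m])
  show DH: "(\<lambda>w. dhc w k i x) \<in> borel_measurable (restrict_space (Fl 0) \<Omega>0)" for k i x
    by (rule measurable_derivative_param[where G="\<lambda>w s. hc w k (x + s *\<^sub>R axis i 1)", OF H])
      (use hc_pder(1) space_N[OF 0] in \<open>auto simp: pder_def\<close>)
  show "(\<lambda>w. ddhc w k i j x) \<in> borel_measurable (restrict_space (Fl 0) \<Omega>0)"
    by (rule measurable_derivative_param[where G="\<lambda>w s. dhc w k i (x + s *\<^sub>R axis j 1)", OF DH])
      (use hc_pder(2) space_N[OF 0] in \<open>auto simp: pder_def\<close>)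
qed

end

section \<open>Time reversal\<close>

lemma has_integral_vec:
  fixes f :: "real \<Rightarrow> real^'n::finite"
  assumes "\<And>k. ((\<lambda>s. f s $ k) has_integral I $ k) A"
  shows "(f has_integral I) A"
  by (subst has_integral_componentwise_iff) (use assms in \<open>auto simp: Basis_vec_def inner_axis\<close>)

lemma bounded_vec_components:
  fixes g :: "'a \<Rightarrow> real^'n::finite"
  assumes "\<And>z k. z \<in> S \<Longrightarrow> \<bar>g z $ k\<bar> \<le> C"
  shows "bounded (g ` S)"
proof (rule boundedI)
  fix v assume "v \<in> g ` S"
  then obtain z where z: "z \<in> S" "v = g z" by auto
  have "norm v \<le> (\<Sum>k\<in>UNIV. \<bar>v $ k\<bar>)" by (rule norm_le_l1_cart)
  also have "\<dots> \<le> real CARD('n) * C" using sum_bounded_above[of UNIV "\<lambda>k. \<bar>v $ k\<bar>" C] assms z by simp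
  finally show "norm v \<le> real CARD('n) * C" .
qed

context burgers_solution
begin

text \<open>\<open>Y\<close> is prescribed on the time strip only: the adapted version of the
  solution arises from measurable extensions and has no meaning at other times.\<close>

context
  fixes T :: real and Y :: "real \<times> (real^'n) \<Rightarrow> real^'n" and C :: real
  assumes Y: "\<And>t x k. t \<in> {T - \<tau>..T} \<Longrightarrow> Y (t, x) $ k = U (I0 k, T - t, x)"
    and C: "\<And>q t x. t \<in> {0..\<tau>} \<Longrightarrow> \<bar>U (q, t, x)\<bar> \<le> C"
begin

abbreviation "S \<equiv> {T - \<tau>..T} \<times> (UNIV :: (real^'n) set)"

lemma rev_mem: "t \<in> {T - \<tau>..T} \<Longrightarrow> T - t \<in> {0..\<tau>}" by auto

lemma line_S: "t \<in> {T - \<tau>..T} \<Longrightarrow> {s. (t, x) + s *\<^sub>R eeta i \<in> S} = UNIV"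
  by (auto simp: eeta_def)

lemma pd_Y:
  assumes t: "t \<in> {T - \<tau>..T}"
  shows "pd_exists S Y (eeta i) (t, x)" "pd S Y (eeta i) (t, x) = (\<chi> k. U (I1 k i, T - t, x))"
proof -
  have "((\<lambda>s. Y ((t, x) + s *\<^sub>R eeta i) $ k) has_real_derivative U (I1 k i, T - t, x)) (at 0)" for k
    using U_pder[OF rev_mem[OF t], of i k] by (simp add: eeta_def Y[OF t] pder_def)
  from pd_eqI[OF this line_S[OF t]] show "pd_exists S Y (eeta i) (t, x)" "pd S Y (eeta i) (t, x) = (\<chi> k. U (I1 k i, T - t, x))" .
qed

lemma pd_pd_Y:
  assumes t: "t \<in> {T - \<tau>..T}"
  shows "pd_exists S (pd S Y (eeta i)) (eeta j) (t, x)" "pd S (pd S Y (eeta i)) (eeta j) (t, x) = (\<chi> k. U (I2 k i j, T - t, x))"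
proof -
  have "((\<lambda>s. pd S Y (eeta i) ((t, x) + s *\<^sub>R eeta j) $ k) has_real_derivative U (I2 k i j, T - t, x)) (at 0)" for k
    using U_pder2[OF rev_mem[OF t], of j k i] by (simp add: eeta_def[of j] pd_Y(2)[OF t] pder_def)
  from pd_eqI[OF this line_S[OF t]] show "pd_exists S (pd S Y (eeta i)) (eeta j) (t, x)"
    "pd S (pd S Y (eeta i)) (eeta j) (t, x) = (\<chi> k. U (I2 k i j, T - t, x))" .
qed

lemma Cb0_reversed:
  fixes G :: "real \<times> (real^'n) \<Rightarrow> real^'n"
  assumes G: "\<And>t x k. t \<in> {T - \<tau>..T} \<Longrightarrow> G (t, x) $ k = g k (T - t) x" and g: "\<And>k. cstrip \<tau> (g k)"
    and b: "\<And>k t x. t \<in> {0..\<tau>} \<Longrightarrow> \<bar>g k t x\<bar> \<le> C'"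
  shows "continuous_on S G" "bounded (G ` S)"
proof -
  have "continuous_on S (\<lambda>z. \<chi> k. g k (T - fst z) (snd z))"
    by (intro continuous_on_vec_lambda cstrip_comp[OF g] continuous_intros) auto
  moreover have "G z = (\<chi> k. g k (T - fst z) (snd z))" if "z \<in> S" for z
    using that G[of "fst z" "snd z"] by (auto simp: vec_eq_iff)
  ultimately show "continuous_on S G" by (simp cong: continuous_on_cong)
  show "bounded (G ` S)"
    by (rule bounded_vec_components[where C=C']) (use G b rev_mem in auto)
qed

lemma Y_Cb2: "Cb S (range eeta) 2 Y"
proof -
  note A = Cb0_reversed[where G=Y and g="\<lambda>k t x. U (I0 k, t, x)", OF Y U_c C]
  note B = Cb0_reversed[where G="pd S Y (eeta i)" and g="\<lambda>k t x. U (I1 k i, t, x)" for i, OF _ U_c C]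
  note D = Cb0_reversed[where G="pd S (pd S Y (eeta i)) (eeta j)" and g="\<lambda>k t x. U (I2 k i j, t, x)" for i j, OF _ U_c C]
  have B': "continuous_on S (pd S Y (eeta i))" "bounded (pd S Y (eeta i) ` S)" for i
    by (rule B; simp add: pd_Y)+
  have D': "continuous_on S (pd S (pd S Y (eeta i)) (eeta j))" "bounded (pd S (pd S Y (eeta i)) (eeta j) ` S)" for i j
    by (rule D; simp add: pd_pd_Y)+
  show ?thesis
    using A B' D' pd_Y(1) pd_pd_Y(1) by (auto simp: numeral_2_eq_2)
qed

lemma rhs_bounded: obtains C' where "\<And>k t x. t \<in> {0..\<tau>} \<Longrightarrow> \<bar>rhs k t x\<bar> \<le> C'"
proof -
  let ?n = "real CARD('n)"
  have C0: "0 \<le> C" using C[of 0 undefined undefined] tau by auto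
  have "\<bar>rhs k t x\<bar> \<le> \<bar>\<nu>\<bar> * (?n * C) + (B + ?n * ((B + C) * (R + 1)))" if t: "t \<in> {0..\<tau>}" for k t x
  proof -
    have "\<bar>\<Sum>j\<in>UNIV. U (I2 k j j, t, x)\<bar> \<le> ?n * C" by (rule abs_sum_le_card) (rule C[OF t])
    then have 1: "\<bar>\<nu> * (\<Sum>j\<in>UNIV. U (I2 k j j, t, x))\<bar> \<le> \<bar>\<nu>\<bar> * (?n * C)"
      unfolding abs_mult by (intro mult_left_mono) auto
    have "\<bar>(a j t x + U (I0 j, t, x)) * tr (U (I1 k j, t, x))\<bar> \<le> (B + C) * (R + 1)" for j
      unfolding abs_mult using a_le[OF t, of j x] C[OF t, of "I0 j" x] tr_le C0 B_nonneg by (intro mult_mono) auto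
    then have "\<bar>\<Sum>j\<in>UNIV. (a j t x + U (I0 j, t, x)) * tr (U (I1 k j, t, x))\<bar> \<le> ?n * ((B + C) * (R + 1))"
      by (rule abs_sum_le_card)
    then show ?thesis using 1 f_le[OF t, of k "(x, uvec U t x)"] unfolding rhs_def N0_def by linarith
  qed
  then show thesis by (rule that)
qed

text \<open>Reversing time changes the sign of the derivative, and the interval of admissible
  increments is one-sided at the two end times.\<close>

lemma Y_time:
  assumes t: "t \<in> {T - \<tau>..T}"
  shows "pd_exists S Y (1, 0) (t, x)" "pd S Y (1, 0) (t, x) = (\<chi> k. - rhs k (T - t) x)"
proof -
  have set: "{s. (t, x) + s *\<^sub>R (1, 0) \<in> S} = {T - \<tau> - t..T - t}" by auto
  have "((\<lambda>s. \<chi> k. U (I0 k, T - (t + s), x)) has_vector_derivative (\<chi> k. - rhs k (T - t) x)) (at 0 within {T - \<tau> - t..T - t})"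
  proof (rule has_vector_derivative_vec_lambda)
    fix k
    have im: "(\<lambda>s. T - (t + s)) ` {T - \<tau> - t..T - t} \<subseteq> {0..\<tau>}" by auto
    have "((\<lambda>r. U (I0 k, r, x)) has_real_derivative rhs k (T - t) x) (at (T - (t + 0)) within (\<lambda>s. T - (t + s)) ` {T - \<tau> - t..T - t})"
      using has_field_derivative_subset[OF U_time_derivative[OF rev_mem[OF t]] im] by simp
    moreover have "((\<lambda>s. T - (t + s)) has_real_derivative - 1) (at 0 within {T - \<tau> - t..T - t})"
      by (auto intro!: derivative_eq_intros)
    ultimately show "((\<lambda>s. U (I0 k, T - (t + s), x)) has_real_derivative - rhs k (T - t) x) (at 0 within {T - \<tau> - t..T - t})"
      using DERIV_image_chain[of "\<lambda>r. U (I0 k, r, x)" "rhs k (T - t) x" "\<lambda>s. T - (t + s)" 0 "{T - \<tau> - t..T - t}" "- 1"]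
      by (simp add: comp_def)
  qed
  then have v: "((\<lambda>s. Y ((t, x) + s *\<^sub>R (1, 0))) has_vector_derivative (\<chi> k. - rhs k (T - t) x)) (at 0 within {T - \<tau> - t..T - t})"
  proof (rule has_vector_derivative_transform[rotated 2])
    show "0 \<in> {T - \<tau> - t..T - t}" using t by auto
    show "Y ((t, x) + s *\<^sub>R (1, 0)) = (\<chi> k. U (I0 k, T - (t + s), x))" if "s \<in> {T - \<tau> - t..T - t}" for s
      using that Y[of "t + s" x] by (auto simp: vec_eq_iff)
  qed
  show "pd_exists S Y (1, 0) (t, x)" unfolding pd_exists_def set using v by (auto intro: differentiableI_vector)
  \<comment> \<open>The interval has positive length \<tau> and contains 0, so the derivative within
    it is unique even when 0 is an end point.\<close>
  show "pd S Y (1, 0) (t, x) = (\<chi> k. - rhs k (T - t) x)"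
    unfolding pd_def set
    using vector_derivative_within_cbox[of "T - \<tau> - t" "T - t" 0, unfolded cbox_interval, OF _ _ v] t tau by auto
qed

lemma Y_time_Cb0: "Cb S D 0 (pd S Y (1, 0))"
proof -
  obtain C' where C': "\<And>k t x. t \<in> {0..\<tau>} \<Longrightarrow> \<bar>rhs k t x\<bar> \<le> C'" by (rule rhs_bounded) blast
  have "cstrip \<tau> (\<lambda>t x. - rhs k t x)" for k using rhs_cstrip[of k] by (auto simp: cstrip_def intro!: continuous_intros)
  then have "continuous_on S (pd S Y (1, 0))" "bounded (pd S Y (1, 0) ` S)"
    by (rule Cb0_reversed[where g="\<lambda>k t x. - rhs k t x" and C'=C', rotated]; simp add: Y_time C')+
  then show ?thesis by simp
qed

lemma reversed_equation:
  assumes t: "t \<in> {T - \<tau>..T}"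
  shows "((\<lambda>s. rhs k (T - s) x) has_integral (U (I0 k, T - t, x) - h k x)) {t..T}"
proof -
  have "((\<lambda>s. rhs k s x) has_integral (U (I0 k, T - t, x) - h k x)) (cbox 0 (T - t))"
    using U_pde[OF rev_mem[OF t], of k x] by (simp add: rhs_def)
  from has_integral_affinity[OF this, of "-1" T]
  have "((\<lambda>s. rhs k (T - s) x) has_integral (U (I0 k, T - t, x) - h k x)) ((\<lambda>s. T - s) ` {0..T - t})" by simp
  moreover have "(\<lambda>s. T - s) ` {0..T - t} = {t..T}"
  proof
    show "{t..T} \<subseteq> (\<lambda>s. T - s) ` {0..T - t}"
    proof
      fix s assume "s \<in> {t..T}"
      then show "s \<in> (\<lambda>s. T - s) ` {0..T - t}" by (intro image_eqI[of _ _ "T - s"]) auto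
    qed
  qed auto
  ultimately show ?thesis by simp
qed

end

end

section \<open>Existence of an adapted solution\<close>

context stochastic_setting
begin

text \<open>The truncated problem is solved for each \<omega> of the full measure set; the
  truncation is then removed, the result extended measurably and reversed in time.\<close>

lemma solution_exists:
  defines "K \<equiv> Kconst T \<eta> F h \<Omega>0"
  shows "\<exists>yb. is_solution M Fl T \<nu> \<eta> F h (max 0 (T - lifespan (real CARD('n)) \<bar>K\<bar>)) yb"
proof -
  let ?n = "real CARD('n)" and ?c = "sqrt (2 * \<nu>)"
  have K0: "0 \<le> K" unfolding K_def by (rule K_bounds(1))
  have n1: "1 \<le> ?n" by (simp add: Suc_leI)
  \<comment> \<open>The lifespan may exceed \<open>T\<close>; the minimum corresponds to the cut at
    0 in the initial time.\<close>
  define \<tau> where "\<tau> = min T (lifespan ?n K)"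
  have taus: "0 < \<tau>" "\<tau> \<le> T" "\<tau> \<le> lifespan ?n K" using T_pos lifespan_pos[OF n1 K0] by (auto simp: \<tau>_def)
  have T0: "max 0 (T - lifespan ?n \<bar>K\<bar>) = T - \<tau>" using K0 by (auto simp: \<tau>_def)
  have sub: "t \<in> {0..T}" if "t \<in> {0..\<tau>}" for t using that taus by auto
  define R where "R = 2 * (?n * K + 1) + 1"
  have R0: "0 \<le> R" using K0 by (simp add: R_def)
  obtain tr tr' where tr: "\<And>r. (tr has_real_derivative tr' r) (at r)" "\<And>r. \<bar>tr' r\<bar> \<le> 1" "\<And>r s. \<bar>tr' r - tr' s\<bar> \<le> \<bar>r - s\<bar>"
    "\<And>r. \<bar>tr r\<bar> \<le> R + 1" "\<And>r. \<bar>r\<bar> \<le> R \<Longrightarrow> tr r = r"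
    using smooth_truncation_exists[OF R0] by blast
  obtain B where B: "0 \<le> B" "\<And>w. w \<in> \<Omega>0 \<Longrightarrow> Cb_bound SX (range eeta) 2 (eta_u \<eta> w) B"
    "\<And>w. w \<in> \<Omega>0 \<Longrightarrow> Cb_bound SF (range eFx \<union> range eFy) 2 (F_u F w) B"
    "\<And>w. w \<in> \<Omega>0 \<Longrightarrow> Cb_bound UNIV (range eh) 2 (\<lambda>x. h x w) B" by (rule bound_data) blast
  have burg: "burgers ?c tr tr' (etac w) (detac w) (Fc w) (Fxc w) (Fyc w) (hc w) (dhc w) (ddhc w) \<tau> \<nu> B R" if "w \<in> \<Omega>0" for w
    by (rule burgers_data[OF that taus(1,2) R0 tr B(2-4)[OF that]])
  let ?P = "\<lambda>w. burgers_operator.Phi ?c tr tr' (etac w) (detac w) (Fc w) (Fxc w) (Fyc w) (hc w) (dhc w) (ddhc w)"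
  have "\<exists>U C. burgers_solution ?c tr tr' (etac w) (detac w) (Fc w) (Fxc w) (Fyc w) (hc w) (dhc w) (ddhc w) \<tau> \<nu> B R K C U
      \<and> (\<forall>q t x. t \<in> {0..\<tau>} \<longrightarrow> \<bar>U (q, t, x)\<bar> \<le> C)
      \<and> (\<forall>q t x. t \<in> {0..\<tau>} \<longrightarrow> (\<lambda>m. (?P w ^^ m) (\<lambda>_. 0) (q, t, x)) \<longlonglongrightarrow> U (q, t, x))" if w: "w \<in> \<Omega>0" for w
  proof -
    interpret burgers ?c tr tr' "etac w" "detac w" "Fc w" "Fxc w" "Fyc w" "hc w" "dhc w" "ddhc w" \<tau> \<nu> B R
      by (rule burg[OF w])
    obtain U l0 l1 where l: "0 < l0" "0 < l1" and U: "U \<in> Adm (2 * B + 1) l0 (2 * B + 1) l1"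
      and fixp: "\<And>q t x. t \<in> {0..\<tau>} \<Longrightarrow> Phi U (q, t, x) = U (q, t, x)"
      and lim: "\<And>q t x. t \<in> {0..\<tau>} \<Longrightarrow> (\<lambda>m. (Phi ^^ m) (\<lambda>_. 0) (q, t, x)) \<longlonglongrightarrow> U (q, t, x)"
      by (rule mild_solution_exists) blast
    define C where "C = (2 * B + 1) * exp (l0 * \<tau>) + (2 * B + 1) * exp (l1 * \<tau>)"
    have b: "0 \<le> 2 * B + 1" using B(1) by simp
    have C: "\<bar>U (q, t, x)\<bar> \<le> C" if "t \<in> {0..\<tau>}" for q t x
      unfolding C_def by (rule Adm_bound[OF U that b b l])
    have "burgers_solution ?c tr tr' (etac w) (detac w) (Fc w) (Fxc w) (Fyc w) (hc w) (dhc w) (ddhc w) \<tau> \<nu> B R K C U"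
    proof (unfold_locales)
      fix i j k :: 'n and t and x :: "real^'n" and p :: "(real^'n) \<times> (real^'n)"
      show "\<tau> \<le> lifespan ?n K" by (rule taus(3))
      show "\<bar>dhc w k i x\<bar> \<le> K" unfolding K_def by (rule K_bounds(2)[OF w])
      assume t: "t \<in> {0..\<tau>}"
      show "\<bar>detac w j i t x\<bar> \<le> K" unfolding K_def by (rule K_bounds(3)[OF w sub[OF t]])
      show "\<bar>Fxc w k i t p\<bar> \<le> K" unfolding K_def by (rule K_bounds(4)[OF w sub[OF t]])
      show "\<bar>Fyc w k i t p\<bar> \<le> K" unfolding K_def by (rule K_bounds(5)[OF w sub[OF t]])
      show "((\<lambda>s. \<nu> * (\<Sum>j\<in>UNIV. U (I2 k j j, s, x)) + N0 U k s x) has_integral (U (I0 k, t, x) - hc w k x)) {0..t}"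
        by (rule mild_solution_pde[OF l U fixp t])
      show "pder i (\<lambda>x. U (I0 k, t, x)) (\<lambda>x. U (I1 k i, t, x))" by (rule AdmD(5)[OF U t])
      show "pder j (\<lambda>x. U (I1 k i, t, x)) (\<lambda>x. U (I2 k i j, t, x))" by (rule AdmD(6)[OF U t])
    qed (use K0 taus AdmD(1)[OF U] C in \<open>auto simp: R_def\<close>)
    then show ?thesis using C lim by blast
  qed
  then obtain U C where sol: "\<And>w. w \<in> \<Omega>0 \<Longrightarrow> burgers_solution ?c tr tr' (etac w) (detac w) (Fc w) (Fxc w) (Fyc w) (hc w) (dhc w) (ddhc w) \<tau> \<nu> B R K (C w) (U w)"
    and C: "\<And>w q t x. w \<in> \<Omega>0 \<Longrightarrow> t \<in> {0..\<tau>} \<Longrightarrow> \<bar>U w (q, t, x)\<bar> \<le> C w"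
    and lim: "\<And>w q t x. w \<in> \<Omega>0 \<Longrightarrow> t \<in> {0..\<tau>} \<Longrightarrow> (\<lambda>m. (?P w ^^ m) (\<lambda>_. 0) (q, t, x)) \<longlonglongrightarrow> U w (q, t, x)"
    by metis
  have Um: "(\<lambda>w. U w (q, t, x)) \<in> borel_measurable (restrict_space (Fl t) \<Omega>0)" if t: "t \<in> {0..\<tau>}" for q t x
  proof (rule borel_measurable_LIMSEQ_real)
    show "(\<lambda>m. (?P w ^^ m) (\<lambda>_. 0) (q, t, x)) \<longlonglongrightarrow> U w (q, t, x)" if "w \<in> space (restrict_space (Fl t) \<Omega>0)" for w
      by (rule lim[OF _ t]) (use that space_N[OF sub[OF t]] in simp)
    show "(\<lambda>w. (?P w ^^ m) (\<lambda>_. 0) (q, t, x)) \<in> borel_measurable (restrict_space (Fl t) \<Omega>0)" for m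
      by (rule Phi_iterate_measurable[where N="\<lambda>t. restrict_space (Fl t) \<Omega>0" and \<Omega>=\<Omega>0 and \<tau>=\<tau>,
          OF space_N[OF sub] measurable_N_mono[OF _ sub] burg data_measurable(1)[OF sub] data_measurable(2)[OF sub]
          data_measurable(3)[OF sub] data_measurable(4)[OF sub] data_measurable(5)[OF sub] data_measurable(6-8) t])
  qed
  \<comment> \<open>The limit is measurable on \<open>\<Omega>0\<close> for the trace
    \<sigma>-algebra; the extension provides a version measurable for \<open>Fl t\<close> itself,
    agreeing at every point of \<open>\<Omega>0\<close>.\<close>
  have "\<exists>g. g \<in> borel_measurable (Fl t) \<and> (\<forall>w\<in>\<Omega>0. g w = U w (I0 k, t, x))" if t: "t \<in> {0..\<tau>}" for t k x
    using borel_measurable_restrict_extend[OF Um[OF t], of "I0 k" x] \<Omega>_sub filt sub[OF t]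
    unfolding filtration_on_def subalgebra_def by fastforce
  then obtain G where G: "\<And>t k x. t \<in> {0..\<tau>} \<Longrightarrow> G t k x \<in> borel_measurable (Fl t)"
    "\<And>t k x w. t \<in> {0..\<tau>} \<Longrightarrow> w \<in> \<Omega>0 \<Longrightarrow> G t k x w = U w (I0 k, t, x)"
    by metis
  define yb where "yb t x w = (\<chi> k. G (T - t) k x w)" for t x w
  have yb: "yb t x w $ k = U w (I0 k, T - t, x)" if "t \<in> {T - \<tau>..T}" "w \<in> \<Omega>0" for t x w k
    using that by (simp add: yb_def G(2))
  have "is_solution M Fl T \<nu> \<eta> F h (T - \<tau>) yb"
    unfolding is_solution_def
  proof (intro conjI ballI allI)
    fix t x assume "t \<in> {T - \<tau>..T}"
    then have "T - t \<in> {0..\<tau>}" by auto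
    then show "(\<lambda>w. yb t x w) \<in> borel_measurable (Fl (T - t))"
      by (intro borel_measurable_vec) (simp add: yb_def G(1))
  next
    interpret prob_space M by (rule prob)
    have "AE w in M. w \<in> \<Omega>0"
      using AE_in_set_eq_1[OF \<Omega>_sets] \<Omega>_full emeasure_space_1 by (simp add: emeasure_eq_measure)
    then show "AE w in M. let S = {T - \<tau>..T} \<times> UNIV; Y = eta_u yb w in
        Cb S (range eeta) 2 Y \<and> (\<forall>z\<in>S. pd_exists S Y (1, 0) z) \<and> Cb S (range eeta) 0 (pd S Y (1, 0)) \<and>
        (\<forall>t\<in>{T - \<tau>..T}. \<forall>x. ((\<lambda>s. \<nu> *\<^sub>R (\<Sum>i\<in>UNIV. pd S (pd S Y (eeta i)) (eeta i) (s, x))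
           - (\<Sum>j\<in>UNIV. ((\<eta> (T - s) x w + yb s x w) $ j) *\<^sub>R pd S Y (eeta j) (s, x))
           + F (T - s) x (yb s x w) w) has_integral (yb t x w - h x w)) {t..T})"
    proof (eventually_elim)
      case (elim w)
      note w = elim
      interpret burgers_solution ?c tr tr' "etac w" "detac w" "Fc w" "Fxc w" "Fyc w" "hc w" "dhc w" "ddhc w" \<tau> \<nu> B R K "C w" "U w"
        by (rule sol[OF w])
      let ?S = "{T - \<tau>..T} \<times> (UNIV :: (real^'n) set)" and ?Y = "eta_u yb w"
      have Y: "?Y (t, x) $ k = U w (I0 k, T - t, x)" if "t \<in> {T - \<tau>..T}" for t x k
        using yb[OF that w] by (simp add: eta_u_def)
      note CC = C[OF w]
      have eqn: "((\<lambda>s. \<nu> *\<^sub>R (\<Sum>i\<in>UNIV. pd ?S (pd ?S ?Y (eeta i)) (eeta i) (s, x))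
           - (\<Sum>j\<in>UNIV. ((\<eta> (T - s) x w + yb s x w) $ j) *\<^sub>R pd ?S ?Y (eeta j) (s, x))
           + F (T - s) x (yb s x w) w) has_integral (yb t x w - h x w)) {t..T}" if t: "t \<in> {T - \<tau>..T}" for t x
      proof (rule has_integral_vec)
        fix k
        have I: "((\<lambda>s. rhs k (T - s) x) has_integral (yb t x w - h x w) $ k) {t..T}"
          using reversed_equation[where Y="?Y" and C="C w", OF Y CC t, of k x] by (simp add: yb[OF t w] hc_def)
        show "((\<lambda>s. (\<nu> *\<^sub>R (\<Sum>i\<in>UNIV. pd ?S (pd ?S ?Y (eeta i)) (eeta i) (s, x))
           - (\<Sum>j\<in>UNIV. ((\<eta> (T - s) x w + yb s x w) $ j) *\<^sub>R pd ?S ?Y (eeta j) (s, x))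
           + F (T - s) x (yb s x w) w) $ k) has_integral (yb t x w - h x w) $ k) {t..T}"
        proof (rule has_integral_eq[OF _ I])
          fix s assume "s \<in> {t..T}"
          then have s: "s \<in> {T - \<tau>..T}" using t by auto
          have r: "T - s \<in> {0..\<tau>}" using s by auto
          have uv: "uvec (U w) (T - s) x = yb s x w" by (simp add: uvec_def vec_eq_iff yb[OF s w])
          have p1: "pd ?S ?Y (eeta i) (s, x) = (\<chi> k. U w (I1 k i, T - s, x))" for i
            by (rule pd_Y(2)[where C="C w"]) (use Y CC s in auto)
          have p2: "pd ?S (pd ?S ?Y (eeta i)) (eeta j) (s, x) = (\<chi> k. U w (I2 k i j, T - s, x))" for i j
            by (rule pd_pd_Y(2)[where C="C w"]) (use Y CC s in auto)
          show "rhs k (T - s) x = (\<nu> *\<^sub>R (\<Sum>i\<in>UNIV. pd ?S (pd ?S ?Y (eeta i)) (eeta i) (s, x))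
             - (\<Sum>j\<in>UNIV. ((\<eta> (T - s) x w + yb s x w) $ j) *\<^sub>R pd ?S ?Y (eeta j) (s, x))
             + F (T - s) x (yb s x w) w) $ k"
            unfolding rhs_def truncation_inactive[OF r] uv p1 p2
            by (simp add: yb[OF s w] etac_def Fc_def)
        qed
      qed
      show ?case
        unfolding Let_def
      proof (intro conjI ballI allI eqn)
        show "Cb ?S (range eeta) 2 ?Y" by (rule Y_Cb2[where C="C w"]) (use Y CC in auto)
        show "Cb ?S (range eeta) 0 (pd ?S ?Y (1, 0))" by (rule Y_time_Cb0[where C="C w"]) (use Y CC in auto)
        show "pd_exists ?S ?Y (1, 0) z" if "z \<in> ?S" for z
        proof -
          obtain t x where z: "z = (t, x)" by (cases z)
          show ?thesis unfolding z by (rule Y_time(1)[where C="C w"]) (use Y CC that z in auto)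
        qed
      qed
    qed
  qed
  then show ?thesis unfolding T0 by blast
qed

end

theorem mainTheorem6:
  shows "\<exists>\<gamma>::real \<Rightarrow> real \<Rightarrow> real. (\<forall>k c. \<gamma> k c > 0) \<and>
    (\<forall>(M::'w measure) Fl T \<nu> (\<eta>::real \<Rightarrow> real^'n::finite \<Rightarrow> 'w \<Rightarrow> real^'n) F h \<Omega>0.
       setting M Fl T \<nu> \<eta> F h \<Omega>0 \<longrightarrow>
       (\<exists>yb. is_solution M Fl T \<nu> \<eta> F h
                (max 0 (T - \<gamma> (Kconst T \<eta> F h \<Omega>0) (Cconst T \<eta> F h \<Omega>0))) yb))"
proof (intro exI[of _ "\<lambda>k c. lifespan (real CARD('n)) \<bar>k\<bar>"] conjI allI impI)
  \<comment> \<open>The absolute value secures positivity at every real argument; for actual data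
    \<open>Kconst\<close> is nonnegative and nothing changes.\<close>
  show "0 < lifespan (real CARD('n)) \<bar>k\<bar>" for k by (rule lifespan_pos) (auto simp: Suc_leI)
  fix M :: "'w measure" and Fl T \<nu> F h \<Omega>0 and \<eta> :: "real \<Rightarrow> real^'n \<Rightarrow> 'w \<Rightarrow> real^'n"
  assume "setting M Fl T \<nu> \<eta> F h \<Omega>0"
  then interpret stochastic_setting M Fl T \<nu> \<eta> F h \<Omega>0 by unfold_locales
  show "\<exists>yb. is_solution M Fl T \<nu> \<eta> F h (max 0 (T - lifespan (real CARD('n)) \<bar>Kconst T \<eta> F h \<Omega>0\<bar>)) yb"
    by (rule solution_exists)
qed

end
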